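(* For every fixed positive integer $s$ and every fixed bound on $|\mathcal I|$, Factorized binary polynomial optimization (Problem F) can be solved in strongly polynomial time.
   Context: Factorized binary polynomial optimization (Problem F): the input consists of positive integers $s$ and $n_j$ for $j\in[s]=\{1,\dots,s\}$, a nonempty family $\mathcal I$ of subsets of $[s]$, and vectors $c^{I,j}\in\mathbb Q^{n_j}$ for $I\in\mathcal I$, $j\in I$. The problem is $$\max_{x^1,\dots,x^s}\ \sum_{I\in\mathcal I}\prod_{j\in I}\langle c^{I,j},x^j\rangle\quad\text{s.t. } x^j\in\{0,1\}^{n_j}\ \ \forall j\in[s],$$ where $\langle a,b\rangle$ is the inner product. "Strongly polynomial time" means the number of arithmetic operations is bounded by a polynomial in the number of input numbers (here in $n_1,\dots,n_s,|\mathcal I|$) and the sizes of all numbers produced are polynomial in the input size. *)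

theory Defs
  imports Complex_Main
begin

text \<open>An instance: s blocks, block j (1 \<le> j \<le> s) has n j variables x j 1, ..., x j (n j);
  the family is given as a duplicate-free list Is of subsets of {1..s};
  c I j i is the i-th entry (1 \<le> i \<le> n j) of the vector c^{I,j}.\<close>

definition wf_instance :: "nat \<Rightarrow> (nat \<Rightarrow> nat) \<Rightarrow> nat set list \<Rightarrow> bool" where
  "wf_instance s n Is \<longleftrightarrow> s > 0 \<and> (\<forall>j\<in>{1..s}. n j > 0) \<and> Is \<noteq> [] \<and> distinct Is
     \<and> (\<forall>I\<in>set Is. I \<subseteq> {1..s})"

definition is_binary :: "nat \<Rightarrow> (nat \<Rightarrow> nat) \<Rightarrow> (nat \<Rightarrow> nat \<Rightarrow> rat) \<Rightarrow> bool" where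
  "is_binary s n x \<longleftrightarrow> (\<forall>j\<in>{1..s}. \<forall>i\<in>{1..n j}. x j i \<in> {0, 1})"

definition objF :: "(nat \<Rightarrow> nat) \<Rightarrow> nat set list \<Rightarrow> (nat set \<Rightarrow> nat \<Rightarrow> nat \<Rightarrow> rat)
     \<Rightarrow> (nat \<Rightarrow> nat \<Rightarrow> rat) \<Rightarrow> rat" where
  "objF n Is c x = (\<Sum>I\<in>set Is. \<Prod>j\<in>I. \<Sum>i\<in>{1..n j}. c I j i * x j i)"

definition enc_set :: "nat \<Rightarrow> (nat \<Rightarrow> nat) \<Rightarrow> (nat set \<Rightarrow> nat \<Rightarrow> nat \<Rightarrow> rat) \<Rightarrow> nat set \<Rightarrow> rat list" where
  "enc_set s n c I =
     map (\<lambda>j. if j \<in> I then 1 else 0) [1..<s+1] @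
     concat (map (\<lambda>j. if j \<in> I then map (c I j) [1..<n j + 1] else replicate (n j) 0) [1..<s+1])"

definition encode :: "nat \<Rightarrow> (nat \<Rightarrow> nat) \<Rightarrow> nat set list \<Rightarrow> (nat set \<Rightarrow> nat \<Rightarrow> nat \<Rightarrow> rat) \<Rightarrow> rat list" where
  "encode s n Is c =
     [of_nat s] @ map (\<lambda>j. of_nat (n j)) [1..<s+1] @ [of_nat (length Is)] @
     concat (map (enc_set s n c) Is)"

definition bitlen :: "int \<Rightarrow> nat" where
  "bitlen k = (LEAST l. \<bar>k\<bar> < 2 ^ l)"

definition rat_size :: "rat \<Rightarrow> nat" where
  "rat_size q = (case quotient_of q of (a, b) \<Rightarrow> 1 + bitlen a + bitlen b)"

definition input_size :: "rat list \<Rightarrow> nat" where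
  "input_size xs = length xs + sum_list (map rat_size xs)"

text \<open>Registers are indexed by natural numbers; each step executes one elementary
  operation (arithmetic operation, comparison, constant, indirect load/store).
  Division by zero yields 0 (HOL convention). Indirect addresses are nat of the floor.\<close>

datatype instr =
    Const nat rat
  | Add nat nat nat
  | Sub nat nat nat
  | Mul nat nat nat
  | Dvd nat nat nat
  | LoadI nat nat
  | StoreI nat nat
  | JmpLe nat nat nat
  | Halt

type_synonym prog = "instr list"
type_synonym config = "nat \<times> (nat \<Rightarrow> rat)"

definition addr :: "rat \<Rightarrow> nat" where
  "addr q = nat \<lfloor>q\<rfloor>"

definition halted :: "prog \<Rightarrow> config \<Rightarrow> bool" where
  "halted P cf \<longleftrightarrow> fst cf \<ge> length P \<or> P ! fst cf = Halt"

fun exec :: "instr \<Rightarrow> config \<Rightarrow> config" where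
  "exec (Const r q) (pc, m) = (Suc pc, m(r := q))"
| "exec (Add r a b) (pc, m) = (Suc pc, m(r := m a + m b))"
| "exec (Sub r a b) (pc, m) = (Suc pc, m(r := m a - m b))"
| "exec (Mul r a b) (pc, m) = (Suc pc, m(r := m a * m b))"
| "exec (Dvd r a b) (pc, m) = (Suc pc, m(r := m a / m b))"
| "exec (LoadI r a) (pc, m) = (Suc pc, m(r := m (addr (m a))))"
| "exec (StoreI a r) (pc, m) = (Suc pc, m(addr (m a) := m r))"
| "exec (JmpLe a b l) (pc, m) = (if m a \<le> m b then l else Suc pc, m)"
| "exec Halt (pc, m) = (pc, m)"

definition step :: "prog \<Rightarrow> config \<Rightarrow> config" where
  "step P cf = (if halted P cf then cf else exec (P ! fst cf) cf)"

definition init_config :: "rat list \<Rightarrow> config" where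
  "init_config xs = (0, \<lambda>a. if a < length xs then xs ! a else 0)"

definition run :: "prog \<Rightarrow> rat list \<Rightarrow> nat \<Rightarrow> config" where
  "run P xs t = (step P ^^ t) (init_config xs)"

definition out_pos :: "(nat \<Rightarrow> nat) \<Rightarrow> nat \<Rightarrow> nat \<Rightarrow> nat" where
  "out_pos n j i = (\<Sum>j'\<in>{1..<j}. n j') + (i - 1)"

definition output_x :: "(nat \<Rightarrow> nat) \<Rightarrow> (nat \<Rightarrow> rat) \<Rightarrow> nat \<Rightarrow> nat \<Rightarrow> rat" where
  "output_x n m j i = m (out_pos n j i)"

definition solves_F_strongly_poly :: "nat \<Rightarrow> nat \<Rightarrow> prog \<Rightarrow> nat \<Rightarrow> nat \<Rightarrow> bool" where
  "solves_F_strongly_poly s k P C D \<longleftrightarrow>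
     (\<forall>n Is c. wf_instance s n Is \<and> length Is \<le> k \<longrightarrow>
        (let xs = encode s n Is c in
         \<exists>t. t \<le> C * (length xs + 1) ^ D \<and> halted P (run P xs t)
           \<and> (\<forall>t'\<le>t. \<forall>a. rat_size (snd (run P xs t') a) \<le> C * (input_size xs + 1) ^ D)
           \<and> is_binary s n (output_x n (snd (run P xs t)))
           \<and> (\<forall>y. is_binary s n y \<longrightarrow>
                   objF n Is c y \<le> objF n Is c (output_x n (snd (run P xs t))))))"

end

theory Submission
  imports Defs "HOL-Library.Nat_Bijection" "HOL-Library.FuncSet"
begin

text \<open>For fixed other blocks the objective is linear in one block \<open>x\<^sup>j\<close>, and it depends on
  \<open>x\<^sup>j\<close> only through the at most \<open>k\<close> inner products with the \<open>c\<^sup>I\<^sup>,\<^sup>j\<close>. So some optimal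
  solution is the sign pattern of a generic linear functional on the vectors formed by the
  coefficients of the single variables. Every such pattern can be read off a short code, namely
  one pivot vector and one sign per coordinate: eliminate the coordinates successively with the
  pivots; the sign of a vector is decided by the last coordinate that was nonzero when it was
  eliminated. As the number of coordinates is bounded by the constant \<open>k s\<close>, there are polynomially
  many codes, and enumerating them needs only arithmetic expressions of constant depth and sums.

  Missing sets are padded by zero coefficients, which adds the constant 1 to the objective for
  each of them, so that always exactly \<open>k\<close> sets are processed.\<close>

text \<open>The gradient of the objective at an optimal selection need not be generic: ties leave
  the sign of some variables open. It is therefore replaced by \<open>T * \<mu> + g\<close>, where
  \<open>g\<close> avoids finitely many hyperplanes and \<open>T\<close> is so large that
  \<open>g\<close> only decides ties; the optimum itself is chosen to maximise \<open>g\<close>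
  among all optima. Exchanging any single block for the sign pattern of this functional then changes
  no inner product at all. This is what allows all blocks to be exchanged at once, although the
  objective is linear only in each block separately.

  There are only \<open>k * s\<close> eliminations, so the growth of unreduced fractions by a factor
  of about four per elimination is harmless.

  The machine adds an obstacle of its own. Input and output both start at cell 0 and have unbounded
  length, so they overlap every fixed register. Before the input is moved, cell 0 is the only
  working register, hence the target address \<open>2 ^ E * N\<close>, which additions alone can
  produce. At the end, the last output cells must be loaded through the very registers that they
  replace.\<close>

section \<open>Sizes of rational numbers\<close>

text \<open>The fraction need not be in lowest terms, so that bounds compose without any reduction.
  \<open>bnd 0 q\<close> never holds, since the denominator would be zero.\<close>

definition bnd :: "nat \<Rightarrow> rat \<Rightarrow> bool" where
  "bnd h q \<longleftrightarrow> (\<exists>a b :: int. b \<noteq> 0 \<and> \<bar>a\<bar> < 2 ^ h \<and> \<bar>b\<bar> < 2 ^ h \<and> q = of_int a / of_int b)"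

lemma bndI: "b \<noteq> 0 \<Longrightarrow> \<bar>a\<bar> < 2 ^ h \<Longrightarrow> \<bar>b\<bar> < 2 ^ h \<Longrightarrow> q = of_int a / of_int b \<Longrightarrow> bnd h q"
  unfolding bnd_def by blast

lemma bnd_mono: "bnd h q \<Longrightarrow> h \<le> h' \<Longrightarrow> bnd h' q"
proof -
  assume "bnd h q" "h \<le> h'"
  then obtain a b :: int where *: "b \<noteq> 0" "\<bar>a\<bar> < 2 ^ h" "\<bar>b\<bar> < 2 ^ h" "q = of_int a / of_int b"
    unfolding bnd_def by blast
  moreover from \<open>h \<le> h'\<close> have "(2::int) ^ h \<le> 2 ^ h'" by simp
  ultimately show ?thesis by (intro bndI[of b a]) linarith+
qed

lemma int_mult_less: "\<bar>a\<bar> < x \<Longrightarrow> \<bar>b\<bar> < y \<Longrightarrow> \<bar>a * b\<bar> < x * (y :: int)"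
  unfolding abs_mult by (intro mult_strict_mono') auto

lemma bnd_add:
  assumes "bnd h q" "bnd h' q'"
  shows "bnd (h + h' + 1) (q + q')"
proof -
  from assms obtain a b c d :: int where *: "b \<noteq> 0" "\<bar>a\<bar> < 2 ^ h" "\<bar>b\<bar> < 2 ^ h" "q = of_int a / of_int b"
     "d \<noteq> 0" "\<bar>c\<bar> < 2 ^ h'" "\<bar>d\<bar> < 2 ^ h'" "q' = of_int c / of_int d" unfolding bnd_def by blast
  have "\<bar>a * d\<bar> < 2 ^ h * 2 ^ h'" "\<bar>b * c\<bar> < 2 ^ h * 2 ^ h'" "\<bar>b * d\<bar> < 2 ^ h * 2 ^ h'"
    using * by (auto intro!: int_mult_less)
  hence "\<bar>a * d + b * c\<bar> < 2 ^ (h + h' + 1)" "\<bar>b * d\<bar> < 2 ^ (h + h' + 1)"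
    by (simp_all add: power_add)
  moreover have "q + q' = of_int (a * d + b * c) / of_int (b * d)"
    using * by (simp add: field_simps)
  ultimately show ?thesis using * by (intro bndI[of "b * d" "a * d + b * c"]) auto
qed

lemma bnd_uminus: "bnd h q \<Longrightarrow> bnd h (- q)"
  unfolding bnd_def by (metis abs_minus_cancel minus_divide_left of_int_minus)

lemma bnd_diff: "bnd h q \<Longrightarrow> bnd h' q' \<Longrightarrow> bnd (h + h' + 1) (q - q')"
  using bnd_add[of h q h' "- q'"] bnd_uminus by simp

lemma bnd_mult:
  assumes "bnd h q" "bnd h' q'"
  shows "bnd (h + h') (q * q')"
proof -
  from assms obtain a b c d :: int where *: "b \<noteq> 0" "\<bar>a\<bar> < 2 ^ h" "\<bar>b\<bar> < 2 ^ h" "q = of_int a / of_int b"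
     "d \<noteq> 0" "\<bar>c\<bar> < 2 ^ h'" "\<bar>d\<bar> < 2 ^ h'" "q' = of_int c / of_int d" unfolding bnd_def by blast
  have "\<bar>a * c\<bar> < 2 ^ h * 2 ^ h'" "\<bar>b * d\<bar> < 2 ^ h * 2 ^ h'"
    using * by (auto intro!: int_mult_less)
  with * show ?thesis by (intro bndI[of "b * d" "a * c"]) (auto simp: power_add)
qed

lemma bnd_nat: "a \<le> h \<Longrightarrow> 0 < h \<Longrightarrow> bnd h (of_nat a)"
proof -
  assume "a \<le> h" "0 < h"
  hence "int a < 2 ^ h"
    by (metis less_exp of_nat_less_iff of_nat_numeral of_nat_power order_le_less_trans)
  moreover have "(1::int) < 2 ^ h" using \<open>0 < h\<close> by simp
  ultimately show ?thesis by (intro bndI[of 1 "int a"]) auto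
qed

lemma bnd_0: "0 < h \<Longrightarrow> bnd h 0" using bnd_nat[of 0 h] by simp
lemma bnd_1: "0 < h \<Longrightarrow> bnd h 1" using bnd_nat[of 1 h] by simp

lemma bnd_divide:
  assumes "bnd h q" "bnd h' q'"
  shows "bnd (h + h') (q / q')"
proof (cases "q' = 0")
  case True
  \<comment> \<open>The quotient is 0 by convention, and \<open>bnd h 0\<close> needs a nonzero
    \<open>h\<close>.\<close>
  from assms(1) have "h \<noteq> 0" unfolding bnd_def by (cases h) auto
  thus ?thesis using True by (auto intro: bnd_0)
next
  case False
  from assms(2) obtain c d :: int where "d \<noteq> 0" "\<bar>c\<bar> < 2 ^ h'" "\<bar>d\<bar> < 2 ^ h'" "q' = of_int c / of_int d"
    unfolding bnd_def by blast
  with False have "bnd h' (inverse q')" by (intro bndI[of c d]) auto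
  from bnd_mult[OF assms(1) this] show ?thesis by (simp add: field_simps)
qed

lemma bnd_sum:
  assumes "finite A" "\<And>x. x \<in> A \<Longrightarrow> bnd h (f x)"
  shows "bnd (card A * (h + 1) + 1) (sum f A)"
  using assms
proof (induction A rule: finite_induct)
  case empty
  show ?case by (simp add: bnd_0)
next
  case (insert x A)
  have "bnd (h + (card A * (h + 1) + 1) + 1) (f x + sum f A)"
    using insert by (intro bnd_add) auto
  thus ?case using insert by (auto elim!: bnd_mono)
qed

lemma bnd_prod:
  assumes "finite A" "\<And>x. x \<in> A \<Longrightarrow> bnd h (f x)"
  shows "bnd (card A * h + 1) (prod f A)"
  using assms
proof (induction A rule: finite_induct)
  case empty
  show ?case by (simp add: bnd_1)
next
  case (insert x A)
  have "bnd (h + (card A * h + 1)) (f x * prod f A)"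
    using insert by (intro bnd_mult) auto
  thus ?case using insert by (auto elim!: bnd_mono)
qed

lemma bitlen_bound: "\<bar>a\<bar> < 2 ^ bitlen a"
  unfolding bitlen_def
proof (rule LeastI[of _ "nat \<bar>a\<bar>"])
  have "\<bar>a\<bar> = int (nat \<bar>a\<bar>)" by simp
  also have "\<dots> < int (2 ^ nat \<bar>a\<bar>)" using less_exp of_nat_less_iff by blast
  finally show "\<bar>a\<bar> < 2 ^ nat \<bar>a\<bar>" by simp
qed

lemma bitlen_le: "\<bar>a\<bar> < 2 ^ l \<Longrightarrow> bitlen a \<le> l"
  unfolding bitlen_def by (rule Least_le)

text \<open>The denominator in lowest terms divides that of any other representation, so reducing a
  fraction cannot lengthen it.\<close>

lemma rat_size_le:
  assumes "bnd h q"
  shows "rat_size q \<le> 2 * h + 1"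
proof -
  obtain a b :: int where *: "b \<noteq> 0" "\<bar>a\<bar> < 2 ^ h" "\<bar>b\<bar> < 2 ^ h" "q = of_int a / of_int b"
    using assms unfolding bnd_def by blast
  obtain c d where q: "quotient_of q = (c, d)" by fastforce
  have d: "d > 0" "coprime c d" "q = of_int c / of_int d"
    using q quotient_of_denom_pos quotient_of_coprime quotient_of_div by blast+
  have "of_int (a * d) = (of_int (c * b) :: rat)" using * d by (simp add: field_simps)
  hence eq: "a * d = c * b" using of_int_eq_iff by blast
  have "d dvd b" using d(2) eq by (metis coprime_commute coprime_dvd_mult_right_iff dvd_triv_right)
  then obtain e where e: "b = d * e" by blast
  with eq d(1) have a: "a = c * e" by simp
  have "e \<noteq> 0" using e * by auto
  hence "\<bar>c\<bar> \<le> \<bar>a\<bar>" "\<bar>d\<bar> \<le> \<bar>b\<bar>" using a e by (auto simp: abs_mult mult_le_cancel_left1)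
  hence "bitlen c \<le> h" "bitlen d \<le> h" using * by (auto intro!: bitlen_le)
  thus ?thesis by (simp add: rat_size_def q)
qed

lemma bnd_rat_size: "rat_size q \<le> h \<Longrightarrow> bnd h q"
proof -
  assume h: "rat_size q \<le> h"
  obtain c d where q: "quotient_of q = (c, d)" by fastforce
  have d: "d > 0" "q = of_int c / of_int d"
    using q quotient_of_denom_pos quotient_of_div by blast+
  have "bitlen c \<le> h" "bitlen d \<le> h" using h q by (auto simp: rat_size_def)
  hence "\<bar>c\<bar> < 2 ^ h" "\<bar>d\<bar> < 2 ^ h"
    using bitlen_bound[of c] bitlen_bound[of d]
    by (meson less_le_trans one_le_numeral power_increasing)+
  thus ?thesis using d by (intro bndI[of d c]) auto
qed

section \<open>A structured language over the machine\<close>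

type_synonym mem = "nat \<Rightarrow> rat"

definition rO :: nat where "rO = 1"

text \<open>\<open>Wh\<close> is a counting loop that does its own increment, so the number of
  iterations is known on entry and no use needs a separate termination argument. The increment adds
  \<open>rO\<close>, because the machine has no immediate operands.\<close>

datatype com = B instr | Skip | Seq com com (infixr ";;" 60) | IfLe nat nat com com | Wh nat nat com

abbreviation For :: "nat \<Rightarrow> nat \<Rightarrow> com \<Rightarrow> com" where
  "For i r c \<equiv> B (Const i 0) ;; Wh i r c"

fun clen :: "com \<Rightarrow> nat" where
  "clen (B i) = 1"
| "clen Skip = 0"
| "clen (c ;; d) = clen c + clen d"
| "clen (IfLe a b c d) = clen c + clen d + 2"
| "clen (Wh i r c) = clen c + 3"

text \<open>The first argument of \<open>compile\<close> is the absolute address of the code; \<open>JmpLe 0 0\<close> always jumps.\<close>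

fun compile :: "nat \<Rightarrow> com \<Rightarrow> instr list" where
  "compile p (B i) = [i]"
| "compile p Skip = []"
| "compile p (c ;; d) = compile p c @ compile (p + clen c) d"
| "compile p (IfLe a b c d) = JmpLe a b (p + clen d + 2) # compile (p + 1) d @
     JmpLe 0 0 (p + clen d + 2 + clen c) # compile (p + clen d + 2) c"
| "compile p (Wh i r c) = JmpLe r i (p + clen c + 3) # compile (p + 1) c @ [Add i i rO, JmpLe 0 0 p]"

fun cost :: "nat \<Rightarrow> com \<Rightarrow> nat" where
  "cost M (B i) = 1"
| "cost M Skip = 0"
| "cost M (c ;; d) = cost M c + cost M d"
| "cost M (IfLe a b c d) = cost M c + cost M d + 2"
| "cost M (Wh i r c) = M * (cost M c + 3) + 1"

lemma length_compile [simp]: "length (compile p c) = clen c"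
  by (induction c arbitrary: p) auto

text \<open>Each loop raises the degree by one. As \<open>C\<close> and \<open>D\<close> depend on
  the syntax alone, a program fixed for \<open>s\<close> and \<open>k\<close> gets a polynomial
  bound that is uniform in the instance.\<close>

lemma cost_poly: "\<exists>C D. \<forall>M. cost M c \<le> C * (M + 1) ^ D"
proof (induction c)
  case (B i)
  show ?case by (rule exI[of _ 1], rule exI[of _ 0]) simp
next
  case Skip
  show ?case by simp
next
  case (Seq c d)
  then obtain C1 D1 C2 D2 where *: "\<And>M. cost M c \<le> C1 * (M + 1) ^ D1" "\<And>M. cost M d \<le> C2 * (M + 1) ^ D2"
    by blast
  have "cost M (c ;; d) \<le> (C1 + C2) * (M + 1) ^ (D1 + D2)" for M
  proof -
    have "C1 * (M + 1) ^ D1 \<le> C1 * (M + 1) ^ (D1 + D2)" "C2 * (M + 1) ^ D2 \<le> C2 * (M + 1) ^ (D1 + D2)"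
      by (intro mult_le_mono2 power_increasing; simp)+
    thus ?thesis using *(1)[of M] *(2)[of M] unfolding cost.simps add_mult_distrib by linarith
  qed
  thus ?case by blast
next
  case (IfLe a b c d)
  then obtain C1 D1 C2 D2 where *: "\<And>M. cost M c \<le> C1 * (M + 1) ^ D1" "\<And>M. cost M d \<le> C2 * (M + 1) ^ D2"
    by blast
  have "cost M (IfLe a b c d) \<le> (C1 + C2 + 2) * (M + 1) ^ (D1 + D2)" for M
  proof -
    have "C1 * (M + 1) ^ D1 \<le> C1 * (M + 1) ^ (D1 + D2)" "C2 * (M + 1) ^ D2 \<le> C2 * (M + 1) ^ (D1 + D2)"
      by (intro mult_le_mono2 power_increasing; simp)+
    moreover have "1 \<le> (M + 1) ^ (D1 + D2)" by simp
    ultimately show ?thesis using *(1)[of M] *(2)[of M] unfolding cost.simps add_mult_distrib by linarith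
  qed
  thus ?case by blast
next
  case (Wh i r c)
  then obtain C D where *: "\<And>M. cost M c \<le> C * (M + 1) ^ D" by blast
  have "cost M (Wh i r c) \<le> (C + 4) * (M + 1) ^ (D + 1)" for M
  proof -
    have p: "1 \<le> (M + 1) ^ D" by simp
    have "cost M (Wh i r c) \<le> (M + 1) * (cost M c + 4)"
      unfolding cost.simps add_mult_distrib by (intro add_mono mult_le_mono2) auto
    also have "\<dots> \<le> (M + 1) * ((C + 4) * (M + 1) ^ D)"
      using add_mono[OF *[of M] mult_le_mono2[OF p, of 4]] by (intro mult_le_mono2) (simp add: add_mult_distrib)
    finally show ?thesis by (simp add: algebra_simps)
  qed
  thus ?case by blast
qed

section \<open>Weakest preconditions that account for time and number sizes\<close>

definition good :: "nat \<Rightarrow> mem \<Rightarrow> bool" where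
  "good H m \<longleftrightarrow> (\<forall>a. bnd H (m a))"

lemma goodD: "good H m \<Longrightarrow> bnd H (m a)" unfolding good_def by blast

lemma good_upd: "good H m \<Longrightarrow> bnd H q \<Longrightarrow> good H (m(a := q))" unfolding good_def by simp

text \<open>All intermediate memories are constrained, because the size requirement concerns every
  number produced and not only the final ones.\<close>

definition reach :: "nat \<Rightarrow> prog \<Rightarrow> nat \<Rightarrow> config \<Rightarrow> config \<Rightarrow> bool" where
  "reach H P t cf cf' \<longleftrightarrow> (step P ^^ t) cf = cf' \<and> (\<forall>t'\<le>t. good H (snd ((step P ^^ t') cf)))"

lemma reach_0: "good H (snd cf) \<Longrightarrow> reach H P 0 cf cf"
  by (simp add: reach_def)

lemma reach_good: "reach H P t cf cf' \<Longrightarrow> good H (snd cf')"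
  by (auto simp: reach_def)

lemma reach_trans:
  assumes "reach H P t cf cf1" "reach H P u cf1 cf2"
  shows "reach H P (t + u) cf cf2"
  unfolding reach_def
proof safe
  have a: "(step P ^^ (t + v)) cf = (step P ^^ v) cf1" for v
    using assms(1) funpow_add[of v t "step P"] by (simp add: reach_def add.commute)
  show "(step P ^^ (t + u)) cf = cf2" using a assms(2) unfolding reach_def by auto
  fix t' assume t': "t' \<le> t + u"
  show "good H (snd ((step P ^^ t') cf))"
  proof (cases "t' \<le> t")
    case True thus ?thesis using assms(1) unfolding reach_def by auto
  next
    case False
    then obtain v where "t' = t + v" "v \<le> u" using t' by (metis add_le_cancel_left le_Suc_ex nat_le_linear)
    thus ?thesis using a assms(2) unfolding reach_def by auto
  qed
qed

lemma reach_1: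
  assumes "p < length P" "P ! p \<noteq> Halt" "exec (P ! p) (p, m) = (p', m')" "good H m" "good H m'"
  shows "reach H P 1 (p, m) (p', m')"
proof -
  have "step P (p, m) = (p', m')" using assms by (simp add: step_def halted_def)
  thus ?thesis using assms unfolding reach_def by (auto simp: le_Suc_eq)
qed

definition code_at :: "prog \<Rightarrow> nat \<Rightarrow> instr list \<Rightarrow> bool" where
  "code_at P p xs \<longleftrightarrow> (\<forall>i<length xs. p + i < length P \<and> P ! (p + i) = xs ! i)"

lemma code_at_Nil [simp]: "code_at P p []" by (simp add: code_at_def)

lemma code_at_Cons [simp]:
  "code_at P p (x # xs) \<longleftrightarrow> p < length P \<and> P ! p = x \<and> code_at P (Suc p) xs"
  unfolding code_at_def by (auto simp: less_Suc_eq_0_disj) 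

lemma code_at_append [simp]:
  "code_at P p (xs @ ys) \<longleftrightarrow> code_at P p xs \<and> code_at P (p + length xs) ys"
  by (induction xs arbitrary: p) auto

text \<open>\<open>M\<close> bounds the number of iterations of every loop, so that the running time is determined by
  the syntax of \<open>c\<close>.\<close>

definition wp :: "nat \<Rightarrow> nat \<Rightarrow> com \<Rightarrow> (mem \<Rightarrow> bool) \<Rightarrow> mem \<Rightarrow> bool" where
  "wp H M c Q m \<longleftrightarrow> (good H m \<longrightarrow> (\<forall>P p. code_at P p (compile p c) \<longrightarrow>
     (\<exists>t m'. t \<le> cost M c \<and> reach H P t (p, m) (p + clen c, m') \<and> Q m')))"

lemma wpD:
  assumes "wp H M c Q m" "good H m" "code_at P p (compile p c)"
  obtains t m' where "t \<le> cost M c" "reach H P t (p, m) (p + clen c, m')" "Q m'" "good H m'"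
  using assms unfolding wp_def by (metis reach_good snd_conv)

text \<open>Every memory that is reached is \<open>good\<close>, so later steps receive this fact
  without carrying it in their postconditions.\<close>

lemma wp_conseq:
  assumes "wp H M c Q m" "\<And>m'. good H m' \<Longrightarrow> Q m' \<Longrightarrow> Q' m'"
  shows "wp H M c Q' m"
  using assms unfolding wp_def by (metis reach_good snd_conv)

text \<open>Every instruction except the jump and \<open>Halt\<close> writes exactly one cell;
  isolating that write yields a single rule for all of them.\<close>

fun upd :: "instr \<Rightarrow> mem \<Rightarrow> (nat \<times> rat) option" where
  "upd (Const r q) m = Some (r, q)"
| "upd (Add r a b) m = Some (r, m a + m b)"
| "upd (Sub r a b) m = Some (r, m a - m b)"
| "upd (Mul r a b) m = Some (r, m a * m b)"
| "upd (Dvd r a b) m = Some (r, m a / m b)"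
| "upd (LoadI r a) m = Some (r, m (addr (m a)))"
| "upd (StoreI a r) m = Some (addr (m a), m r)"
| "upd _ m = None"

lemma wp_B:
  assumes "upd i m = Some (r, q)" "good H m \<Longrightarrow> bnd H q" "Q (m(r := q))"
  shows "wp H M (B i) Q m"
  unfolding wp_def
proof (intro allI impI)
  fix P p assume g: "good H m" and "code_at P p (compile p (B i))"
  hence c: "p < length P" "P ! p = i" by auto
  have i: "i \<noteq> Halt" "exec i (p, m) = (Suc p, m(r := q))" using assms(1) by (cases i; auto)+
  have "reach H P 1 (p, m) (Suc p, m(r := q))"
    using c i g assms(2) by (intro reach_1) (auto intro: good_upd)
  thus "\<exists>t m'. t \<le> cost M (B i) \<and> reach H P t (p, m) (p + clen (B i), m') \<and> Q m'"
    using assms(3) by auto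
qed

lemma wp_Const: "bnd H q \<Longrightarrow> Q (m(r := q)) \<Longrightarrow> wp H M (B (Const r q)) Q m"
  by (rule wp_B) auto
lemma wp_Add: "(good H m \<Longrightarrow> bnd H (m a + m b)) \<Longrightarrow> Q (m(r := m a + m b)) \<Longrightarrow> wp H M (B (Add r a b)) Q m"
  by (rule wp_B) auto
lemma wp_Sub: "(good H m \<Longrightarrow> bnd H (m a - m b)) \<Longrightarrow> Q (m(r := m a - m b)) \<Longrightarrow> wp H M (B (Sub r a b)) Q m"
  by (rule wp_B) auto
lemma wp_Mul: "(good H m \<Longrightarrow> bnd H (m a * m b)) \<Longrightarrow> Q (m(r := m a * m b)) \<Longrightarrow> wp H M (B (Mul r a b)) Q m"
  by (rule wp_B) auto
lemma wp_Dvd: "(good H m \<Longrightarrow> bnd H (m a / m b)) \<Longrightarrow> Q (m(r := m a / m b)) \<Longrightarrow> wp H M (B (Dvd r a b)) Q m"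
  by (rule wp_B) auto
lemma wp_LoadI: "Q (m(r := m (addr (m a)))) \<Longrightarrow> wp H M (B (LoadI r a)) Q m"
  by (rule wp_B) (auto intro: goodD)
lemma wp_StoreI: "Q (m(addr (m a) := m r)) \<Longrightarrow> wp H M (B (StoreI a r)) Q m"
  by (rule wp_B) (auto intro: goodD)

lemma wp_Skip: "Q m \<Longrightarrow> wp H M Skip Q m"
  unfolding wp_def using reach_0 by fastforce

lemma wp_Seq:
  assumes "wp H M c (wp H M d Q) m"
  shows "wp H M (c ;; d) Q m"
  unfolding wp_def
proof (intro allI impI)
  fix P p assume g: "good H m" and "code_at P p (compile p (c ;; d))"
  hence c: "code_at P p (compile p c)" "code_at P (p + clen c) (compile (p + clen c) d)" by auto
  from wpD[OF assms g c(1)] obtain t m1 where 1: "t \<le> cost M c"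
    "reach H P t (p, m) (p + clen c, m1)" "wp H M d Q m1" "good H m1" .
  from wpD[OF 1(3,4) c(2)] obtain u m2 where 2: "u \<le> cost M d"
    "reach H P u (p + clen c, m1) (p + clen c + clen d, m2)" "Q m2" .
  show "\<exists>t m'. t \<le> cost M (c ;; d) \<and> reach H P t (p, m) (p + clen (c ;; d), m') \<and> Q m'"
    using reach_trans[OF 1(2) 2(2)] 1(1) 2
    by (intro exI[of _ "t + u"] exI[of _ m2]) (auto simp: add.assoc)
qed

lemma wp_IfLe:
  assumes "m a \<le> m b \<Longrightarrow> wp H M c Q m" "\<not> m a \<le> m b \<Longrightarrow> wp H M d Q m"
  shows "wp H M (IfLe a b c d) Q m"
  unfolding wp_def
proof (intro allI impI)
  fix P p assume g: "good H m" and "code_at P p (compile p (IfLe a b c d))"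
  hence c: "p < length P" "P ! p = JmpLe a b (p + clen d + 2)" "code_at P (p + 1) (compile (p + 1) d)"
    "p + 1 + clen d < length P" "P ! (p + 1 + clen d) = JmpLe 0 0 (p + clen d + 2 + clen c)"
    "code_at P (p + clen d + 2) (compile (p + clen d + 2) c)" by auto
  show "\<exists>t m'. t \<le> cost M (IfLe a b c d) \<and> reach H P t (p, m) (p + clen (IfLe a b c d), m') \<and> Q m'"
  proof (cases "m a \<le> m b")
    case True
    have 1: "reach H P 1 (p, m) (p + clen d + 2, m)"
      using c g True by (intro reach_1) auto
    from wpD[OF assms(1)[OF True] g c(6)] obtain t m' where 2: "t \<le> cost M c"
      "reach H P t (p + clen d + 2, m) (p + clen d + 2 + clen c, m')" "Q m'" .
    show ?thesis using reach_trans[OF 1 2(2)] 2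
      by (intro exI[of _ "1 + t"] exI[of _ m']) (auto simp: add_ac)
  next
    case False
    have 1: "reach H P 1 (p, m) (p + 1, m)"
      using c g False by (intro reach_1) auto
    from wpD[OF assms(2)[OF False] g c(3)] obtain t m' where 2: "t \<le> cost M d"
      "reach H P t (p + 1, m) (p + 1 + clen d, m')" "Q m'" "good H m'" .
    have 3: "reach H P 1 (p + 1 + clen d, m') (p + clen d + 2 + clen c, m')"
      using c 2 by (intro reach_1) auto
    show ?thesis using reach_trans[OF reach_trans[OF 1 2(2)] 3] 2
      by (intro exI[of _ "1 + t + 1"] exI[of _ m']) (auto simp: add_ac)
  qed
qed

text \<open>The increment follows the body and reads \<open>rO\<close>. So the body must restore
  counter, limit and \<open>rO\<close>, and its invariant is stated for the memory after the
  increment. The bound \<open>n \<le> H\<close> keeps the counter itself small.\<close>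

lemma wp_Wh:
  assumes body: "\<And>j m. j < n \<Longrightarrow> I j m \<Longrightarrow> m i = of_nat j \<Longrightarrow> m r = of_nat n \<Longrightarrow> wp H M c
      (\<lambda>m'. m' i = of_nat j \<and> m' r = of_nat n \<and> m' rO = 1 \<and> I (Suc j) (m'(i := of_nat (Suc j)))) m"
    and HM: "n \<le> H" "n \<le> M" "i \<noteq> r"
    and "I 0 m" "m i = 0" "m r = of_nat n" "\<And>m. I n m \<Longrightarrow> Q m"
  shows "wp H M (Wh i r c) Q m"
  unfolding wp_def
proof (intro allI impI)
  fix P p assume g: "good H m" and "code_at P p (compile p (Wh i r c))"
  hence c: "p < length P" "P ! p = JmpLe r i (p + clen c + 3)" "code_at P (p + 1) (compile (p + 1) c)"
    "p + 1 + clen c < length P" "P ! (p + 1 + clen c) = Add i i rO"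
    "p + 2 + clen c < length P" "P ! (p + 2 + clen c) = JmpLe 0 0 p" by auto
  have "\<exists>t m'. t \<le> (n - j) * (cost M c + 3) + 1 \<and> reach H P t (p, m) (p + clen c + 3, m') \<and> I n m'"
    if "j \<le> n" "I j m" "m i = of_nat j" "m r = of_nat n" "good H m" for j m
    using that
  proof (induction "n - j" arbitrary: j m)
    case 0
    hence "reach H P 1 (p, m) (p + clen c + 3, m)"
      using c by (intro reach_1) auto
    thus ?case using 0 by (intro exI[of _ 1] exI[of _ m]) auto
  next
    case (Suc x)
    hence j: "j < n" by simp
    have 1: "reach H P 1 (p, m) (p + 1, m)"
      using c Suc j by (intro reach_1) auto
    from wpD[OF body[OF j Suc(4-6)] Suc(7) c(3)] obtain t m1 where 2: "t \<le> cost M c"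
      "reach H P t (p + 1, m) (p + 1 + clen c, m1)" "m1 i = of_nat j" "m1 r = of_nat n" "m1 rO = 1"
      "I (Suc j) (m1(i := of_nat (Suc j)))" "good H m1" by blast
    let ?m = "m1(i := of_nat (Suc j))"
    have g': "good H ?m" using 2 HM j by (intro good_upd bnd_nat) auto
    have 3: "reach H P 1 (p + 1 + clen c, m1) (p + 2 + clen c, ?m)"
      using c 2 g' by (intro reach_1) (auto simp: add.commute)
    have 4: "reach H P 1 (p + 2 + clen c, ?m) (p, ?m)"
      using c g' by (intro reach_1) auto
    have "\<exists>t m'. t \<le> (n - Suc j) * (cost M c + 3) + 1 \<and> reach H P t (p, ?m) (p + clen c + 3, m') \<and> I n m'"
      using Suc(2) j 2 g' HM by (intro Suc(1)) auto
    then obtain u m2 where 5: "u \<le> (n - Suc j) * (cost M c + 3) + 1"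
      "reach H P u (p, ?m) (p + clen c + 3, m2)" "I n m2" by blast
    have "n - j = Suc (n - Suc j)" using j by simp
    hence "1 + t + 1 + 1 + u \<le> (n - j) * (cost M c + 3) + 1" using 2(1) 5(1) by simp
    thus ?case using reach_trans[OF reach_trans[OF reach_trans[OF reach_trans[OF 1 2(2)] 3] 4] 5(2)] 5(3)
      by blast
  qed
  from this[of 0 m] obtain t m' where 1: "t \<le> n * (cost M c + 3) + 1"
    "reach H P t (p, m) (p + clen c + 3, m')" "I n m'" using assms g by auto
  have "n * (cost M c + 3) \<le> M * (cost M c + 3)" using HM by (intro mult_le_mono1)
  hence "t \<le> cost M (Wh i r c)" using 1(1) unfolding cost.simps by linarith
  thus "\<exists>t m'. t \<le> cost M (Wh i r c) \<and> reach H P t (p, m) (p + clen (Wh i r c), m') \<and> Q m'"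
    using 1 assms(8) by (intro exI[of _ t] exI[of _ m']) (auto simp: add_ac)
qed

lemma wp_For:
  assumes "\<And>j m. j < n \<Longrightarrow> I j m \<Longrightarrow> m i = of_nat j \<Longrightarrow> m r = of_nat n \<Longrightarrow> wp H M c
      (\<lambda>m'. m' i = of_nat j \<and> m' r = of_nat n \<and> m' rO = 1 \<and> I (Suc j) (m'(i := of_nat (Suc j)))) m"
    and "n \<le> H" "0 < H" "n \<le> M" "i \<noteq> r"
    and "m r = of_nat n" "I 0 (m(i := 0))" "\<And>m. I n m \<Longrightarrow> Q m"
  shows "wp H M (For i r c) Q m"
  by (rule wp_Seq, rule wp_Const, simp add: bnd_0 assms, rule wp_Wh[of n I], rule assms)
     (use assms in auto)

text \<open>Unrolling at compile time, used where the number of repetitions depends only on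
  \<open>s\<close> and \<open>k\<close>: register numbers may then depend on the index.\<close>

fun seqs :: "(nat \<Rightarrow> com) \<Rightarrow> nat \<Rightarrow> com" where
  "seqs f 0 = Skip"
| "seqs f (Suc n) = seqs f n ;; f n"

lemma wp_seqs:
  assumes "I 0 m" "\<And>i m. i < n \<Longrightarrow> I i m \<Longrightarrow> wp H M (f i) (I (Suc i)) m" "\<And>m. I n m \<Longrightarrow> Q m"
  shows "wp H M (seqs f n) Q m"
proof -
  have "wp H M (seqs f j) (I j) m" if "j \<le> n" for j
    using that
  proof (induction j)
    case 0
    show ?case using assms by (auto intro: wp_Skip)
  next
    case (Suc j)
    show ?case unfolding seqs.simps
      by (rule wp_Seq, rule wp_conseq[OF Suc.IH]) (use Suc.prems in \<open>auto intro: assms\<close>)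
  qed
  from this[of n] show ?thesis using assms(3) by (auto elim: wp_conseq)
qed

section \<open>Candidate solutions from generic linear functionals\<close>

text \<open>Perturb a functional that works for \<open>A\<close> in one coordinate where the new
  vector is nonzero; only finitely many step lengths spoil anything.\<close>

lemma exists_nonorthogonal:
  fixes A :: "(nat \<Rightarrow> rat) set"
  assumes "finite A"
  shows "\<exists>g. \<forall>a\<in>A. (\<exists>e<D. a e \<noteq> 0) \<longrightarrow> (\<Sum>e<D. g e * a e) \<noteq> 0"
  using assms
proof (induction A rule: finite_induct)
  case empty
  show ?case by simp
next
  case (insert a A)
  then obtain g where g: "\<And>b. b \<in> A \<Longrightarrow> \<exists>e<D. b e \<noteq> 0 \<Longrightarrow> (\<Sum>e<D. g e * b e) \<noteq> 0" by blast
  show ?case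
  proof (cases "(\<exists>e<D. a e \<noteq> 0) \<and> (\<Sum>e<D. g e * a e) = 0")
    case False
    thus ?thesis using g by blast
  next
    case True
    then obtain i where i: "i < D" "a i \<noteq> 0" by blast
    \<comment> \<open>The step 0 is excluded because the new vector is orthogonal to
      \<open>g\<close>; the other values are the steps at which some \<open>b\<close> becomes
      orthogonal. If \<open>b i = 0\<close>, the listed value is 0 and already excluded.\<close>
    have "finite (insert 0 ((\<lambda>b. - (\<Sum>e<D. g e * b e) / b i) ` A))" using insert by simp
    then obtain t where t: "t \<notin> insert 0 ((\<lambda>b. - (\<Sum>e<D. g e * b e) / b i) ` A)"
      using ex_new_if_finite infinite_UNIV_char_0 by blast
    let ?g = "\<lambda>e. g e + (if e = i then t else 0)"
    have dot: "(\<Sum>e<D. ?g e * b e) = (\<Sum>e<D. g e * b e) + t * b i" for b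
    proof -
      have "(\<Sum>e<D. ?g e * b e) = (\<Sum>e<D. g e * b e + (if e = i then t * b e else 0))"
        by (intro sum.cong) (auto simp: algebra_simps)
      thus ?thesis using i by (simp add: sum.distrib)
    qed
    have "(\<Sum>e<D. ?g e * b e) \<noteq> 0" if b: "b \<in> insert a A" "\<exists>e<D. b e \<noteq> 0" for b
    proof (cases "b = a")
      case True
      thus ?thesis using \<open>_ \<and> _\<close> i t unfolding dot by simp
    next
      case False
      with b g have *: "b \<in> A" "(\<Sum>e<D. g e * b e) \<noteq> 0" by auto
      show ?thesis
      proof
        assume z: "(\<Sum>e<D. ?g e * b e) = 0"
        hence "t * b i = - (\<Sum>e<D. g e * b e)" unfolding dot by (simp add: eq_neg_iff_add_eq_0 add.commute)
        moreover from this * have "b i \<noteq> 0" by auto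
        ultimately have "t = - (\<Sum>e<D. g e * b e) / b i" by (subst nonzero_eq_divide_eq) auto
        with * t show False by blast
      qed
    qed
    thus ?thesis by (intro exI[of _ ?g] ballI impI)
  qed
qed

text \<open>Lets \<open>T * f a + g a\<close> inherit the sign of \<open>f a\<close> wherever this
  is nonzero, so that \<open>g\<close> acts only as a tie-break.\<close>

lemma exists_dominating:
  fixes f g :: "'a \<Rightarrow> rat"
  assumes "finite A"
  shows "\<exists>T. \<forall>a\<in>A. f a \<noteq> 0 \<longrightarrow> \<bar>g a\<bar> < T * \<bar>f a\<bar>"
proof -
  define T where "T = 1 + (\<Sum>a\<in>A. \<bar>g a\<bar> / \<bar>f a\<bar>)"
  have "\<bar>g a\<bar> < T * \<bar>f a\<bar>" if "a \<in> A" "f a \<noteq> 0" for a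
  proof -
    have "\<bar>g a\<bar> / \<bar>f a\<bar> \<le> (\<Sum>a\<in>A. \<bar>g a\<bar> / \<bar>f a\<bar>)"
      using that assms by (intro member_le_sum) auto
    hence "\<bar>g a\<bar> / \<bar>f a\<bar> < T" unfolding T_def by simp
    thus ?thesis using that by (simp add: divide_less_eq)
  qed
  thus ?thesis by blast
qed

text \<open>Coordinate \<open>d\<close> is eliminated with pivot vector number \<open>bs d\<close>. A pivot with vanishing entry has
  no effect, because division by zero yields zero.\<close>

fun red :: "(nat \<Rightarrow> nat \<Rightarrow> rat) \<Rightarrow> (nat \<Rightarrow> nat) \<Rightarrow> nat \<Rightarrow> nat \<Rightarrow> nat \<Rightarrow> rat" where
  "red w bs 0 p e = w p e"
| "red w bs (Suc d) p e = red w bs d p e - red w bs d p d / red w bs d (bs d) d * red w bs d (bs d) e"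

text \<open>Only the sign matters. Once the remaining functional vanishes on a vector, genericity
  makes all its later diagonal entries zero, so the last nonzero one belongs to the stage at which
  the value reached zero.\<close>

fun key :: "(nat \<Rightarrow> nat \<Rightarrow> rat) \<Rightarrow> (nat \<Rightarrow> nat) \<Rightarrow> (nat \<Rightarrow> rat) \<Rightarrow> nat \<Rightarrow> nat \<Rightarrow> rat" where
  "key w bs es 0 p = 0"
| "key w bs es (Suc d) p = (if red w bs d p d = 0 then key w bs es d p else es d * red w bs d p d)"

definition valid :: "nat \<Rightarrow> nat \<Rightarrow> (nat \<Rightarrow> nat) \<Rightarrow> (nat \<Rightarrow> rat) \<Rightarrow> bool" where
  "valid N D bs es \<longleftrightarrow> (\<forall>d<D. bs d < N \<and> es d \<in> {1, -1})"

lemma red_cong: "(\<And>i. i < d \<Longrightarrow> bs i = bs' i) \<Longrightarrow> red w bs d p e = red w bs' d p e"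
  by (induction d arbitrary: p e) auto

lemma key_cong: "(\<And>i. i < d \<Longrightarrow> bs i = bs' i) \<Longrightarrow> (\<And>i. i < d \<Longrightarrow> es i = es' i) \<Longrightarrow>
    key w bs es d p = key w bs' es' d p"
proof (induction d)
  case (Suc d)
  have "red w bs d p d = red w bs' d p d" using Suc by (intro red_cong) auto
  thus ?case using Suc by auto
qed simp

text \<open>Moving the \<open>d\<close>-th coordinate of the functional \<open>f\<close> to the closest value at which some vector
  with nonzero \<open>d\<close>-th entry becomes orthogonal to \<open>f\<close> reverses no sign. That vector is the next
  pivot, and the direction of the move is the sign \<open>es d\<close>.\<close>

lemma exists_code:
  fixes f :: "nat \<Rightarrow> rat"
  assumes N: "N > 0"
  assumes gen: "\<And>bs d p. d < D \<Longrightarrow> (\<And>i. i < d \<Longrightarrow> bs i < N) \<Longrightarrow> p < N \<Longrightarrow>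
     (\<Sum>e=d..<D. f e * red w bs d p e) = 0 \<Longrightarrow> red w bs d p d = 0"
  shows "\<exists>bs es. valid N D bs es \<and> (\<forall>p<N.
     (0 < (\<Sum>e<D. f e * w p e) \<longrightarrow> 0 < key w bs es D p) \<and>
     ((\<Sum>e<D. f e * w p e) < 0 \<longrightarrow> key w bs es D p < 0))"
proof -
  define u where "u bs d p = (\<Sum>e=d..<D. f e * red w bs d p e)" for bs d p
  define v where "v p = (\<Sum>e<D. f e * w p e)" for p
  \<comment> \<open>Invariant: the value \<open>u\<close> of the remaining functional keeps the sign
    of the original value \<open>v\<close> until it becomes zero, and from then on
    \<open>key\<close> remembers that sign.\<close>
  have "\<exists>bs es. valid N d bs es \<and> (\<forall>p<N.
     (0 < v p \<longrightarrow> 0 < u bs d p \<or> u bs d p = 0 \<and> 0 < key w bs es d p) \<and>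
     (v p < 0 \<longrightarrow> u bs d p < 0 \<or> u bs d p = 0 \<and> key w bs es d p < 0))" if "d \<le> D" for d
    using that
  proof (induction d)
    case 0
    have "u bs 0 p = v p" for bs p by (simp add: u_def v_def atLeast0LessThan)
    thus ?case by (auto simp: valid_def)
  next
    case (Suc d)
    then obtain bs es where val: "valid N d bs es" and IH: "\<And>p. p < N \<Longrightarrow>
     (0 < v p \<longrightarrow> 0 < u bs d p \<or> u bs d p = 0 \<and> 0 < key w bs es d p) \<and>
     (v p < 0 \<longrightarrow> u bs d p < 0 \<or> u bs d p = 0 \<and> key w bs es d p < 0)" by auto
    have d: "d < D" using Suc by simp
    define a where "a p = red w bs d p d" for p
    have ua: "a p = 0" if "p < N" "u bs d p = 0" for p
      using gen[OF d, of bs p] val that unfolding a_def u_def valid_def by blast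
    \<comment> \<open>The pivot minimises the absolute ratio of value to entry; if no entry is
      nonzero, any index serves.\<close>
    have "\<exists>b<N. (a b = 0 \<longrightarrow> (\<forall>p<N. a p = 0)) \<and> (\<forall>p<N. a p \<noteq> 0 \<longrightarrow> \<bar>a p * (u bs d b / a b)\<bar> \<le> \<bar>u bs d p\<bar>)"
    proof (cases "\<exists>p<N. a p \<noteq> 0")
      case False
      thus ?thesis using N by blast
    next
      case True
      let ?A = "{p. p < N \<and> a p \<noteq> 0}"
      let ?r = "\<lambda>p. \<bar>u bs d p / a p\<bar>"
      have "finite ?A" "?A \<noteq> {}" using True by auto
      hence Min: "Min (?r ` ?A) \<in> ?r ` ?A" and le: "\<And>p. p \<in> ?A \<Longrightarrow> Min (?r ` ?A) \<le> ?r p"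
        by (intro Min_in Min_le finite_imageI imageI; simp)+
      from Min obtain b where b: "b \<in> ?A" "Min (?r ` ?A) = ?r b" by blast
      note b = b(1) le[unfolded b(2)]
      have "\<bar>a p * (u bs d b / a b)\<bar> \<le> \<bar>u bs d p\<bar>" if "p < N" "a p \<noteq> 0" for p
      proof -
        have "\<bar>a p\<bar> * ?r b \<le> \<bar>a p\<bar> * ?r p" using b that by (intro mult_left_mono) auto
        thus ?thesis using that by (simp add: abs_mult)
      qed
      thus ?thesis using b by blast
    qed
    then obtain b where b: "b < N" "a b = 0 \<Longrightarrow> p < N \<Longrightarrow> a p = 0"
      "p < N \<Longrightarrow> a p \<noteq> 0 \<Longrightarrow> \<bar>a p * (u bs d b / a b)\<bar> \<le> \<bar>u bs d p\<bar>" for p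
      by blast
    define \<tau> where "\<tau> = u bs d b / a b"
    define bs' where "bs' = bs(d := b)"
    \<comment> \<open>Vectors whose value reaches zero here satisfy
      \<open>u bs d p = a p * \<tau>\<close>, so their former sign is that of \<open>\<tau>\<close>
      times that of \<open>a p\<close>.\<close>
    define es' where "es' = es(d := if \<tau> < 0 then -1 else 1)"
    have red: "red w bs' d p e = red w bs d p e" for p e
      by (rule red_cong) (simp add: bs'_def)
    have key: "key w bs' es' d p = key w bs es d p" for p
      by (rule key_cong) (simp_all add: bs'_def es'_def)
    have bs'd: "bs' d = b" by (simp add: bs'_def)
    \<comment> \<open>Elimination with pivot \<open>b\<close> acts like lowering the
      \<open>d\<close>-th coordinate of \<open>f\<close> by \<open>\<tau>\<close>: the changed
      functional vanishes on the pivot, so subtracting multiples of the pivot does not alter its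
      values.\<close>
    have u': "u bs' (Suc d) p = u bs d p - a p * \<tau>" if "p < N" for p
    proof -
      have sp: "u bs d q = f d * a q + (\<Sum>e=Suc d..<D. f e * red w bs d q e)" for q
        unfolding u_def a_def using d by (simp add: sum.atLeast_Suc_lessThan)
      have "u bs' (Suc d) p = (\<Sum>e=Suc d..<D. f e * red w bs d p e - a p / a b * (f e * red w bs d b e))"
        unfolding u_def by (intro sum.cong) (auto simp: red bs'd a_def algebra_simps)
      also have "\<dots> = (u bs d p - f d * a p) - a p / a b * (u bs d b - f d * a b)"
        unfolding sp by (simp add: sum_subtractf sum_distrib_left)
      also have "\<dots> = u bs d p - a p * \<tau>"
        using b(2)[OF _ that] by (cases "a b = 0") (auto simp: \<tau>_def field_simps)
      finally show ?thesis .
    qed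
    have key': "key w bs' es' (Suc d) p = (if a p = 0 then key w bs es d p else es' d * a p)" for p
      by (simp add: red key a_def)
    have "(0 < v p \<longrightarrow> 0 < u bs' (Suc d) p \<or> u bs' (Suc d) p = 0 \<and> 0 < key w bs' es' (Suc d) p) \<and>
      (v p < 0 \<longrightarrow> u bs' (Suc d) p < 0 \<or> u bs' (Suc d) p = 0 \<and> key w bs' es' (Suc d) p < 0)" if p: "p < N" for p
    proof (cases "a p = 0")
      case True
      thus ?thesis using IH[OF p] u'[OF p] key' by simp
    next
      case False
      hence u0: "u bs d p \<noteq> 0" and le: "\<bar>a p * \<tau>\<bar> \<le> \<bar>u bs d p\<bar>"
        using ua[OF p] b(3)[OF p] by (auto simp: \<tau>_def)
      have k: "key w bs' es' (Suc d) p = (if \<tau> < 0 then - a p else a p)"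
        unfolding key' using False by (simp add: es'_def)
      show ?thesis
      proof (intro conjI impI)
        assume "0 < v p"
        with IH[OF p] u0 have pos: "0 < u bs d p" by auto
        show "0 < u bs' (Suc d) p \<or> u bs' (Suc d) p = 0 \<and> 0 < key w bs' es' (Suc d) p"
        proof (cases "u bs d p = a p * \<tau>")
          case True
          hence "0 < a p * \<tau>" using pos by simp
          thus ?thesis using True u'[OF p] k by (auto simp: zero_less_mult_iff)
        next
          case False
          thus ?thesis using le pos u'[OF p] by auto
        qed
      next
        assume "v p < 0"
        with IH[OF p] u0 have neg: "u bs d p < 0" by auto
        show "u bs' (Suc d) p < 0 \<or> u bs' (Suc d) p = 0 \<and> key w bs' es' (Suc d) p < 0"
        proof (cases "u bs d p = a p * \<tau>")
          case True
          hence "a p * \<tau> < 0" using neg by simp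
          thus ?thesis using True u'[OF p] k by (auto simp: mult_less_0_iff)
        next
          case False
          thus ?thesis using le neg u'[OF p] by auto
        qed
      qed
    qed
    moreover have "valid N (Suc d) bs' es'"
      using val b by (auto simp: valid_def bs'_def es'_def less_Suc_eq)
    ultimately show ?case by blast
  qed
  \<comment> \<open>For \<open>d = D\<close> the sum in \<open>u\<close> is empty, so only the
    alternatives about \<open>key\<close> remain.\<close>
  from this[of D] obtain bs es where "valid N D bs es" "\<forall>p<N. (0 < v p \<longrightarrow> 0 < key w bs es D p) \<and>
     (v p < 0 \<longrightarrow> key w bs es D p < 0)"
    unfolding u_def by auto
  thus ?thesis unfolding v_def by blast
qed

section \<open>Optimal selections as sign patterns\<close>

definition sel :: "nat \<Rightarrow> nat \<Rightarrow> (nat \<Rightarrow> nat \<Rightarrow> rat) \<Rightarrow> (nat \<Rightarrow> nat) \<Rightarrow> (nat \<Rightarrow> rat) \<Rightarrow> nat set" where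
  "sel N D w bs es = {p. p < N \<and> 0 < key w bs es D p}"

lemma sel_cong: "(\<And>i. i < D \<Longrightarrow> bs i = bs' i) \<Longrightarrow> (\<And>i. i < D \<Longrightarrow> es i = es' i) \<Longrightarrow>
    sel N D w bs es = sel N D w bs' es'"
  using key_cong[of D bs bs' es es' w] by (simp add: sel_def)

text \<open>\<open>w p\<close> lists what variable \<open>p\<close> adds to each factor of the
  objective; coordinate \<open>l * s + j\<close> is the factor of block \<open>j\<close> in set
  \<open>l\<close>. The offset \<open>y0\<close> will supply the factor 1 for blocks outside a
  set.\<close>

definition lin :: "(nat \<Rightarrow> rat) \<Rightarrow> (nat \<Rightarrow> nat \<Rightarrow> rat) \<Rightarrow> nat set \<Rightarrow> nat \<Rightarrow> rat" where
  "lin y0 w S e = y0 e + (\<Sum>p\<in>S. w p e)"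

definition mlin :: "nat \<Rightarrow> nat \<Rightarrow> (nat \<Rightarrow> rat) \<Rightarrow> rat" where
  "mlin k s y = (\<Sum>l<k. \<Prod>j<s. y (l * s + j))"

lemma mlin_cong: "(\<And>e. e < k * s \<Longrightarrow> y e = y' e) \<Longrightarrow> mlin k s y = mlin k s y'"
proof -
  assume *: "\<And>e. e < k * s \<Longrightarrow> y e = y' e"
  have "l * s + j < k * s" if "l < k" "j < s" for l j
  proof -
    have "l * s + j < Suc l * s" using that by simp
    also have "\<dots> \<le> k * s" using that by (intro mult_le_mono1) simp
    finally show ?thesis .
  qed
  thus ?thesis unfolding mlin_def by (intro sum.cong prod.cong) (auto simp: *)
qed

lemma sum_blocks: "(\<Sum>e<k * s. f e) = (\<Sum>l<k. \<Sum>j<s. f (l * s + j :: nat))" for f :: "nat \<Rightarrow> rat"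
proof -
  have "sum f {l * s..<l * s + s} = (\<Sum>j<s. f (l * s + j))" for l
    using sum.shift_bounds_nat_ivl[of f 0 "l * s" s] by (simp add: atLeast0LessThan add.commute)
  thus ?thesis using sum.nat_group[of f s k] by simp
qed

text \<open>The support condition \<open>blk\<close> makes the objective affine in each block, so
  exchanging one block of an optimal selection changes it by exactly the gradient term. It suffices
  that each such exchange leaves all coordinates fixed.\<close>

theorem exists_optimal_code:
  assumes N: "N > 0" and s: "s > 0"
    and blk: "\<And>p e. p < N \<Longrightarrow> e < k * s \<Longrightarrow> w p e \<noteq> 0 \<Longrightarrow> e mod s = blk p"
  shows "\<exists>bs es. valid N (k * s) bs es \<and>
    (\<forall>S\<subseteq>{..<N}. mlin k s (lin y0 w S) \<le> mlin k s (lin y0 w (sel N (k * s) w bs es)))"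
proof -
  define D where "D = k * s"
  have blk0: "w p e = 0" if "p < N" "e < D" "e mod s \<noteq> blk p" for p e
    using blk that unfolding D_def by blast
  define V where "V = Pow {..<N}"
  define F where "F S = mlin k s (lin y0 w S)" for S
  define dot where "dot f a = (\<Sum>e<D. f e * a e)" for f a :: "nat \<Rightarrow> rat"
  define df where "df S S' j = (\<lambda>e. if e mod s = j then lin y0 w S' e - lin y0 w S e else 0)" for S S' j
  \<comment> \<open>\<open>A1\<close> collects the tails of reduced vectors for all choices of
    pivots, as the genericity condition of \<open>exists_code\<close> requires; \<open>A2\<close>
    collects the changes caused by exchanging one block. Both are finite, so one \<open>g\<close>
    serves all of them.\<close>
  define A1 where "A1 = (\<lambda>(bs, d, p) e. if e < d then 0 else red w bs d p e) ` (({..<D} \<rightarrow>\<^sub>E {..<N}) \<times> {..<D} \<times> {..<N})"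
  define A2 where "A2 = (\<lambda>(S, S', j). df S S' j) ` (V \<times> V \<times> {..<s})"
  have fin: "finite (A1 \<union> A2)" unfolding A1_def A2_def V_def by (auto intro!: finite_PiE)
  obtain g where g: "\<And>a. a \<in> A1 \<union> A2 \<Longrightarrow> \<exists>e<D. a e \<noteq> 0 \<Longrightarrow> dot g a \<noteq> 0"
    using exists_nonorthogonal[OF fin, of D] unfolding dot_def by blast
  have finV: "finite V" "{} \<in> V" unfolding V_def by auto
  \<comment> \<open>Among the optima, \<open>S\<close> will be one that maximises \<open>g\<close>,
    which matches the way \<open>f\<close> below breaks ties.\<close>
  define V1 where "V1 = {S \<in> V. \<forall>S'\<in>V. F S' \<le> F S}"
  have argmax: "\<exists>S\<in>X. \<forall>S'\<in>X. h S' \<le> h S" if "finite X" "X \<noteq> {}" for X :: "nat set set" and h :: "nat set \<Rightarrow> rat"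
  proof -
    have "Max (h ` X) \<in> h ` X" using that by simp
    moreover have "\<forall>S'\<in>X. h S' \<le> Max (h ` X)" using that by simp
    ultimately show ?thesis by (metis (no_types, lifting) imageE)
  qed
  have "V1 \<noteq> {}" using argmax[of V F] finV unfolding V1_def by blast
  moreover have "finite V1" using finV unfolding V1_def by simp
  ultimately obtain S where S: "S \<in> V1" "\<And>S'. S' \<in> V1 \<Longrightarrow> dot g (lin y0 w S') \<le> dot g (lin y0 w S)"
    using argmax[of V1 "\<lambda>S. dot g (lin y0 w S)"] by blast
  have SV: "S \<in> V" and SF: "\<And>S'. S' \<in> V \<Longrightarrow> F S' \<le> F S" using S(1) unfolding V1_def by auto
  \<comment> \<open>The partial derivative of the objective at \<open>S\<close> with respect to
    coordinate \<open>e\<close>.\<close>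
  define \<mu> where "\<mu> e = (\<Prod>j\<in>{..<s} - {e mod s}. lin y0 w S (e div s * s + j))" for e
  obtain T where T: "\<And>a. a \<in> A1 \<union> A2 \<Longrightarrow> dot \<mu> a \<noteq> 0 \<Longrightarrow> \<bar>dot g a\<bar> < T * \<bar>dot \<mu> a\<bar>"
    using exists_dominating[OF fin, of "dot \<mu>" "dot g"] by blast
  define f where "f e = T * \<mu> e + g e" for e
  have dotf: "dot f a = T * dot \<mu> a + dot g a" for a
    unfolding dot_def f_def by (simp add: algebra_simps sum.distrib sum_distrib_left)
  have nz: "dot f a \<noteq> 0" if a: "a \<in> A1 \<union> A2" "\<exists>e<D. a e \<noteq> 0" for a
  proof
    assume z: "dot f a = 0"
    show False
    proof (cases "dot \<mu> a = 0")
      case True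
      thus ?thesis using z g[OF a] dotf by simp
    next
      case False
      from T[OF a(1) this] have "\<bar>dot g a\<bar> < \<bar>T * dot \<mu> a\<bar>"
        using mult_right_mono[OF abs_ge_self[of T] abs_ge_zero[of "dot \<mu> a"]] unfolding abs_mult by linarith
      thus ?thesis using z dotf by simp
    qed
  qed
  have gen: "red w bs d p d = 0" if h: "d < D" "\<And>i. i < d \<Longrightarrow> bs i < N" "p < N"
     "(\<Sum>e=d..<D. f e * red w bs d p e) = 0" for bs d p
  proof -
    \<comment> \<open>Only pivots below \<open>d\<close> matter; the others are set to 0 so that the
      choice lies in a finite function space.\<close>
    define bs' where "bs' = restrict (\<lambda>i. if i < d then bs i else 0) {..<D}"
    have "bs' \<in> {..<D} \<rightarrow>\<^sub>E {..<N}" using h N by (auto simp: bs'_def)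
    hence "(\<lambda>e. if e < d then 0 else red w bs' d p e) \<in> A1" (is "?a \<in> A1")
      unfolding A1_def using h by (intro image_eqI[of _ _ "(bs', d, p)"]) auto
    moreover have "red w bs' d p e = red w bs d p e" for e
      using h by (intro red_cong) (simp add: bs'_def)
    moreover have "dot f ?a = (\<Sum>e=d..<D. f e * red w bs' d p e)"
      unfolding dot_def by (rule sum.mono_neutral_cong_right) auto
    ultimately have "?a \<in> A1 \<union> A2" "dot f ?a = 0" using h(4) by auto
    hence "\<not> (\<exists>e<D. ?a e \<noteq> 0)" using nz by blast
    hence "?a d = 0" using h(1) by blast
    thus ?thesis using \<open>\<And>e. red w bs' d p e = red w bs d p e\<close> by simp
  qed
  from exists_code[OF N gen] obtain bs es where val: "valid N D bs es"
    and sgn: "\<And>p. p < N \<Longrightarrow> 0 < (\<Sum>e<D. f e * w p e) \<Longrightarrow> 0 < key w bs es D p"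
      "\<And>p. p < N \<Longrightarrow> (\<Sum>e<D. f e * w p e) < 0 \<Longrightarrow> key w bs es D p < 0" by blast
  define S' where "S' = sel N D w bs es"
  have S'V: "S' \<in> V" unfolding S'_def V_def sel_def by auto
  have linN: "lin y0 w S e = y0 e + (\<Sum>p<N. if p \<in> S then w p e else 0)" if "S \<in> V" for S e
  proof -
    have "(\<Sum>p\<in>S. w p e) = (\<Sum>p<N. if p \<in> S then w p e else 0)"
      using that unfolding V_def by (intro sum.mono_neutral_cong_left) auto
    thus ?thesis by (simp add: lin_def)
  qed
  have d0: "df S S' j e = 0" if j: "j < s" "e < D" for j e
  proof -
    \<comment> \<open>\<open>S\<close> with the selection in block \<open>j\<close> taken from
      \<open>S'\<close>.\<close>
    define Sj where "Sj = {p. p < N \<and> (if blk p = j then p \<in> S' else p \<in> S)}"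
    have SjV: "Sj \<in> V" unfolding Sj_def V_def by auto
    have linSj: "lin y0 w Sj e = lin y0 w S e + df S S' j e" if "e < D" for e
    proof -
      have "lin y0 w Sj e = (if e mod s = j then lin y0 w S' e else lin y0 w S e)"
      proof (cases "e mod s = j")
        case True
        hence "(\<Sum>p<N. if p \<in> Sj then w p e else 0) = (\<Sum>p<N. if p \<in> S' then w p e else 0)"
          using blk0[OF _ that] unfolding Sj_def by (intro sum.cong) auto
        thus ?thesis using True linN[OF SjV] linN[OF S'V] by simp
      next
        case False
        hence "(\<Sum>p<N. if p \<in> Sj then w p e else 0) = (\<Sum>p<N. if p \<in> S then w p e else 0)"
          using blk0[OF _ that] unfolding Sj_def by (intro sum.cong) auto
        thus ?thesis using False linN[OF SjV] linN[OF SV] by simp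
      qed
      thus ?thesis by (simp add: df_def)
    qed
    have dA: "df S S' j \<in> A1 \<union> A2" unfolding A2_def using SV S'V j by force
    have "F Sj - F S = dot \<mu> (df S S' j)"
    proof -
      have "F Sj - F S = (\<Sum>l<k. \<mu> (l * s + j) * df S S' j (l * s + j))"
        unfolding F_def mlin_def sum_subtractf[symmetric]
      proof (intro sum.cong refl)
        fix l assume l: "l \<in> {..<k}"
        have lt: "l * s + j' < D" if "j' < s" for j'
        proof -
          have "l * s + j' < Suc l * s" using that by simp
          also have "\<dots> \<le> k * s" using l by (intro mult_le_mono1) simp
          finally show ?thesis by (simp add: D_def)
        qed
        have r: "(\<Prod>j<s. h j) = h j * (\<Prod>j\<in>{..<s} - {j}. h j)" for h :: "nat \<Rightarrow> rat"
          using j by (intro prod.remove) auto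
        have "(\<Prod>j'\<in>{..<s} - {j}. lin y0 w Sj (l * s + j')) = (\<Prod>j'\<in>{..<s} - {j}. lin y0 w S (l * s + j'))"
          using lt by (intro prod.cong) (auto simp: linSj df_def)
        also have "\<dots> = \<mu> (l * s + j)" using j by (simp add: \<mu>_def)
        finally have e: "(\<Prod>j'\<in>{..<s} - {j}. lin y0 w Sj (l * s + j')) = \<mu> (l * s + j)" .
        have e': "(\<Prod>j'\<in>{..<s} - {j}. lin y0 w S (l * s + j')) = \<mu> (l * s + j)"
          using j by (simp add: \<mu>_def)
        show "(\<Prod>j<s. lin y0 w Sj (l * s + j)) - (\<Prod>j<s. lin y0 w S (l * s + j)) =
            \<mu> (l * s + j) * df S S' j (l * s + j)"
          unfolding r[of "\<lambda>j. lin y0 w Sj (l * s + j)"] r[of "\<lambda>j. lin y0 w S (l * s + j)"] e e' linSj[OF lt[OF j(1)]]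
          by (simp add: algebra_simps)
      qed
      also have "\<dots> = (\<Sum>l<k. \<Sum>j'<s. \<mu> (l * s + j') * df S S' j (l * s + j'))"
      proof (intro sum.cong refl)
        fix l
        have "(\<Sum>j'<s. \<mu> (l * s + j') * df S S' j (l * s + j')) =
          (\<Sum>j'<s. if j' = j then \<mu> (l * s + j) * df S S' j (l * s + j) else 0)"
          by (intro sum.cong) (auto simp: df_def)
        thus "\<mu> (l * s + j) * df S S' j (l * s + j) = (\<Sum>j'<s. \<mu> (l * s + j') * df S S' j (l * s + j'))"
          using j by simp
      qed
      finally show ?thesis unfolding dot_def D_def sum_blocks .
    qed
    moreover have "dot g (lin y0 w Sj) = dot g (lin y0 w S) + dot g (df S S' j)"
      unfolding dot_def sum.distrib[symmetric]
      by (intro sum.cong) (auto simp: linSj algebra_simps)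
    \<comment> \<open>\<open>S'\<close> contains the variables of positive \<open>f\<close>-value
      and omits those of negative one, so moving towards it never lowers \<open>f\<close>.\<close>
    moreover have "dot f (df S S' j) \<ge> 0"
    proof -
      have "dot f (df S S' j) = (\<Sum>e<D. \<Sum>p<N. (if e mod s = j then f e * w p e else 0) * (of_bool (p \<in> S') - of_bool (p \<in> S)))"
        unfolding dot_def
      proof (intro sum.cong refl)
        fix e
        have "df S S' j e = (if e mod s = j then (\<Sum>p<N. (if p \<in> S' then w p e else 0) - (if p \<in> S then w p e else 0)) else 0)"
          unfolding df_def linN[OF SV] linN[OF S'V] by (simp add: sum_subtractf)
        thus "f e * df S S' j e = (\<Sum>p<N. (if e mod s = j then f e * w p e else 0) * (of_bool (p \<in> S') - of_bool (p \<in> S)))"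
          by (cases "e mod s = j") (simp_all add: sum_distrib_left, intro sum.cong, auto)
      qed
      also have "\<dots> = (\<Sum>p<N. (\<Sum>e<D. if e mod s = j then f e * w p e else 0) * (of_bool (p \<in> S') - of_bool (p \<in> S)))"
        unfolding sum_distrib_right by (rule sum.swap)
      also have "\<dots> \<ge> 0"
      proof (intro sum_nonneg)
        fix p assume p: "p \<in> {..<N}"
        show "0 \<le> (\<Sum>e<D. if e mod s = j then f e * w p e else 0) * (of_bool (p \<in> S') - of_bool (p \<in> S))"
        proof (cases "blk p = j")
          case True
          hence "(\<Sum>e<D. if e mod s = j then f e * w p e else 0) = (\<Sum>e<D. f e * w p e)"
            using blk0[of p] p by (intro sum.cong) auto
          moreover have "p \<in> S' \<longleftrightarrow> 0 < key w bs es D p" using p by (simp add: S'_def sel_def)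
          ultimately show ?thesis using sgn[of p] p
            by (cases "(\<Sum>e<D. f e * w p e)" "0 :: rat" rule: linorder_cases)
               (auto simp: mult_le_0_iff zero_le_mult_iff of_bool_def)
        next
          case False
          hence "(\<Sum>e<D. if e mod s = j then f e * w p e else 0) = 0"
            using blk0[of p] p by (intro sum.neutral) auto
          thus ?thesis by simp
        qed
      qed
      finally show ?thesis .
    qed
    ultimately have 1: "F Sj - F S = dot \<mu> (df S S' j)" "dot g (lin y0 w Sj) = dot g (lin y0 w S) + dot g (df S S' j)"
      "dot f (df S S' j) \<ge> 0" by blast+
    \<comment> \<open>Optimality makes the gradient term nonpositive. Were it negative,
      \<open>T\<close> would make \<open>dot f\<close> negative. So it vanishes, \<open>Sj\<close>
      is optimal as well, and the tie-break forces \<open>dot g\<close> to be zero, which genericity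
      permits only for a zero change.\<close>
    have "dot \<mu> (df S S' j) \<le> 0" using 1(1) SF[OF SjV] by simp
    have m0: "dot \<mu> (df S S' j) = 0"
    proof (rule ccontr)
      assume n: "dot \<mu> (df S S' j) \<noteq> 0"
      with \<open>_ \<le> 0\<close> have "\<bar>dot \<mu> (df S S' j)\<bar> = - dot \<mu> (df S S' j)" by simp
      with T[OF dA n] have "\<bar>dot g (df S S' j)\<bar> < - (T * dot \<mu> (df S S' j))" by simp
      thus False using 1(3) dotf by simp
    qed
    hence "F Sj = F S" using 1(1) by simp
    hence "Sj \<in> V1" unfolding V1_def using SjV SF by simp
    from S(2)[OF this] have "dot g (df S S' j) \<le> 0" using 1(2) by simp
    hence "dot g (df S S' j) = 0" using 1(3) dotf m0 by simp
    thus ?thesis using g[OF dA] that by blast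
  qed
  have "lin y0 w S' e = lin y0 w S e" if "e < D" for e
    using d0[of "e mod s" e] that s by (simp add: df_def)
  hence "F S' = F S" unfolding F_def D_def by (intro mlin_cong) simp
  hence "\<forall>X\<subseteq>{..<N}. F X \<le> F S'" using SF unfolding V_def by auto
  thus ?thesis using val unfolding F_def S'_def D_def by blast
qed

section \<open>The enumeration program\<close>

text \<open>Register 0 holds addresses and register 1 the constant one. Every other static register
  is some \<open>rg c i\<close>; classes 2 to 5 are constant after the setup.\<close>

definition rg :: "nat \<Rightarrow> nat \<Rightarrow> nat" where
  "rg c i = 2 + prod_encode (c, i)"

lemma rg_eq [simp]: "rg c i = rg c' i' \<longleftrightarrow> c = c' \<and> i = i'"
  by (simp add: rg_def)

lemma rg_neq [simp]: "rg c i \<noteq> 0" "0 \<noteq> rg c i" "rg c i \<noteq> rO" "rO \<noteq> rg c i" "rO \<noteq> 0" "0 \<noteq> rO"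
  by (simp_all add: rg_def rO_def)

text \<open>\<open>rYB\<close> is the displacement of moved input cells, \<open>rZ\<close> the
  address of the stored selection, \<open>rLO j\<close> the first variable of block
  \<open>j\<close>, \<open>rCB l\<close> the address of the coefficients of set \<open>l\<close>.
  \<open>rV\<close> is the vector being reduced and \<open>rK\<close> its key; \<open>rPB\<close>,
  \<open>rE\<close> and \<open>rB\<close> keep the pivot indices, signs and reduced pivot
  vectors.\<close>

abbreviation "rZero \<equiv> rg 2 2"
abbreviation "rF \<equiv> rg 2 3"
abbreviation "rYB \<equiv> rg 2 4"
abbreviation "rZ \<equiv> rg 2 5"
abbreviation "rLO \<equiv> rg 3"
abbreviation "rCB \<equiv> rg 4"
abbreviation "rY0 \<equiv> rg 5"
abbreviation "rT \<equiv> rg 6 2"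
abbreviation "rU \<equiv> rg 6 3"
abbreviation "rK \<equiv> rg 6 4"
abbreviation "rP \<equiv> rg 6 5"
abbreviation "rObj \<equiv> rg 6 6"
abbreviation "rV \<equiv> rg 7"
abbreviation "rY \<equiv> rg 8"
abbreviation "rPB \<equiv> rg 9"
abbreviation "rE \<equiv> rg 10"
abbreviation "rB d e \<equiv> rg 11 (prod_encode (d, e))"
abbreviation "rBest \<equiv> rg 12 2"

text \<open>Static registers lie below \<open>F\<close>. Input cell \<open>a\<close> stays in place if \<open>a \<ge> F\<close>, and otherwise
  it is moved to cell \<open>X + a - 1\<close>, where \<open>X\<close> is at least the length of the input.\<close>

definition loadin :: "nat \<Rightarrow> com" where
  "loadin v = IfLe rF 0 Skip (B (Add 0 0 rYB)) ;; B (LoadI v 0)"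

locale alg =
  fixes s k F :: nat
begin

definition D :: nat where "D = k * s"

text \<open>A set has one coefficient cell per variable, whichever coordinate asks for it; the
  comparisons keep it only for the block that contains the variable.\<close>

definition loadvec :: com where
  "loadvec = seqs (\<lambda>e. B (Const (rV e) 0) ;;
     IfLe (rLO (e mod s)) rP
       (IfLe (rLO (Suc (e mod s))) rP Skip (B (Add 0 (rCB (e div s)) rP) ;; loadin (rV e)))
       Skip) D"

text \<open>The two comparisons test the entry for zero, in which case the earlier key stands. The
  quotient is saved in \<open>rT\<close> because the subtractions overwrite \<open>rV d\<close> as
  well.\<close>

definition stepc :: "nat \<Rightarrow> com" where
  "stepc d = IfLe (rV d) rZero (IfLe rZero (rV d) Skip (B (Mul rK (rE d) (rV d)))) (B (Mul rK (rE d) (rV d))) ;;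
     B (Dvd rT (rV d) (rB d d)) ;;
     seqs (\<lambda>e. B (Mul rU rT (rB d e)) ;; B (Sub (rV e) (rV e) rU)) D"

definition proc :: "nat \<Rightarrow> com" where
  "proc n = loadvec ;; B (Const rK 0) ;; seqs stepc n"

definition copyB :: "nat \<Rightarrow> com" where
  "copyB n = seqs (\<lambda>e. B (Add (rB n e) (rV e) rZero)) D"

definition inity :: com where
  "inity = seqs (\<lambda>e. B (Add (rY e) (rY0 e) rZero)) D"

text \<open>\<open>proc\<close> destroys the original vector, so it is loaded again once its
  variable turns out to be selected.\<close>

definition sumy :: com where
  "sumy = For rP (rLO s) (proc D ;; IfLe rK rZero Skip
     (loadvec ;; seqs (\<lambda>e. B (Add (rY e) (rY e) (rV e))) D))"

definition evalobj :: com where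
  "evalobj = B (Const rObj 0) ;; seqs (\<lambda>l. B (Const rU 1) ;;
     seqs (\<lambda>j. B (Mul rU rU (rY (l * s + j)))) s ;; B (Add rObj rObj rU)) k"

text \<open>The selection is not recorded during evaluation; it is recomputed here, only for
  candidates that improve on the best value.\<close>

definition store :: com where
  "store = For rP (rLO s) (proc D ;; B (Add 0 rZ rP) ;;
     IfLe rK rZero (B (StoreI 0 rZero)) (B (StoreI 0 rO)))"

definition evalc :: com where
  "evalc = inity ;; sumy ;; evalobj ;; IfLe rObj rBest Skip (B (Add rBest rObj rZero) ;; store)"

text \<open>The argument of \<open>nest\<close> is the number of pivots that remain to be chosen.\<close>

fun nest :: "nat \<Rightarrow> com" where
  "nest 0 = evalc"
| "nest (Suc r) = (let n = D - Suc r in For (rPB n) (rLO s)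
     (B (Add rP (rPB n) rZero) ;; proc n ;; copyB n ;;
      B (Const (rE n) 1) ;; nest r ;; B (Const (rE n) (-1)) ;; nest r))"

end

section \<open>Memory invariants and frames\<close>

lemma addr_of_nat [simp]: "addr (of_nat a) = a"
  by (simp add: addr_def)

definition same :: "nat set \<Rightarrow> mem \<Rightarrow> mem \<Rightarrow> bool" where
  "same W m m' \<longleftrightarrow> (\<forall>a. a \<notin> W \<longrightarrow> m' a = m a)"

lemma same_refl [simp]: "same W m m" by (simp add: same_def)
lemma same_trans: "same W m m' \<Longrightarrow> same W m' m'' \<Longrightarrow> same W m m''" by (simp add: same_def)
lemma same_upd [simp]: "r \<in> W \<Longrightarrow> same W m (m'(r := q)) \<longleftrightarrow> same W m m'" by (auto simp: same_def)

text \<open>Bit bound after \<open>d\<close> eliminations: each combines four numbers of the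
  previous stage.\<close>

fun hh :: "nat \<Rightarrow> nat \<Rightarrow> nat" where
  "hh S 0 = S"
| "hh S (Suc d) = 4 * hh S d + 1"

lemma hh_mono: "d \<le> d' \<Longrightarrow> hh S d \<le> hh S d'"
  by (rule lift_Suc_mono_le[of "hh S"]) auto

text \<open>One encoded instance. \<open>S\<close> bounds the input numbers and \<open>off j\<close>
  counts the variables in the first \<open>j\<close> blocks. There are three size budgets:
  \<open>Hred\<close> for elimination, \<open>Hobj\<close> for inner products and objective,
  \<open>Hadr\<close> for addresses.\<close>

locale inst = alg +
  fixes N X Z H M S :: nat and inp :: "nat \<Rightarrow> rat" and off :: "nat \<Rightarrow> nat"
  assumes s: "s > 0" and N: "N > 0" and FX: "F \<le> X" and NX: "N \<le> X" and Z: "Z = X + F"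
    and regs: "c \<le> 12 \<Longrightarrow> i \<le> s + k + k * s + 10 \<Longrightarrow> rg c i < F"
      "d < k * s \<Longrightarrow> e < k * s \<Longrightarrow> rB d e < F"
    and inp: "bnd S (inp a)" and S: "S > 0"
    and addrX: "2 * s + 2 + k * (s + N) \<le> X"
    and off: "off 0 = 0" "j < s \<Longrightarrow> off j \<le> off (Suc j)" "off s = N"
      "j < s \<Longrightarrow> inp (Suc j) = of_nat (off (Suc j) - off j)"
    and Hred: "hh S (k * s) + hh S (k * s) + hh S (k * s) + 1 \<le> H"
    and Hobj: "k * (s * (N * (S + 1) + S + 4) + 2) + N * (S + 1) + S + 4 + s * (N * (S + 1) + S + 4) + 2 \<le> H"
    and Hadr: "2 * Z + 2 * F + 2 \<le> H" and M: "N \<le> M"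
begin

abbreviation "WP \<equiv> wp H M"

text \<open>The input lists \<open>s\<close>, the block sizes, the number of sets, and for each set
  \<open>s\<close> membership indicators followed by \<open>N\<close> coefficients.\<close>

definition w :: "nat \<Rightarrow> nat \<Rightarrow> rat" where
  "w p e = (if off (e mod s) \<le> p \<and> p < off (Suc (e mod s)) then inp (2 * s + 2 + (e div s) * (s + N) + p) else 0)"

text \<open>One minus the membership indicator: a block outside the set contributes the factor
  1.\<close>

definition y0 :: "nat \<Rightarrow> rat" where
  "y0 e = 1 - inp (s + 2 + (e div s) * (s + N) + e mod s)"

text \<open>The cells that must survive the enumeration. The upper range joins the input cells left
  in place with the moved ones at \<open>X\<close> to \<open>X + F - 2\<close>.\<close>

definition ENV :: "nat set" where
  "ENV = {a. a < F \<and> (a = rO \<or> (\<exists>c i. c \<le> 5 \<and> a = rg c i)) \<or> F \<le> a \<and> a < X + F - 1}"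

definition env :: "mem \<Rightarrow> bool" where
  "env m \<longleftrightarrow> m rO = 1 \<and> m rZero = 0 \<and> m rF = of_nat F \<and> m rYB = of_nat (X - 1) \<and> m rZ = of_nat Z \<and>
     (\<forall>j\<le>s. m (rLO j) = of_nat (off j)) \<and>
     (\<forall>l<k. m (rCB l) = of_nat (2 * s + 2 + l * (s + N))) \<and>
     (\<forall>e<D. m (rY0 e) = y0 e) \<and>
     (\<forall>a. F \<le> a \<and> a < X \<longrightarrow> m a = inp a) \<and>
     (\<forall>a. 1 \<le> a \<and> a < F \<longrightarrow> m (X + a - 1) = inp a)"

lemma regF: "c \<le> 12 \<Longrightarrow> i \<le> 10 \<Longrightarrow> rg c i < F"
  using regs(1)[of c i] by simp

lemma regD: "c \<le> 12 \<Longrightarrow> e < D \<Longrightarrow> rg c e < F"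
  using regs(1)[of c e] by (simp add: D_def)

lemma regs': "c \<le> 12 \<Longrightarrow> j \<le> s \<Longrightarrow> rg c j < F" "c \<le> 12 \<Longrightarrow> l \<le> k \<Longrightarrow> rg c l < F"
  using regs(1)[of c] by simp_all

lemma regB: "d < D \<Longrightarrow> e < D \<Longrightarrow> rB d e < F"
  using regs(2) by (simp add: D_def)

lemma F2: "2 < F" using regF[of 2 2] by (simp add: rg_def)

lemma env_cong:
  assumes "env m" "\<And>a. a \<in> ENV \<Longrightarrow> m' a = m a"
  shows "env m'"
proof -
  have "rg c i \<in> ENV" if "c \<le> 5" "rg c i < F" for c i using that by (auto simp: ENV_def)
  hence "rZero \<in> ENV" "rF \<in> ENV" "rYB \<in> ENV" "rZ \<in> ENV" "j \<le> s \<Longrightarrow> rLO j \<in> ENV"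
    "l < k \<Longrightarrow> rCB l \<in> ENV" "e < D \<Longrightarrow> rY0 e \<in> ENV" for j l e
    by (simp_all add: regF regD regs')
  moreover have "rO \<in> ENV" using F2 by (simp add: ENV_def rO_def)
  moreover have "F \<le> a \<Longrightarrow> a < X \<Longrightarrow> a \<in> ENV" "1 \<le> a \<Longrightarrow> a < F \<Longrightarrow> X + a - 1 \<in> ENV" for a
    using FX F2 by (auto simp: ENV_def)
  ultimately show ?thesis using assms(1) unfolding env_def by (simp add: assms(2))
qed

lemma env_upd: "r \<notin> ENV \<Longrightarrow> env m \<Longrightarrow> env (m(r := q))"
  by (erule env_cong) auto

lemma ENV_rg: "5 < c \<Longrightarrow> rg c i < F \<Longrightarrow> rg c i \<notin> ENV"
  by (auto simp: ENV_def)

lemma ENV_0: "0 \<notin> ENV" using F2 by (auto simp: ENV_def)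

lemma ENV_Z: "Z + p \<notin> ENV" using Z by (auto simp: ENV_def)

definition SCR :: "nat set" where "SCR = {0, rT, rU, rK} \<union> rV ` {..<D}"

lemma SCR_simps [simp]: "0 \<in> SCR" "rT \<in> SCR" "rU \<in> SCR" "rK \<in> SCR" "e < D \<Longrightarrow> rV e \<in> SCR"
  "rO \<notin> SCR" by (auto simp: SCR_def)

lemma SCR_rg [simp]: "c \<noteq> 6 \<Longrightarrow> c \<noteq> 7 \<Longrightarrow> rg c i \<notin> SCR" "i > 4 \<Longrightarrow> rg 6 i \<notin> SCR" by (auto simp: SCR_def)

lemma SCR_F: "a \<in> SCR \<Longrightarrow> a < F" using F2 by (auto simp: SCR_def regF regD)

lemma SCR_ENV: "a \<in> ENV \<Longrightarrow> a \<notin> SCR"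
  using ENV_0 by (auto simp: SCR_def regF regD ENV_rg intro!: gr0I)

lemma env_same: "same SCR m m' \<Longrightarrow> env m \<Longrightarrow> env m'"
  by (erule env_cong) (auto dest: SCR_ENV simp: same_def)

lemma D_lt: "e < D \<Longrightarrow> e mod s < s" "e < D \<Longrightarrow> e div s < k"
  using s by (simp_all add: D_def less_mult_imp_div_less)

lemma off_mono: "i \<le> j \<Longrightarrow> j \<le> s \<Longrightarrow> off i \<le> off j"
proof (induction j)
  case (Suc j)
  thus ?case using off(2)[of j] by (cases "i = Suc j") auto
qed simp

lemma bnd_adr: "a \<le> 2 * Z + 2 * F + 2 \<Longrightarrow> bnd H (of_nat a)"
  using Hadr by (intro bnd_nat) auto

lemma H0: "0 < H" using Hadr by simp

text \<open>The part of \<open>env\<close> that \<open>loadin\<close> relies on; it holds already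
  while the remaining constants are being set up.\<close>

definition env0 :: "mem \<Rightarrow> bool" where
  "env0 m \<longleftrightarrow> m rO = 1 \<and> m rZero = 0 \<and> m rF = of_nat F \<and> m rYB = of_nat (X - 1) \<and> m rZ = of_nat Z \<and>
     (\<forall>a. F \<le> a \<and> a < X \<longrightarrow> m a = inp a) \<and>
     (\<forall>a. 1 \<le> a \<and> a < F \<longrightarrow> m (X + a - 1) = inp a)"

lemma env_env0: "env m \<Longrightarrow> env0 m"
  by (simp add: env_def env0_def)

lemma wp_loadin:
  assumes "env0 m" "m 0 = of_nat a" "1 \<le> a" "a < X" "\<And>q. Q (m(0 := q, v := inp a))"
  shows "WP (loadin v) Q m"
  unfolding loadin_def
proof (rule wp_Seq, rule wp_IfLe)
  note e = assms(1)[unfolded env0_def]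
  { assume "m rF \<le> m 0"
    hence "m a = inp a" using assms e by auto
    moreover have "m(v := inp a) = m(0 := m 0, v := inp a)" by simp
    ultimately show "WP Skip (WP (B (LoadI v 0)) Q) m"
      using assms(5)[of "m 0"] assms(2) by (intro wp_Skip wp_LoadI) simp }
  { assume "\<not> m rF \<le> m 0"
    hence "a < F" using assms e by auto
    hence 1: "m (X + a - 1) = inp a" using assms e by auto
    define b where "b = X + a - 1"
    have 2: "m 0 + m rYB = of_nat b" using assms e by (simp add: b_def)
    show "WP (B (Add 0 0 rYB)) (WP (B (LoadI v 0)) Q) m"
    proof (rule wp_Add, unfold 2)
      show "bnd H (of_nat b)" using assms Z by (intro bnd_adr) (simp add: b_def)
      have "b \<noteq> 0" using assms by (simp add: b_def)
      thus "WP (B (LoadI v 0)) Q (m(0 := of_nat b))"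
        using 1[folded b_def] assms(5) by (intro wp_LoadI) simp
    qed }
qed

lemma adr_lt: "l < k \<Longrightarrow> p < N \<Longrightarrow> 2 * s + 2 + l * (s + N) + p < X"
proof -
  assume "l < k" "p < N"
  hence "l * (s + N) + (s + N) \<le> k * (s + N)" by (metis Suc_leI add.commute mult_Suc mult_le_mono1)
  thus ?thesis using addrX \<open>p < N\<close> by linarith
qed

lemma wp_loadvec:
  assumes "env m" "m rP = of_nat p" "p < N"
  shows "WP loadvec (\<lambda>m'. same SCR m m' \<and> (\<forall>e<D. m' (rV e) = w p e)) m"
  unfolding loadvec_def
proof (rule wp_seqs[where I = "\<lambda>i m'. same SCR m m' \<and> (\<forall>e<i. m' (rV e) = w p e)"])
  fix i m1 assume i: "i < D" and I: "same SCR m m1 \<and> (\<forall>e<i. m1 (rV e) = w p e)"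
  have e: "env m1" using env_same I assms by blast
  have P: "m1 rP = of_nat p" using I assms by (simp add: same_def)
  let ?m = "m1(rV i := 0)"
  have e': "env ?m" using e i by (intro env_upd ENV_rg) (auto simp: regD)
  have lo: "?m (rLO (i mod s)) = of_nat (off (i mod s))" "?m (rLO (Suc (i mod s))) = of_nat (off (Suc (i mod s)))"
    using e' D_lt[OF i] unfolding env_def by (auto simp: Suc_le_eq)
  have cb: "?m (rCB (i div s)) = of_nat (2 * s + 2 + (i div s) * (s + N))"
    using e' D_lt[OF i] unfolding env_def by auto
  let ?Q = "\<lambda>m'. same SCR m m' \<and> (\<forall>e<Suc i. m' (rV e) = w p e)"
  have zero: "?Q ?m" if "w p i = 0" using I i that by (auto simp: less_Suc_eq)
  show "WP (B (Const (rV i) 0) ;;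
     IfLe (rLO (i mod s)) rP
       (IfLe (rLO (Suc (i mod s))) rP Skip (B (Add 0 (rCB (i div s)) rP) ;; loadin (rV i)))
       Skip) ?Q m1"
  proof (rule wp_Seq, rule wp_Const, rule bnd_0[OF H0], rule wp_IfLe, rule wp_IfLe)
    assume "?m (rLO (Suc (i mod s))) \<le> ?m rP"
    thus "WP Skip ?Q ?m" using lo P by (intro wp_Skip zero) (auto simp: w_def)
  next
    assume "\<not> ?m (rLO (i mod s)) \<le> ?m rP"
    thus "WP Skip ?Q ?m" using lo P by (intro wp_Skip zero) (auto simp: w_def)
  next
    assume le: "?m (rLO (i mod s)) \<le> ?m rP" "\<not> ?m (rLO (Suc (i mod s))) \<le> ?m rP"
    let ?a = "2 * s + 2 + (i div s) * (s + N) + p"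
    have w: "w p i = inp ?a" using le lo P by (simp add: w_def)
    have sum: "?m (rCB (i div s)) + ?m rP = of_nat ?a" unfolding cb using P by simp
    have a: "?a < X" using adr_lt D_lt[OF i] assms by simp
    show "WP (B (Add 0 (rCB (i div s)) rP) ;; loadin (rV i)) ?Q ?m"
    proof (rule wp_Seq, rule wp_Add, unfold sum)
      show "bnd H (of_nat ?a)" using a Z by (intro bnd_adr) simp
      show "WP (loadin (rV i)) ?Q (?m(0 := of_nat ?a))"
      proof (rule wp_loadin)
        show "env0 (?m(0 := of_nat ?a))" by (rule env_env0[OF env_upd[OF ENV_0 e']])
        show "?Q (?m(0 := of_nat ?a, 0 := q, rV i := inp ?a))" for q
          using I i by (auto simp: less_Suc_eq w)
      qed (use a in auto)
    qed
  qed
qed auto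

section \<open>Correctness of the elimination\<close>

definition piv :: "nat \<Rightarrow> (nat \<Rightarrow> nat) \<Rightarrow> (nat \<Rightarrow> rat) \<Rightarrow> mem \<Rightarrow> bool" where
  "piv n bs es m \<longleftrightarrow> (\<forall>d<n. m (rPB d) = of_nat (bs d) \<and> m (rE d) = es d \<and>
     (\<forall>e<D. m (rB d e) = red w bs d (bs d) e))"

lemma piv_same: "same SCR m m' \<Longrightarrow> piv n bs es m \<Longrightarrow> piv n bs es m'"
  by (simp add: piv_def same_def)

lemma piv_upd: "(\<And>d. d < n \<Longrightarrow> r \<noteq> rPB d \<and> r \<noteq> rE d \<and> (\<forall>e<D. r \<noteq> rB d e)) \<Longrightarrow>
    piv n bs es (m(r := q)) \<longleftrightarrow> piv n bs es m"
proof -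
  assume *: "\<And>d. d < n \<Longrightarrow> r \<noteq> rPB d \<and> r \<noteq> rE d \<and> (\<forall>e<D. r \<noteq> rB d e)"
  have "(m(r := q)) (rPB d) = m (rPB d)" "(m(r := q)) (rE d) = m (rE d)"
    "e < D \<Longrightarrow> (m(r := q)) (rB d e) = m (rB d e)" if "d < n" for d e
    using *[OF that] by (metis fun_upd_other)+
  thus ?thesis unfolding piv_def by (simp del: fun_upd_apply)
qed

lemma bnd_red: "valid N n bs es \<Longrightarrow> d \<le> n \<Longrightarrow> p < N \<Longrightarrow> bnd (hh S d) (red w bs d p e)"
proof (induction d arbitrary: p e)
  case 0
  show ?case using inp S by (auto simp: w_def bnd_0)
next
  case (Suc d)
  hence b: "bs d < N" by (simp add: valid_def)
  have "bnd (hh S d + (hh S d + hh S d + hh S d) + 1) (red w bs (Suc d) p e)"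
    unfolding red.simps using Suc b by (intro bnd_diff bnd_mult bnd_divide) auto
  thus ?case by (rule bnd_mono) simp
qed

lemma hh_H: "d \<le> D \<Longrightarrow> hh S d + hh S d + hh S d + 1 \<le> H"
  using Hred hh_mono[of d "k * s" S] by (simp add: D_def)

lemma wp_stepc:
  assumes "env m" "piv n bs es m" "valid N n bs es" "n \<le> D" "d < n" "p < N"
    "\<And>e. e < D \<Longrightarrow> m (rV e) = red w bs d p e" "m rK = key w bs es d p"
  shows "WP (stepc d) (\<lambda>m'. same SCR m m' \<and> (\<forall>e<D. m' (rV e) = red w bs (Suc d) p e) \<and>
    m' rK = key w bs es (Suc d) p) m"
proof -
  have dD: "d < D" using assms by simp
  have bd: "bs d < N" "es d \<in> {1, -1}" using assms unfolding valid_def by auto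
  have bp: "bnd (hh S d) (red w bs d p e)" and bb: "bnd (hh S d) (red w bs d (bs d) e)" for e
    using bnd_red[OF assms(3)] assms bd by auto
  have hH: "hh S d + hh S d + hh S d + 1 \<le> H" using hh_H dD by simp
  have be: "bnd 1 (es d)" using bd bnd_1[of 1] bnd_uminus[of 1 1] by auto
  define t where "t = red w bs d p d / red w bs d (bs d) d"
  \<comment> \<open>Entries below \<open>i\<close> are already reduced, the others not yet;
    \<open>t\<close> refers to the values before the pass.\<close>
  let ?I = "\<lambda>i m'. same SCR m m' \<and> m' rT = t \<and> m' rK = key w bs es (Suc d) p \<and>
     (\<forall>e<D. m' (rV e) = (if e < i then red w bs (Suc d) p e else red w bs d p e))"
  have main: "WP (B (Dvd rT (rV d) (rB d d)) ;; seqs (\<lambda>e. B (Mul rU rT (rB d e)) ;; B (Sub (rV e) (rV e) rU)) D)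
    (\<lambda>m'. same SCR m m' \<and> (\<forall>e<D. m' (rV e) = red w bs (Suc d) p e) \<and> m' rK = key w bs es (Suc d) p)
    (m(rK := key w bs es (Suc d) p))"
  proof (rule wp_Seq, rule wp_Dvd)
    let ?m = "m(rK := key w bs es (Suc d) p)"
    have q: "?m (rV d) / ?m (rB d d) = t"
      using assms dD unfolding piv_def t_def by simp
    have bt: "bnd (hh S d + hh S d) t" unfolding t_def using bp bb by (intro bnd_divide)
    show "bnd H (?m (rV d) / ?m (rB d d))" unfolding q using bt hH by (auto elim: bnd_mono)
    show "WP (seqs (\<lambda>e. B (Mul rU rT (rB d e)) ;; B (Sub (rV e) (rV e) rU)) D)
     (\<lambda>m'. same SCR m m' \<and> (\<forall>e<D. m' (rV e) = red w bs (Suc d) p e) \<and> m' rK = key w bs es (Suc d) p)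
     (?m(rT := ?m (rV d) / ?m (rB d d)))" unfolding q
    proof (rule wp_seqs[where I = ?I])
      fix i m1 assume i: "i < D" and I: "?I i m1"
      have "piv n bs es m1" using I piv_same assms by blast
      hence q1: "m1 rT * m1 (rB d i) = t * red w bs d (bs d) i"
        using I i assms unfolding piv_def by simp
      have bu: "bnd (hh S d + hh S d + hh S d) (t * red w bs d (bs d) i)"
        using bt bb by (intro bnd_mult)
      have q2: "m1 (rV i) - t * red w bs d (bs d) i = red w bs (Suc d) p i"
        using I i by (simp add: t_def)
      show "WP (B (Mul rU rT (rB d i)) ;; B (Sub (rV i) (rV i) rU)) (?I (Suc i)) m1"
      proof (rule wp_Seq, rule wp_Mul, unfold q1)
        show "bnd H (t * red w bs d (bs d) i)" using bu hH by (auto elim: bnd_mono)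
        have "bnd H (red w bs (Suc d) p i)"
          using bnd_red[OF assms(3), of "Suc d" p i] assms hh_H[of "Suc d"] dD
          by (auto elim!: bnd_mono)
        thus "WP (B (Sub (rV i) (rV i) rU)) (?I (Suc i)) (m1(rU := t * red w bs d (bs d) i))"
          using q2 I i by (intro wp_Sub) (auto simp: less_Suc_eq simp del: red.simps)
      qed
    qed (use assms in \<open>auto simp del: red.simps key.simps\<close>)
  qed
  have mul: "WP (B (Mul rK (rE d) (rV d))) (WP (B (Dvd rT (rV d) (rB d d)) ;;
      seqs (\<lambda>e. B (Mul rU rT (rB d e)) ;; B (Sub (rV e) (rV e) rU)) D)
    (\<lambda>m'. same SCR m m' \<and> (\<forall>e<D. m' (rV e) = red w bs (Suc d) p e) \<and> m' rK = key w bs es (Suc d) p)) m"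
    if "m (rV d) \<noteq> 0"
  proof (rule wp_Mul)
    have q: "m (rE d) * m (rV d) = es d * red w bs d p d" using assms dD unfolding piv_def by simp
    have k: "key w bs es (Suc d) p = es d * red w bs d p d" using that assms dD by simp
    have "bnd (1 + hh S d) (es d * red w bs d p d)" using be bp by (intro bnd_mult)
    thus "bnd H (m (rE d) * m (rV d))" unfolding q using hH by (auto elim!: bnd_mono)
    show "WP (B (Dvd rT (rV d) (rB d d)) ;;
      seqs (\<lambda>e. B (Mul rU rT (rB d e)) ;; B (Sub (rV e) (rV e) rU)) D)
      (\<lambda>m'. same SCR m m' \<and> (\<forall>e<D. m' (rV e) = red w bs (Suc d) p e) \<and> m' rK = key w bs es (Suc d) p)
      (m(rK := m (rE d) * m (rV d)))" using main unfolding q k .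
  qed
  have z: "m rZero = 0" using assms unfolding env_def by simp
  show ?thesis unfolding stepc_def
  proof (rule wp_Seq, rule wp_IfLe, rule wp_IfLe)
    assume "m (rV d) \<le> m rZero" "m rZero \<le> m (rV d)"
    hence "red w bs d p d = 0" using z assms dD by simp
    hence "key w bs es (Suc d) p = m rK" using assms by simp
    thus "WP Skip (WP (B (Dvd rT (rV d) (rB d d)) ;; seqs (\<lambda>e. B (Mul rU rT (rB d e)) ;; B (Sub (rV e) (rV e) rU)) D)
    (\<lambda>m'. same SCR m m' \<and> (\<forall>e<D. m' (rV e) = red w bs (Suc d) p e) \<and> m' rK = key w bs es (Suc d) p)) m"
      using main by (intro wp_Skip) (simp del: red.simps key.simps)
  qed (use z mul in auto)
qed

lemma wp_proc:
  assumes "env m" "piv n bs es m" "valid N n bs es" "n \<le> D" "p < N" "m rP = of_nat p"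
  shows "WP (proc n) (\<lambda>m'. same SCR m m' \<and> (\<forall>e<D. m' (rV e) = red w bs n p e) \<and>
    m' rK = key w bs es n p) m"
  unfolding proc_def
proof (rule wp_Seq, rule wp_conseq[OF wp_loadvec[OF assms(1,6,5)]], rule wp_Seq, rule wp_Const, rule bnd_0[OF H0])
  fix m1 assume m1: "same SCR m m1 \<and> (\<forall>e<D. m1 (rV e) = w p e)"
  show "WP (seqs stepc n) (\<lambda>m'. same SCR m m' \<and> (\<forall>e<D. m' (rV e) = red w bs n p e) \<and>
    m' rK = key w bs es n p) (m1(rK := 0))"
  proof (rule wp_seqs[where I = "\<lambda>i m'. same SCR m m' \<and> (\<forall>e<D. m' (rV e) = red w bs i p e) \<and>
    m' rK = key w bs es i p"])
    fix i m2 assume i: "i < n" and I: "same SCR m m2 \<and> (\<forall>e<D. m2 (rV e) = red w bs i p e) \<and>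
      m2 rK = key w bs es i p"
    show "WP (stepc i) (\<lambda>m'. same SCR m m' \<and> (\<forall>e<D. m' (rV e) = red w bs (Suc i) p e) \<and>
      m' rK = key w bs es (Suc i) p) m2"
      by (rule wp_conseq[OF wp_stepc[of m2 n bs es i p]])
         (use assms i I env_same piv_same same_trans in \<open>blast+\<close>)
  qed (use m1 in auto)
qed

section \<open>Evaluating and storing a candidate\<close>

abbreviation "Obj A \<equiv> mlin k s (lin y0 w A)"

abbreviation "chosen bs es \<equiv> sel N D w bs es"

definition Best :: "mem \<Rightarrow> bool" where
  "Best m \<longleftrightarrow> (\<exists>A\<subseteq>{..<N}. m rBest = Obj A \<and> (\<forall>p<N. m (Z + p) = (if p \<in> A then 1 else 0)))"

definition WRK :: "nat set" where "WRK = SCR \<union> {rP, rObj} \<union> rY ` {..<D}"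

lemma WRK_simps [simp]: "rP \<in> WRK" "rObj \<in> WRK" "e < D \<Longrightarrow> rY e \<in> WRK" "a \<in> SCR \<Longrightarrow> a \<in> WRK"
  by (simp_all add: WRK_def)

lemma WRK_SCR: "a \<notin> WRK \<Longrightarrow> a \<notin> SCR" by (auto simp: WRK_def)

lemma WRK_ENV: "a \<in> WRK \<Longrightarrow> a \<notin> ENV"
  using SCR_ENV by (auto simp: WRK_def regF regD ENV_rg)

lemma WRK_rg [simp]: "c \<noteq> 6 \<Longrightarrow> c \<noteq> 7 \<Longrightarrow> c \<noteq> 8 \<Longrightarrow> rg c i \<notin> WRK" by (auto simp: WRK_def)

lemma WRK_Z [simp]: "Z + p \<notin> WRK"
proof
  assume "Z + p \<in> WRK"
  hence "Z + p < F" using SCR_F by (auto simp: WRK_def regF regD)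
  thus False using Z by simp
qed

lemma same_WRK: "same SCR m m' \<Longrightarrow> same WRK m m'"
  using WRK_SCR by (simp add: same_def)

lemma env_WRK: "same WRK m m' \<Longrightarrow> env m \<Longrightarrow> env m'"
  by (erule env_cong) (auto dest: WRK_ENV simp: same_def)

lemma piv_WRK: "same WRK m m' \<Longrightarrow> piv n bs es m \<Longrightarrow> piv n bs es m'"
  by (simp add: piv_def same_def)

lemma Best_WRK: "same WRK m m' \<Longrightarrow> Best m \<Longrightarrow> Best m'"
  by (simp add: Best_def same_def)

definition yh :: nat where "yh = N * (S + 1) + S + 4"

lemma bnd_lin: "A \<subseteq> {..<N} \<Longrightarrow> bnd yh (lin y0 w A e)"
proof -
  assume A: "A \<subseteq> {..<N}"
  have c: "card A \<le> N" using card_mono[OF _ A] by simp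
  have "bnd (1 + S + 1) (y0 e)" unfolding y0_def by (intro bnd_diff bnd_1 inp) simp
  moreover have "bnd (card A * (S + 1) + 1) (\<Sum>p\<in>A. w p e)"
    using A inp S by (intro bnd_sum) (auto simp: w_def bnd_0 dest: finite_subset)
  ultimately have "bnd (1 + S + 1 + (card A * (S + 1) + 1) + 1) (lin y0 w A e)"
    unfolding lin_def by (rule bnd_add)
  moreover have "card A * (S + 1) \<le> N * (S + 1)" using c by (rule mult_le_mono1)
  ultimately show ?thesis unfolding yh_def by (elim bnd_mono) linarith
qed

lemma yh_H: "k * (s * yh + 2) + yh + s * yh + 2 \<le> H"
  using Hobj by (simp add: yh_def add.assoc)

lemma bnd_lin_H: "A \<subseteq> {..<N} \<Longrightarrow> bnd H (lin y0 w A e)"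
  using bnd_mono[OF bnd_lin, of A H e] yh_H by simp

lemma wp_inity:
  assumes "env m"
  shows "WP inity (\<lambda>m'. same WRK m m' \<and> (\<forall>e<D. m' (rY e) = lin y0 w {} e)) m"
  unfolding inity_def
proof (rule wp_seqs[where I = "\<lambda>i m'. same WRK m m' \<and> (\<forall>e<i. m' (rY e) = lin y0 w {} e)"])
  fix i m1 assume i: "i < D" and I: "same WRK m m1 \<and> (\<forall>e<i. m1 (rY e) = lin y0 w {} e)"
  hence "env m1" using assms env_WRK by blast
  hence q: "m1 (rY0 i) + m1 rZero = lin y0 w {} i" using i unfolding env_def by (simp add: lin_def)
  show "WP (B (Add (rY i) (rY0 i) rZero)) (\<lambda>m'. same WRK m m' \<and> (\<forall>e<Suc i. m' (rY e) = lin y0 w {} e)) m1"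
  proof (rule wp_Add, unfold q)
    show "bnd H (lin y0 w {} i)" by (intro bnd_lin_H) simp
  qed (use I i in \<open>auto simp: less_Suc_eq\<close>)
qed auto

lemma env_LO: "env m \<Longrightarrow> m (rLO s) = of_nat N"
  by (simp add: env_def off)

lemma NH: "N \<le> H" using NX Z Hadr by linarith

lemma sel_Suc: "A \<inter> {..<Suc j} = (if j \<in> A then insert j (A \<inter> {..<j}) else A \<inter> {..<j})" for A :: "nat set"
  by (auto simp: less_Suc_eq)

lemma wp_sumy:
  assumes "env m" "piv D bs es m" "valid N D bs es" "\<And>e. e < D \<Longrightarrow> m (rY e) = lin y0 w {} e"
  shows "WP sumy (\<lambda>m'. same WRK m m' \<and> (\<forall>e<D. m' (rY e) = lin y0 w (chosen bs es) e)) m"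
proof -
  define A where "A = chosen bs es"
  have AN: "A \<subseteq> {..<N}" by (auto simp: A_def sel_def)
  have step: "lin y0 w (A \<inter> {..<Suc j}) e = lin y0 w (A \<inter> {..<j}) e + (if j \<in> A then w j e else 0)" for j e
    by (simp add: sel_Suc lin_def)
  let ?I = "\<lambda>j m'. same WRK m m' \<and> (\<forall>e<D. m' (rY e) = lin y0 w (A \<inter> {..<j}) e)"
  show ?thesis unfolding sumy_def
  proof (rule wp_For[of N ?I])
    fix j m1 assume j: "j < N" and I: "?I j m1" and P: "m1 rP = of_nat j" "m1 (rLO s) = of_nat N"
    let ?Q = "\<lambda>m'. m' rP = of_nat j \<and> m' (rLO s) = of_nat N \<and> m' rO = 1 \<and> ?I (Suc j) (m'(rP := of_nat (Suc j)))"
    have e1: "env m1" "piv D bs es m1" using I assms env_WRK piv_WRK by blast+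
    have Q: "?Q m'" if "same WRK m1 m'" "m' rP = of_nat j" "\<And>e. e < D \<Longrightarrow> m' (rY e) = lin y0 w (A \<inter> {..<Suc j}) e" for m'
    proof -
      have "env m'" using env_WRK[OF that(1)] e1 by blast
      thus ?thesis using that same_trans[of WRK m m1 m'] I env_LO[of m'] unfolding env_def by simp
    qed
    show "WP (proc D ;; IfLe rK rZero Skip (loadvec ;; seqs (\<lambda>e. B (Add (rY e) (rY e) (rV e))) D)) ?Q m1"
    proof (rule wp_Seq, rule wp_conseq[OF wp_proc[OF e1 assms(3) order_refl j P(1)]])
      fix m2 assume m2: "same SCR m1 m2 \<and> (\<forall>e<D. m2 (rV e) = red w bs D j e) \<and> m2 rK = key w bs es D j"
      have z: "m2 rZero = 0" using env_same[of m1 m2] m2 e1 unfolding env_def by blast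
      have jA: "j \<in> A \<longleftrightarrow> 0 < m2 rK" using m2 j by (simp add: A_def sel_def)
      have y2: "m2 (rY e) = lin y0 w (A \<inter> {..<j}) e" if "e < D" for e
        using m2 I that by (simp add: same_def)
      have P2: "m2 rP = of_nat j" using m2 P by (simp add: same_def)
      show "WP (IfLe rK rZero Skip (loadvec ;; seqs (\<lambda>e. B (Add (rY e) (rY e) (rV e))) D)) ?Q m2"
      proof (rule wp_IfLe)
        assume "m2 rK \<le> m2 rZero"
        hence "j \<notin> A" using jA z by simp
        thus "WP Skip ?Q m2" using m2 y2 P2 step by (intro wp_Skip Q) (auto simp: same_WRK)
      next
        assume "\<not> m2 rK \<le> m2 rZero"
        hence "j \<in> A" using jA z by simp
        hence st: "lin y0 w (A \<inter> {..<Suc j}) e = lin y0 w (A \<inter> {..<j}) e + w j e" for e using step by simp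
        have e2: "env m2" using env_same m2 e1 by blast
        show "WP (loadvec ;; seqs (\<lambda>e. B (Add (rY e) (rY e) (rV e))) D) ?Q m2"
        proof (rule wp_Seq, rule wp_conseq[OF wp_loadvec[OF e2 P2 j]])
          fix m3 assume m3: "same SCR m2 m3 \<and> (\<forall>e<D. m3 (rV e) = w j e)"
          let ?J = "\<lambda>i m'. same WRK m1 m' \<and> m' rP = of_nat j \<and> (\<forall>e<D. m' (rV e) = w j e) \<and>
            (\<forall>e<D. m' (rY e) = lin y0 w (A \<inter> {..<if e < i then Suc j else j}) e)"
          show "WP (seqs (\<lambda>e. B (Add (rY e) (rY e) (rV e))) D) ?Q m3"
          proof (rule wp_seqs[where I = ?J])
            have "same WRK m1 m3" using m2 m3 same_WRK same_trans by blast
            moreover have "m3 rP = m2 rP" "m3 (rY e) = m2 (rY e)" for e using m3 by (simp_all add: same_def)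
            ultimately show "?J 0 m3" using m3 y2 P2 by simp
            fix i m4 assume i: "i < D" and J: "?J i m4"
            have q: "m4 (rY i) + m4 (rV i) = lin y0 w (A \<inter> {..<Suc j}) i" using J i st by simp
            show "WP (B (Add (rY i) (rY i) (rV i))) (?J (Suc i)) m4"
            proof (rule wp_Add, unfold q)
              show "bnd H (lin y0 w (A \<inter> {..<Suc j}) i)"
                using AN by (intro bnd_lin_H) blast
              show "?J (Suc i) (m4(rY i := lin y0 w (A \<inter> {..<Suc j}) i))" using J i by auto
            qed
          next
            fix m4 assume "?J D m4"
            thus "?Q m4" by (intro Q) auto
          qed
        qed
      qed
    qed
  next
    fix m' assume "?I N m'"
    moreover have "A \<inter> {..<N} = A" using AN by blast
    ultimately show "same WRK m m' \<and> (\<forall>e<D. m' (rY e) = lin y0 w (chosen bs es) e)"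
      by (simp add: A_def)
  qed (use assms NH H0 M env_LO in auto)
qed

lemma idx_lt: "l < k \<Longrightarrow> j < s \<Longrightarrow> l * s + j < D"
proof -
  assume "l < k" "j < s"
  hence "l * s + j < Suc l * s" by simp
  also have "\<dots> \<le> k * s" using \<open>l < k\<close> by (intro mult_le_mono1) simp
  finally show ?thesis by (simp add: D_def)
qed

lemma wp_evalobj:
  assumes "\<And>e. e < D \<Longrightarrow> m (rY e) = lin y0 w A e" "A \<subseteq> {..<N}"
  shows "WP evalobj (\<lambda>m'. same WRK m m' \<and> m' rObj = Obj A) m"
proof -
  let ?f = "\<lambda>l j. lin y0 w A (l * s + j)"
  \<comment> \<open>A smaller frame than \<open>WRK\<close>, because the registers \<open>rY\<close>
    must survive while the products are formed.\<close>
  let ?W = "{rObj, rU}"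
  have bp: "bnd (s * yh + 1) (\<Prod>j<i. ?f l j)" if "i \<le> s" for i l
  proof -
    have "bnd (card {..<i} * yh + 1) (\<Prod>j<i. ?f l j)" using assms(2) by (intro bnd_prod bnd_lin) auto
    thus ?thesis by (rule bnd_mono) (use that in simp)
  qed
  have bs: "bnd (k * (s * yh + 2) + 1) (\<Sum>l<i. \<Prod>j<s. ?f l j)" if "i \<le> k" for i
  proof -
    have "bnd (card {..<i} * (s * yh + 1 + 1) + 1) (\<Sum>l<i. \<Prod>j<s. ?f l j)" by (intro bnd_sum bp) auto
    moreover have "i * (s * yh + 2) \<le> k * (s * yh + 2)" using that by (rule mult_le_mono1)
    ultimately show ?thesis by (elim bnd_mono) simp
  qed
  have "WP evalobj (\<lambda>m'. same ?W m m' \<and> m' rObj = Obj A) m"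
    unfolding evalobj_def
  proof (rule wp_Seq, rule wp_Const, rule bnd_0[OF H0], rule wp_seqs[where I =
      "\<lambda>i m'. same ?W m m' \<and> m' rObj = (\<Sum>l<i. \<Prod>j<s. ?f l j)"])
    fix l m1 assume l: "l < k" and I: "same ?W m m1 \<and> m1 rObj = (\<Sum>l<l. \<Prod>j<s. ?f l j)"
    show "WP (B (Const rU 1) ;; seqs (\<lambda>j. B (Mul rU rU (rY (l * s + j)))) s ;; B (Add rObj rObj rU))
      (\<lambda>m'. same ?W m m' \<and> m' rObj = (\<Sum>l<Suc l. \<Prod>j<s. ?f l j)) m1"
    proof (rule wp_Seq, rule wp_Const, rule bnd_1[OF H0], rule wp_Seq, rule wp_seqs[where I =
        "\<lambda>i m'. same ?W m m' \<and> m' rObj = (\<Sum>l<l. \<Prod>j<s. ?f l j) \<and> m' rU = (\<Prod>j<i. ?f l j)"])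
      fix j m2 assume j: "j < s" and J: "same ?W m m2 \<and> m2 rObj = (\<Sum>l<l. \<Prod>j<s. ?f l j) \<and> m2 rU = (\<Prod>j<j. ?f l j)"
      have "m2 (rY (l * s + j)) = m (rY (l * s + j))" using J by (simp add: same_def)
      hence q: "m2 rU * m2 (rY (l * s + j)) = (\<Prod>j<Suc j. ?f l j)" using J assms(1)[OF idx_lt[OF l j]] by simp
      show "WP (B (Mul rU rU (rY (l * s + j)))) (\<lambda>m'. same ?W m m' \<and> m' rObj = (\<Sum>l<l. \<Prod>j<s. ?f l j) \<and>
        m' rU = (\<Prod>j<Suc j. ?f l j)) m2"
      proof (rule wp_Mul, unfold q)
        show "bnd H (\<Prod>j<Suc j. ?f l j)"
          by (rule bnd_mono[OF bp[of "Suc j" l]]) (use j yh_H in auto)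
      qed (use J in auto)
    next
      fix m2 assume J: "same ?W m m2 \<and> m2 rObj = (\<Sum>l<l. \<Prod>j<s. ?f l j) \<and> m2 rU = (\<Prod>j<s. ?f l j)"
      hence q: "m2 rObj + m2 rU = (\<Sum>l<Suc l. \<Prod>j<s. ?f l j)" by simp
      show "WP (B (Add rObj rObj rU)) (\<lambda>m'. same ?W m m' \<and> m' rObj = (\<Sum>l<Suc l. \<Prod>j<s. ?f l j)) m2"
      proof (rule wp_Add, unfold q)
        show "bnd H (\<Sum>l<Suc l. \<Prod>j<s. ?f l j)"
          by (rule bnd_mono[OF bs[of "Suc l"]]) (use l yh_H in auto)
      qed (use J in auto)
    qed (use I in auto)
  qed (auto simp: mlin_def)
  moreover have "same WRK m m'" if "same ?W m m'" for m'
    using that WRK_simps(2) WRK_simps(4)[OF SCR_simps(3)] unfolding same_def by (metis insertE singletonD)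
  ultimately show ?thesis by (auto elim: wp_conseq)
qed

lemma piv_Z: "n \<le> D \<Longrightarrow> piv n bs es (m(Z + p := q)) \<longleftrightarrow> piv n bs es m"
proof (rule piv_upd)
  have *: "Z + p \<noteq> a" if "a < F" for a using that Z by simp
  fix d assume "n \<le> D" "d < n"
  thus "Z + p \<noteq> rPB d \<and> Z + p \<noteq> rE d \<and> (\<forall>e<D. Z + p \<noteq> rB d e)"
    by (intro conjI allI impI *) (simp_all add: regD regB)
qed

lemma piv_0: "piv n bs es (m(0 := q)) \<longleftrightarrow> piv n bs es m"
  by (rule piv_upd) simp

lemma wp_store:
  assumes "env m" "piv D bs es m" "valid N D bs es"
  shows "WP store (\<lambda>m'. env m' \<and> piv D bs es m' \<and> m' rBest = m rBest \<and>
     (\<forall>p<N. m' (Z + p) = (if p \<in> chosen bs es then 1 else 0))) m"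
proof -
  define A where "A = chosen bs es"
  let ?I = "\<lambda>j m'. env m' \<and> piv D bs es m' \<and> m' rBest = m rBest \<and> (\<forall>p<j. m' (Z + p) = (if p \<in> A then 1 else 0))"
  have ZF: "rg c i \<noteq> Z + p" if "rg c i < F" for c i p using that Z by simp
  note ZF' = ZF[OF regF] ZF[OF regD] ZF[OF regB] ZF[OF regs'(1)]
  have upd: "?I j (m'(rP := q))" if "?I j m'" for j m' q
    using that ZF'(1)[of 6 5] ZF'(1)[of 6 5, symmetric] by (simp add: env_upd ENV_rg regF piv_upd)
  show ?thesis unfolding store_def
  proof (rule wp_For[of N ?I])
    fix j m1 assume j: "j < N" and I: "?I j m1" and P: "m1 rP = of_nat j" "m1 (rLO s) = of_nat N"
    let ?Q = "\<lambda>m'. m' rP = of_nat j \<and> m' (rLO s) = of_nat N \<and> m' rO = 1 \<and> ?I (Suc j) (m'(rP := of_nat (Suc j)))"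
    have I': "env m1" "piv D bs es m1" using I by auto
    show "WP (proc D ;; B (Add 0 rZ rP) ;; IfLe rK rZero (B (StoreI 0 rZero)) (B (StoreI 0 rO))) ?Q m1"
    proof (rule wp_Seq, rule wp_conseq[OF wp_proc[OF I' assms(3) order_refl j P(1)]])
      fix m2 assume m2: "same SCR m1 m2 \<and> (\<forall>e<D. m2 (rV e) = red w bs D j e) \<and> m2 rK = key w bs es D j"
      have e2: "env m2" "piv D bs es m2" using env_same piv_same I' m2 by blast+
      have same2: "m2 rP = of_nat j" "m2 rBest = m rBest" using m2 I P by (simp_all add: same_def)
      have Z2: "m2 (Z + p) = m1 (Z + p)" for p
        using m2 WRK_SCR[OF WRK_Z] by (simp add: same_def)
      have jA: "j \<in> A \<longleftrightarrow> 0 < m2 rK" using m2 j by (simp add: A_def sel_def)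
      have q: "m2 rZ + m2 rP = of_nat (Z + j)" using e2 same2 by (simp add: env_def)
      let ?m = "m2(0 := of_nat (Z + j))"
      have e3: "env ?m" using e2 ENV_0 by (intro env_upd)
      have fin: "?Q (?m(Z + j := (if j \<in> A then 1 else 0)))"
      proof -
        let ?m' = "?m(Z + j := (if j \<in> A then 1 else 0))"
        have e': "env ?m'" by (rule env_upd[OF ENV_Z e3])
        have "piv D bs es ?m'"
          using e2 by (simp only: piv_Z order_refl piv_0)
        moreover have "?m' rBest = m rBest" "?m' rP = of_nat j" using same2 ZF'(1)[of 12 2 j] ZF'(1)[of 6 5 j] by auto
        moreover have "\<forall>p<Suc j. ?m' (Z + p) = (if p \<in> A then 1 else 0)"
          using I Z2 Z F2 by (auto simp: less_Suc_eq)
        ultimately show ?thesis using upd[where j = "Suc j" and m' = ?m'] e' env_LO[OF e'] unfolding env_def[of ?m'] by blast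
      qed
      show "WP (B (Add 0 rZ rP) ;; IfLe rK rZero (B (StoreI 0 rZero)) (B (StoreI 0 rO))) ?Q m2"
      proof (rule wp_Seq, rule wp_Add, unfold q)
        show "bnd H (of_nat (Z + j))" using j NX Z by (intro bnd_adr) simp
        have zo: "?m rZero = 0" "?m rO = 1" using e3 unfolding env_def by auto
        show "WP (IfLe rK rZero (B (StoreI 0 rZero)) (B (StoreI 0 rO))) ?Q ?m"
        proof (rule wp_IfLe)
          assume "?m rK \<le> ?m rZero"
          hence "j \<notin> A" using jA zo by simp
          hence eq: "?m(addr (?m 0) := ?m rZero) = ?m(Z + j := (if j \<in> A then 1 else 0))"
            by (simp only: zo addr_of_nat fun_upd_same if_False)
          show "WP (B (StoreI 0 rZero)) ?Q ?m" by (rule wp_StoreI, unfold eq, rule fin)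
        next
          assume "\<not> ?m rK \<le> ?m rZero"
          hence "j \<in> A" using jA zo by simp
          hence eq: "?m(addr (?m 0) := ?m rO) = ?m(Z + j := (if j \<in> A then 1 else 0))"
            by (simp only: zo addr_of_nat fun_upd_same if_True)
          show "WP (B (StoreI 0 rO)) ?Q ?m" by (rule wp_StoreI, unfold eq, rule fin)
        qed
      qed
    qed
  next
    show "?I 0 (m(rP := 0))" using assms upd[where j = 0 and m' = m] by simp
  qed (use assms NH H0 M env_LO in \<open>auto simp: A_def\<close>)
qed

lemma wp_evalc:
  assumes "env m" "Best m" "piv D bs es m" "valid N D bs es"
  shows "WP evalc (\<lambda>m'. env m' \<and> Best m' \<and> piv D bs es m' \<and> m rBest \<le> m' rBest \<and>
    Obj (chosen bs es) \<le> m' rBest) m"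
proof -
  define A where "A = chosen bs es"
  have AN: "A \<subseteq> {..<N}" by (auto simp: A_def sel_def)
  let ?Q = "\<lambda>m'. env m' \<and> Best m' \<and> piv D bs es m' \<and> m rBest \<le> m' rBest \<and> Obj A \<le> m' rBest"
  have "WP evalc ?Q m"
    unfolding evalc_def
  proof (rule wp_Seq, rule wp_conseq[OF wp_inity[OF assms(1)]])
    fix m1 assume m1: "same WRK m m1 \<and> (\<forall>e<D. m1 (rY e) = lin y0 w {} e)"
    hence e1: "env m1" "piv D bs es m1" using assms env_WRK piv_WRK by blast+
    show "WP (sumy ;; evalobj ;; IfLe rObj rBest Skip (B (Add rBest rObj rZero) ;; store)) ?Q m1"
    proof (rule wp_Seq, rule wp_conseq[OF wp_sumy[OF e1 assms(4)]])
      fix m2 assume m2: "same WRK m1 m2 \<and> (\<forall>e<D. m2 (rY e) = lin y0 w (chosen bs es) e)"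
      show "WP (evalobj ;; IfLe rObj rBest Skip (B (Add rBest rObj rZero) ;; store)) ?Q m2"
      proof (rule wp_Seq, rule wp_conseq[OF wp_evalobj[of m2 A, OF _ AN]])
        fix m3 assume m3: "same WRK m2 m3 \<and> m3 rObj = Obj A"
        hence s3: "same WRK m m3" using m1 m2 same_trans by blast
        hence e3: "env m3" "Best m3" "piv D bs es m3" using assms env_WRK piv_WRK Best_WRK by blast+
        have b3: "m3 rBest = m rBest" using s3 by (simp add: same_def)
        show "WP (IfLe rObj rBest Skip (B (Add rBest rObj rZero) ;; store)) ?Q m3"
        proof (rule wp_IfLe)
          assume "m3 rObj \<le> m3 rBest"
          thus "WP Skip ?Q m3" using e3 m3 b3 by (intro wp_Skip) auto
        next
          assume lt: "\<not> m3 rObj \<le> m3 rBest"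
          have q: "m3 rObj + m3 rZero = m3 rObj" using e3 unfolding env_def by simp
          show "WP (B (Add rBest rObj rZero) ;; store) ?Q m3"
          proof (rule wp_Seq, rule wp_Add, unfold q)
            show "bnd H (m3 rObj)" if "good H m3" using that by (rule goodD)
            let ?m = "m3(rBest := m3 rObj)"
            have e4: "env ?m" "piv D bs es ?m" using e3 by (simp_all add: env_upd ENV_rg regF piv_upd)
            show "WP store ?Q ?m"
            proof (rule wp_conseq[OF wp_store[OF e4 assms(4)]])
              fix m4 assume m4: "env m4 \<and> piv D bs es m4 \<and> m4 rBest = ?m rBest \<and>
                (\<forall>p<N. m4 (Z + p) = (if p \<in> chosen bs es then 1 else 0))"
              hence "Best m4" unfolding Best_def using AN m3 by (intro exI[of _ A]) (simp add: A_def)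
              thus "?Q m4" using m4 m3 lt b3 by simp
            qed
          qed
        qed
      qed (use m2 in \<open>simp add: A_def\<close>)
    qed (use m1 in simp)
  qed
  thus ?thesis by (simp add: A_def)
qed

lemma wp_copyB:
  assumes "env m" "n < D" "piv n bs es m" "\<And>e. e < D \<Longrightarrow> m (rV e) = red w bs n b e"
  shows "WP (copyB n) (\<lambda>m'. same (rg 11 ` {e. rg 11 e < F}) m m' \<and> env m' \<and> piv n bs es m' \<and> (\<forall>e<D. m' (rB n e) = red w bs n b e)) m"
  unfolding copyB_def
proof (rule wp_seqs[where I = "\<lambda>i m'. same (rg 11 ` {e. rg 11 e < F}) m m' \<and> env m' \<and> piv n bs es m' \<and> (\<forall>e<i. m' (rB n e) = red w bs n b e)"])
  fix i m1 assume i: "i < D" and I: "same (rg 11 ` {e. rg 11 e < F}) m m1 \<and> env m1 \<and> piv n bs es m1 \<and> (\<forall>e<i. m1 (rB n e) = red w bs n b e)"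
  have "rV i \<notin> rg 11 ` {e. rg 11 e < F}" by auto
  hence "m1 (rV i) = red w bs n b i" using I i assms by (simp add: same_def)
  hence q: "m1 (rV i) + m1 rZero = red w bs n b i" "m1 (rV i) = red w bs n b i" using I unfolding env_def by simp_all
  show "WP (B (Add (rB n i) (rV i) rZero)) (\<lambda>m'. same (rg 11 ` {e. rg 11 e < F}) m m' \<and> env m' \<and> piv n bs es m' \<and> (\<forall>e<Suc i. m' (rB n e) = red w bs n b e)) m1"
  proof (rule wp_Add)
    show "bnd H (m1 (rV i) + m1 rZero)" if "good H m1" using q goodD[OF that, of "rV i"] by simp
  qed (use I i assms in \<open>auto simp: q(1) env_upd ENV_rg regB piv_upd less_Suc_eq\<close>)
qed (use assms in auto)

lemma Best_upd: "r \<noteq> rBest \<Longrightarrow> r < F \<Longrightarrow> Best (m(r := q)) \<longleftrightarrow> Best m"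
proof -
  assume *: "r \<noteq> rBest" "r < F"
  hence "(m(r := q)) (Z + p) = m (Z + p)" for p using Z by simp
  thus ?thesis unfolding Best_def using * by (simp del: fun_upd_apply) simp
qed

lemma Best_B: "same (rg 11 ` {e. rg 11 e < F}) m m' \<Longrightarrow> Best m \<Longrightarrow> Best m'"
proof -
  assume *: "same (rg 11 ` {e. rg 11 e < F}) m m'" "Best m"
  have "Z + p \<notin> rg 11 ` {e. rg 11 e < F}" for p
  proof
    assume "Z + p \<in> rg 11 ` {e. rg 11 e < F}"
    hence "Z + p < F" by auto
    thus False using Z by simp
  qed
  hence "m' (Z + p) = m (Z + p)" for p using * by (simp add: same_def)
  moreover have "rBest \<notin> rg 11 ` {e. rg 11 e < F}" by auto
  hence "m' rBest = m rBest" using * by (simp add: same_def)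
  ultimately show ?thesis using * by (simp add: Best_def)
qed

section \<open>Completeness of the enumeration\<close>

lemma piv_Suc: "piv (Suc n) bs es m \<longleftrightarrow> piv n bs es m \<and> m (rPB n) = of_nat (bs n) \<and> m (rE n) = es n \<and>
    (\<forall>e<D. m (rB n e) = red w bs n (bs n) e)"
  by (auto simp: piv_def less_Suc_eq)

lemma piv_cong: "(\<And>d. d < n \<Longrightarrow> bs d = bs' d \<and> es d = es' d) \<Longrightarrow> piv n bs es m \<longleftrightarrow> piv n bs' es' m"
proof -
  assume *: "\<And>d. d < n \<Longrightarrow> bs d = bs' d \<and> es d = es' d"
  have "red w bs d p e = red w bs' d p e" if "d < n" for d p e
    using that * by (intro red_cong) auto
  thus ?thesis using * unfolding piv_def by simp
qed

definition agree :: "nat \<Rightarrow> (nat \<Rightarrow> nat) \<Rightarrow> (nat \<Rightarrow> rat) \<Rightarrow> (nat \<Rightarrow> nat) \<Rightarrow> (nat \<Rightarrow> rat) \<Rightarrow> bool" where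
  "agree n bs es bs' es' \<longleftrightarrow> (\<forall>d<n. bs' d = bs d \<and> es' d = es d)"

text \<open>The postcondition ranges over all codes that extend the pivots and signs fixed so far;
  for \<open>r = D\<close> these are all codes. The recursive call stands twice in the program text,
  once per sign, which costs only a factor depending on \<open>D\<close>.\<close>

lemma wp_nest:
  assumes "r \<le> D" "env m" "Best m" "piv (D - r) bs es m" "valid N (D - r) bs es"
  shows "WP (nest r) (\<lambda>m'. env m' \<and> Best m' \<and> piv (D - r) bs es m' \<and> m rBest \<le> m' rBest \<and>
    (\<forall>bs' es'. agree (D - r) bs es bs' es' \<and> valid N D bs' es' \<longrightarrow> Obj (chosen bs' es') \<le> m' rBest)) m"
  using assms
proof (induction r arbitrary: m bs es)
  case 0
  have "chosen bs' es' = chosen bs es" if "agree D bs es bs' es'" for bs' es'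
    using that by (intro sel_cong) (auto simp: agree_def)
  thus ?case using wp_evalc[of m bs es] 0 by (auto elim: wp_conseq)
next
  case (Suc r)
  define n where "n = D - Suc r"
  have n: "n < D" "D - r = Suc n" using Suc.prems by (auto simp: n_def)
  \<comment> \<open>Codes extending the fixed part whose next pivot has already been tried.\<close>
  let ?done = "\<lambda>j m'. \<forall>bs' es'. agree n bs es bs' es' \<and> valid N D bs' es' \<and> bs' n < j \<longrightarrow> Obj (chosen bs' es') \<le> m' rBest"
  let ?I = "\<lambda>j m'. env m' \<and> Best m' \<and> piv n bs es m' \<and> m rBest \<le> m' rBest \<and> ?done j m'"
  have upd: "?I j (m'(rPB n := q)) \<longleftrightarrow> ?I j m'" if "env m'" for j m' q
    using n that by (simp add: env_upd ENV_rg regD piv_upd Best_upd)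
  have "WP (nest (Suc r)) (?I N) m"
    unfolding nest.simps Let_def n_def[symmetric]
  proof (rule wp_For[of N ?I])
    fix b m1 assume b: "b < N" and I: "?I b m1" and P: "m1 (rPB n) = of_nat b" "m1 (rLO s) = of_nat N"
    let ?Q = "\<lambda>m'. m' (rPB n) = of_nat b \<and> m' (rLO s) = of_nat N \<and> m' rO = 1 \<and> ?I (Suc b) (m'(rPB n := of_nat (Suc b)))"
    define bs1 where "bs1 = bs(n := b)"
    have red1: "red w bs n p e = red w bs1 n p e" for p e by (rule red_cong) (simp add: bs1_def)
    have z: "m1 rZero = 0" using I unfolding env_def by blast
    have next_level: "WP (nest r) (\<lambda>m'. env m' \<and> Best m' \<and> piv (Suc n) bs1 (es(n := \<epsilon>)) m' \<and> m0 rBest \<le> m' rBest \<and>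
      (\<forall>bs' es'. agree (Suc n) bs1 (es(n := \<epsilon>)) bs' es' \<and> valid N D bs' es' \<longrightarrow> Obj (chosen bs' es') \<le> m' rBest)) m0"
      if "env m0" "Best m0" "piv (Suc n) bs1 (es(n := \<epsilon>)) m0" "\<epsilon> \<in> {1, -1}" for m0 \<epsilon>
    proof (rule Suc.IH[of m0 bs1 "es(n := \<epsilon>)", unfolded n(2)])
      show "valid N (Suc n) bs1 (es(n := \<epsilon>))"
        using that(4) Suc.prems(5) b unfolding n_def[symmetric] by (auto simp: valid_def bs1_def less_Suc_eq)
      show "r \<le> D" using Suc.prems by simp
    qed (rule that)+
    show "WP (B (Add rP (rPB n) rZero) ;; proc n ;; copyB n ;;
      B (Const (rE n) 1) ;; nest r ;; B (Const (rE n) (-1)) ;; nest r) ?Q m1"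
    proof (rule wp_Seq, rule wp_Add, unfold P z add_0_right)
      show "bnd H (of_nat b)" using b NX Z by (intro bnd_adr) simp
      let ?m = "m1(rP := of_nat b)"
      have e1: "env ?m" "Best ?m" "piv n bs es ?m" using I by (simp_all add: env_upd ENV_rg regF Best_upd piv_upd)
      show "WP (proc n ;; copyB n ;; B (Const (rE n) 1) ;; nest r ;; B (Const (rE n) (-1)) ;; nest r) ?Q ?m"
      proof (rule wp_Seq, rule wp_conseq[OF wp_proc[OF e1(1,3) _ _ b]])
        show "valid N n bs es" using Suc.prems by (simp add: n_def)
        fix m2 assume m2: "same SCR ?m m2 \<and> (\<forall>e<D. m2 (rV e) = red w bs n b e) \<and> m2 rK = key w bs es n b"
        hence e2: "env m2" "piv n bs es m2" "Best m2"
          using e1 env_same piv_same same_WRK Best_WRK by blast+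
        have k2: "m2 rBest = m1 rBest" "m2 (rPB n) = of_nat b" using m2 P by (simp_all add: same_def)
        show "WP (copyB n ;; B (Const (rE n) 1) ;; nest r ;; B (Const (rE n) (-1)) ;; nest r) ?Q m2"
        proof (rule wp_Seq, rule wp_conseq[OF wp_copyB[OF e2(1) n(1) e2(2), of b]])
          fix m3 assume m3: "same (rg 11 ` {e. rg 11 e < F}) m2 m3 \<and> env m3 \<and> piv n bs es m3 \<and> (\<forall>e<D. m3 (rB n e) = red w bs n b e)"
          have "Best m3" using m3 Best_B e2 by blast
          have notB: "rBest \<notin> rg 11 ` {e. rg 11 e < F}" "rPB n \<notin> rg 11 ` {e. rg 11 e < F}" by auto
          have k3: "m3 rBest = m1 rBest" "m3 (rPB n) = of_nat b" using m3 k2 notB by (simp_all add: same_def)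
          let ?m3 = "m3(rE n := 1)"
          have pn: "piv n bs1 (es(n := \<epsilon>)) m' \<longleftrightarrow> piv n bs es m'" for m' \<epsilon>
            by (rule piv_cong) (simp add: bs1_def)
          have e3: "env ?m3" "Best ?m3" using m3 \<open>Best m3\<close> n by (simp_all add: env_upd ENV_rg regD Best_upd)
          have p3: "piv (Suc n) bs1 (es(n := 1)) ?m3"
            unfolding piv_Suc pn using m3 k3 by (simp add: piv_upd red1) (simp add: bs1_def)
          show "WP (B (Const (rE n) 1) ;; nest r ;; B (Const (rE n) (-1)) ;; nest r) ?Q m3"
          proof (rule wp_Seq, rule wp_Const, rule bnd_1[OF H0], rule wp_Seq, rule wp_conseq[OF next_level[OF e3 p3]])
            fix m4 assume m4: "env m4 \<and> Best m4 \<and> piv (Suc n) bs1 (es(n := 1)) m4 \<and> ?m3 rBest \<le> m4 rBest \<and>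
              (\<forall>bs' es'. agree (Suc n) bs1 (es(n := 1)) bs' es' \<and> valid N D bs' es' \<longrightarrow> Obj (chosen bs' es') \<le> m4 rBest)"
            let ?m4 = "m4(rE n := -1)"
            have e4: "env ?m4" "Best ?m4" using m4 n by (simp_all add: env_upd ENV_rg regD Best_upd)
            have p4: "piv (Suc n) bs1 (es(n := -1)) ?m4"
              using m4 unfolding piv_Suc pn by (simp add: piv_upd)
            show "WP (B (Const (rE n) (-1)) ;; nest r) ?Q m4"
            proof (rule wp_Seq, rule wp_Const, rule bnd_uminus, rule bnd_1[OF H0], rule wp_conseq[OF next_level[OF e4 p4]])
              fix m5 assume m5: "env m5 \<and> Best m5 \<and> piv (Suc n) bs1 (es(n := -1)) m5 \<and> ?m4 rBest \<le> m5 rBest \<and>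
                (\<forall>bs' es'. agree (Suc n) bs1 (es(n := -1)) bs' es' \<and> valid N D bs' es' \<longrightarrow> Obj (chosen bs' es') \<le> m5 rBest)"
              have le: "m1 rBest \<le> m4 rBest" "m4 rBest \<le> m5 rBest" using m4 m5 k3 by simp_all
              have "?done (Suc b) m5"
              proof (intro allI impI, elim conjE)
                fix bs' es' assume h: "agree n bs es bs' es'" "valid N D bs' es'" "bs' n < Suc b"
                show "Obj (chosen bs' es') \<le> m5 rBest"
                proof (cases "bs' n = b")
                  case False
                  hence "Obj (chosen bs' es') \<le> m1 rBest" using I h by auto
                  thus ?thesis using le by linarith
                next
                  case True
                  \<comment> \<open>The sign at level \<open>n\<close> is 1 or -1, so one of the two
                    recursive calls has covered this code, and \<open>rBest\<close> never
                    decreases.\<close>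
                  have "agree (Suc n) bs1 (es(n := es' n)) bs' es'"
                    using h True by (auto simp: agree_def bs1_def less_Suc_eq)
                  moreover have "es' n = 1 \<or> es' n = -1" using h n by (auto simp: valid_def)
                  ultimately have "Obj (chosen bs' es') \<le> m4 rBest \<or> Obj (chosen bs' es') \<le> m5 rBest"
                    using m4 m5 h(2) by metis
                  thus ?thesis using le by linarith
                qed
              qed
              moreover have "piv n bs es m5" "m5 (rPB n) = of_nat b" using m5 unfolding piv_Suc pn by (auto simp: bs1_def)
              ultimately show "?Q m5" using upd[where j = "Suc b" and m' = m5] m5 le I env_LO[of m5] unfolding env_def[of m5] by auto
            qed simp
          qed simp
        qed (use m2 in simp)
      qed (use n in auto)
    qed
  next
    show "?I 0 (m(rPB n := 0))" using Suc.prems upd[where j = 0 and m' = m] by (simp add: n_def)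
  qed (use Suc.prems NH H0 M env_LO n in auto)
  thus ?case unfolding n_def[symmetric]
  proof (rule wp_conseq)
    fix m' assume I: "?I N m'"
    have "bs' n < N" if "valid N D bs' es'" for bs' es' using that n by (simp add: valid_def)
    thus "env m' \<and> Best m' \<and> piv n bs es m' \<and> m rBest \<le> m' rBest \<and>
      (\<forall>bs' es'. agree n bs es bs' es' \<and> valid N D bs' es' \<longrightarrow> Obj (chosen bs' es') \<le> m' rBest)"
      using I by blast
  qed
qed

end

section \<open>Setup and output\<close>

context alg
begin

text \<open>Cell 0 holds \<open>s\<close>, which the program knows, so it may be overwritten. It
  accumulates \<open>N\<close>, is doubled to \<open>2 ^ E * N\<close>, and then serves as target
  address. Cell 1 is moved before it receives the constant one that advances this address.\<close>

definition prel :: "nat \<Rightarrow> com" where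
  "prel E = B (Const 0 0) ;; seqs (\<lambda>j. B (Add 0 0 (Suc j))) s ;; seqs (\<lambda>_. B (Add 0 0 0)) E ;;
     B (StoreI 0 rO) ;; B (Const rO 1) ;; seqs (\<lambda>i. B (Add 0 0 rO) ;; B (StoreI 0 (i + 2))) (F - 2)"

definition setLO :: com where
  "setLO = B (Const (rLO 0) 0) ;;
     seqs (\<lambda>j. B (Const 0 (of_nat (Suc j))) ;; loadin rU ;; B (Add (rLO (Suc j)) (rLO j) rU)) s"

definition setCB :: com where
  "setCB = B (Const (rCB 0) (of_nat (2 * s + 2))) ;;
     seqs (\<lambda>l. B (Const rT (of_nat s)) ;; B (Add rU (rLO s) rT) ;; B (Add (rCB (Suc l)) (rCB l) rU)) k"

text \<open>The indicator of block \<open>j\<close> lies \<open>s - j\<close> cells before the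
  coefficients of its set.\<close>

definition setY0 :: com where
  "setY0 = seqs (\<lambda>e. B (Const rT (of_nat (s - e mod s))) ;; B (Sub 0 (rCB (e div s)) rT) ;; loadin rU ;;
     B (Sub (rY0 e) rO rU)) D"

text \<open>The value of \<open>X\<close> is recovered from cell 0, which \<open>prel\<close> leaves
  at \<open>X + F - 2\<close>.\<close>

definition setup0 :: com where
  "setup0 = B (Const rT (of_nat (F - 1))) ;; B (Sub rYB 0 rT) ;; B (Const rF (of_nat F)) ;;
     B (Const rZero 0) ;; B (Const rT (of_nat (F + 1))) ;; B (Add rZ rYB rT)"

text \<open>Solution cells from \<open>F\<close> on collide with no static register, so they are
  copied while the registers are still intact.\<close>

definition outhigh :: com where
  "outhigh = For rP (rLO s) (IfLe rF rP (B (Add 0 rZ rP) ;; B (LoadI rU 0) ;; B (StoreI rP rU)) Skip)"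

text \<open>The last two output cells are registers 1 and 0 themselves, and no third register is free:
  cell 0 of the solution is parked at address \<open>2 * Z + 2\<close>, which is obtained by doubling the
  address \<open>Z + 1\<close> of cell 1.\<close>

definition outlow :: com where
  "outlow = B (LoadI rU rZ) ;; B (Add 0 rZ rO) ;; B (Add 0 0 0) ;; B (StoreI 0 rU) ;;
     B (Const rT (of_nat (F - 1))) ;; B (Add 0 rZ rT) ;;
     seqs (\<lambda>i. B (LoadI (F - 1 - i) 0) ;; B (Sub 0 0 rO)) (F - 2) ;;
     B (LoadI rO 0) ;; B (Add 0 0 0) ;; B (LoadI 0 0)"

text \<open>The empty selection is the initial best. Its stored form needs no instructions, because
  the memory from \<open>Z\<close> on is still zero.\<close>

definition mainc :: "nat \<Rightarrow> com" where
  "mainc E = prel E ;; setup0 ;; setLO ;; setCB ;; setY0 ;; inity ;; evalobj ;; B (Add rBest rObj rZero) ;;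
     nest D ;; outhigh ;; outlow"

end

locale inst2 = inst +
  fixes E :: nat
  assumes X: "X = 2 ^ E * N" and inp0: "\<And>a. X \<le> a \<Longrightarrow> inp a = 0"
begin

definition zer :: "mem \<Rightarrow> bool" where
  "zer m \<longleftrightarrow> (\<forall>a\<ge>Z. m a = 0)"

lemma wp_prel:
  "WP (prel E) (\<lambda>m'. m' 0 = of_nat (X + F - 2) \<and> m' rO = 1 \<and>
     (\<forall>a. F \<le> a \<and> a < X \<longrightarrow> m' a = inp a) \<and> (\<forall>a. 1 \<le> a \<and> a < F \<longrightarrow> m' (X + a - 1) = inp a) \<and> zer m') inp"
  unfolding prel_def
proof (rule wp_Seq, rule wp_Const, rule bnd_0[OF H0], rule wp_Seq,
    rule wp_seqs[where I = "\<lambda>i m'. m' = inp(0 := of_nat (off i))"])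
  fix i m1 assume i: "i < s" and I: "m1 = inp(0 := of_nat (off i))"
  have q: "m1 0 + m1 (Suc i) = of_nat (off (Suc i))" using I off(2,4)[OF i] by simp
  have "off (Suc i) \<le> N" using off_mono[of "Suc i" s] i off by simp
  thus "WP (B (Add 0 0 (Suc i))) (\<lambda>m'. m' = inp(0 := of_nat (off (Suc i)))) m1"
    by (intro wp_Add, unfold q) (use I NX Z in \<open>auto intro!: bnd_adr\<close>)
next
  fix m1 assume I: "m1 = inp(0 := of_nat (off s))"
  let ?R = "\<lambda>m'. m' 0 = of_nat (X + F - 2) \<and> m' rO = 1 \<and>
     (\<forall>a. F \<le> a \<and> a < X \<longrightarrow> m' a = inp a) \<and> (\<forall>a. 1 \<le> a \<and> a < F \<longrightarrow> m' (X + a - 1) = inp a) \<and> zer m'"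
  show "WP (seqs (\<lambda>_. B (Add 0 0 0)) E ;; B (StoreI 0 rO) ;; B (Const rO 1) ;;
     seqs (\<lambda>i. B (Add 0 0 rO) ;; B (StoreI 0 (i + 2))) (F - 2)) ?R m1"
  proof (rule wp_Seq, rule wp_seqs[where I = "\<lambda>i m'. m' = inp(0 := of_nat (2 ^ i * N))"])
    show "m1 = inp(0 := of_nat (2 ^ 0 * N))" using I off by simp
    fix i m2 assume i: "i < E" and J: "m2 = inp(0 := of_nat (2 ^ i * N))"
    have q: "m2 0 + m2 0 = of_nat (2 ^ Suc i * N)" using J by simp
    have "2 ^ Suc i * N \<le> X" unfolding X using i by (intro mult_le_mono1 power_increasing) auto
    hence "bnd H (of_nat (2 ^ Suc i * N))" using Z by (intro bnd_adr) linarith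
    thus "WP (B (Add 0 0 0)) (\<lambda>m'. m' = inp(0 := of_nat (2 ^ Suc i * N))) m2"
      by (intro wp_Add, unfold q) (use J in auto)
  next
    fix m2 assume "m2 = inp(0 := of_nat (2 ^ E * N))"
    hence J: "m2 = inp(0 := of_nat X)" unfolding X .
    let ?m = "m2(X := inp 1, rO := 1)"
    have X2: "2 < X" using F2 FX by linarith
    have q: "addr (m2 0) = X" "m2 rO = inp 1" using J by (simp_all add: rO_def)
    let ?I = "\<lambda>i m'. m' 0 = of_nat (X + i) \<and> m' rO = 1 \<and> (\<forall>a. 2 \<le> a \<and> a < X \<longrightarrow> m' a = inp a) \<and>
       (\<forall>a. 1 \<le> a \<and> a \<le> i + 1 \<longrightarrow> m' (X + a - 1) = inp a) \<and> (\<forall>a. X + i < a \<longrightarrow> m' a = 0)"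
    show "WP (B (StoreI 0 rO) ;; B (Const rO 1) ;; seqs (\<lambda>i. B (Add 0 0 rO) ;; B (StoreI 0 (i + 2))) (F - 2)) ?R m2"
    proof (rule wp_Seq, rule wp_StoreI, unfold q, rule wp_Seq, rule wp_Const, rule bnd_1[OF H0], rule wp_seqs[where I = ?I])
      show "?I 0 ?m" using J X2 inp0 by (auto simp: rO_def)
      fix i m3 assume i: "i < F - 2" and K: "?I i m3"
      have q: "m3 0 + m3 rO = of_nat (X + Suc i)" using K by simp
      show "WP (B (Add 0 0 rO) ;; B (StoreI 0 (i + 2))) (?I (Suc i)) m3"
      proof (rule wp_Seq, rule wp_Add, unfold q)
        show "bnd H (of_nat (X + Suc i))" using i Z by (intro bnd_adr) simp
        let ?m3 = "m3(0 := of_nat (X + Suc i))"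
        have v: "?m3 (i + 2) = inp (i + 2)" using K i FX by simp
        have eq: "?m3(addr (?m3 0) := ?m3 (i + 2)) = ?m3(X + Suc i := inp (i + 2))"
          unfolding fun_upd_same addr_of_nat v ..
        have fin: "?I (Suc i) (?m3(X + Suc i := inp (i + 2)))"
        proof (intro conjI allI impI)
          fix a assume a: "1 \<le> a \<and> a \<le> Suc i + 1"
          show "(?m3(X + Suc i := inp (i + 2))) (X + a - 1) = inp a"
          proof (cases "a = i + 2")
            case False
            hence "X + a - 1 \<noteq> X + Suc i" "X + a - 1 \<noteq> 0" "a \<le> i + 1" using a X2 by auto
            thus ?thesis using K a by simp
          qed simp
        qed (use K X2 in \<open>auto simp: rO_def\<close>)
        show "WP (B (StoreI 0 (i + 2))) (?I (Suc i)) ?m3"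
          by (rule wp_StoreI, unfold eq, rule fin)
      qed
    next
      fix m3 assume K: "?I (F - 2) m3"
      have "X + (F - 2) = X + F - 2" using F2 by simp
      thus "?R m3" using K F2 Z unfolding zer_def by auto
    qed
  qed
qed (simp add: off)

lemma env0_upd: "r < F \<Longrightarrow> r \<noteq> rO \<Longrightarrow> r \<noteq> rZero \<Longrightarrow> r \<noteq> rF \<Longrightarrow> r \<noteq> rYB \<Longrightarrow> r \<noteq> rZ \<Longrightarrow> env0 m \<Longrightarrow> env0 (m(r := q))"
proof -
  assume r: "r < F" "r \<noteq> rO" "r \<noteq> rZero" "r \<noteq> rF" "r \<noteq> rYB" "r \<noteq> rZ" "env0 m"
  have "(m(r := q)) a = m a" if "F \<le> a" for a using that r by simp
  moreover have "F \<le> X + a - 1" if "1 \<le> a" for a using that FX by simp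
  ultimately show ?thesis using r unfolding env0_def by (simp del: fun_upd_apply) simp
qed

lemma zer_upd: "r < F \<Longrightarrow> zer m \<Longrightarrow> zer (m(r := q))"
  unfolding zer_def using Z by auto

lemma F0: "0 < F" using F2 by simp

lemma wp_setup0:
  assumes "m 0 = of_nat (X + F - 2)" "m rO = 1"
     "\<forall>a. F \<le> a \<and> a < X \<longrightarrow> m a = inp a" "\<forall>a. 1 \<le> a \<and> a < F \<longrightarrow> m (X + a - 1) = inp a" "zer m"
  shows "WP setup0 (\<lambda>m'. env0 m' \<and> zer m') m"
proof -
  have c: "of_nat (X + F - 2) - of_nat (F - 1) = (of_nat (X - 1) :: rat)"
    using F2 FX by (simp add: of_nat_diff)
  have c': "of_nat (X - 1) + of_nat (F + 1) = (of_nat Z :: rat)"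
    using F2 FX Z by (simp add: of_nat_diff)
  let ?m = "m(rT := of_nat (F - 1), rYB := of_nat (X - 1), rF := of_nat F, rZero := 0, rT := of_nat (F + 1), rZ := of_nat Z)"
  have hi: "?m a = m a" if "F \<le> a" for a
    using that regF[of 6 2] regF[of 2 4] regF[of 2 3] regF[of 2 2] regF[of 2 5] by (auto simp del: rg_eq)
  have "env0 ?m"
    unfolding env0_def
  proof (intro conjI allI impI)
    fix a assume a: "1 \<le> a \<and> a < F"
    hence "F \<le> X + a - 1" using FX by linarith
    thus "?m (X + a - 1) = inp a" using hi assms(4) a by metis
  next
    fix a assume "F \<le> a \<and> a < X"
    thus "?m a = inp a" using hi assms(3) by metis
  qed (use assms(2) in auto)
  moreover have "zer ?m" unfolding zer_def
  proof (intro allI impI)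
    fix a assume "Z \<le> a"
    hence "F \<le> a" "m a = 0" using assms(5) Z unfolding zer_def by auto
    thus "?m a = 0" using hi by metis
  qed
  ultimately have fin: "env0 ?m \<and> zer ?m" ..
  let ?m1 = "m(rT := of_nat (F - 1))"
  let ?m2 = "?m1(rYB := of_nat (X - 1), rF := of_nat F, rZero := 0, rT := of_nat (F + 1))"
  have 1: "?m1 0 - ?m1 rT = of_nat (X - 1)" using assms(1) c by simp
  have 2: "?m2 rYB + ?m2 rT = of_nat Z" using c' by simp
  show ?thesis unfolding setup0_def
    by (rule wp_Seq, rule wp_Const, rule bnd_adr, simp, rule wp_Seq, rule wp_Sub, unfold 1, rule bnd_adr, simp add: Z,
        rule wp_Seq, rule wp_Const, rule bnd_adr, simp, rule wp_Seq, rule wp_Const, rule bnd_0[OF H0],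
        rule wp_Seq, rule wp_Const, rule bnd_adr, use F2 in simp, rule wp_Add, unfold 2, rule bnd_adr, simp, rule fin)
qed

lemma wp_loadin0:
  assumes "env0 m" "1 \<le> a" "a < X" "m 0 = of_nat a"
    "\<And>q. Q (m(0 := q, rU := inp a))"
  shows "WP (loadin rU) Q m"
  using assms by (intro wp_loadin) auto

lemma wp_setLO:
  assumes "env0 m" "zer m"
  shows "WP setLO (\<lambda>m'. env0 m' \<and> zer m' \<and> (\<forall>j\<le>s. m' (rLO j) = of_nat (off j))) m"
  unfolding setLO_def
proof (rule wp_Seq, rule wp_Const, rule bnd_0[OF H0], rule wp_seqs[where I =
    "\<lambda>i m'. env0 m' \<and> zer m' \<and> (\<forall>j\<le>i. m' (rLO j) = of_nat (off j))"])
  show "env0 (m(rLO 0 := 0)) \<and> zer (m(rLO 0 := 0)) \<and> (\<forall>j\<le>0. (m(rLO 0 := 0)) (rLO j) = of_nat (off j))"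
    using assms off by (simp add: env0_upd zer_upd regF)
  fix i m1 assume i: "i < s" and I: "env0 m1 \<and> zer m1 \<and> (\<forall>j\<le>i. m1 (rLO j) = of_nat (off j))"
  let ?m = "m1(0 := of_nat (Suc i))"
  have e: "env0 ?m" using I F0 by (intro env0_upd) auto
  have sX: "Suc i < X" using i addrX by linarith
  let ?Q = "\<lambda>m'. env0 m' \<and> zer m' \<and> (\<forall>j\<le>Suc i. m' (rLO j) = of_nat (off j))"
  show "WP (B (Const 0 (of_nat (Suc i))) ;; loadin rU ;; B (Add (rLO (Suc i)) (rLO i) rU)) ?Q m1"
  proof (rule wp_Seq, rule wp_Const, rule bnd_adr, use sX Z in simp, rule wp_Seq, rule wp_loadin0[OF e _ sX])
    fix q
    let ?m' = "?m(0 := q, rU := inp (Suc i))"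
    have v: "?m' (rLO i) + ?m' rU = of_nat (off (Suc i))" using I off(2,4)[OF i] by simp
    have "env0 ?m'" "zer ?m'" using e I F0 by (simp_all add: env0_upd zer_upd regF)
    hence "?Q (?m'(rLO (Suc i) := of_nat (off (Suc i))))"
      using I i regs'(1)[of 3 "Suc i"] by (auto simp: env0_upd zer_upd le_Suc_eq)
    moreover have "off (Suc i) \<le> N" using off_mono[of "Suc i" s] i off by simp
    ultimately show "WP (B (Add (rLO (Suc i)) (rLO i) rU)) ?Q ?m'"
      by (intro wp_Add, unfold v) (use NX Z in \<open>auto intro!: bnd_adr\<close>)
  qed auto
qed auto

lemma wp_setCB:
  assumes "env0 m" "zer m" "\<forall>j\<le>s. m (rLO j) = of_nat (off j)"
  shows "WP setCB (\<lambda>m'. env0 m' \<and> zer m' \<and> (\<forall>j\<le>s. m' (rLO j) = of_nat (off j)) \<and>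
    (\<forall>l\<le>k. m' (rCB l) = of_nat (2 * s + 2 + l * (s + N)))) m"
  unfolding setCB_def
proof (rule wp_Seq, rule wp_Const, rule bnd_adr, use addrX Z in linarith, rule wp_seqs[where I =
    "\<lambda>i m'. env0 m' \<and> zer m' \<and> (\<forall>j\<le>s. m' (rLO j) = of_nat (off j)) \<and>
    (\<forall>l\<le>i. m' (rCB l) = of_nat (2 * s + 2 + l * (s + N)))"])
  fix i m1 assume i: "i < k" and I: "env0 m1 \<and> zer m1 \<and> (\<forall>j\<le>s. m1 (rLO j) = of_nat (off j)) \<and>
    (\<forall>l\<le>i. m1 (rCB l) = of_nat (2 * s + 2 + l * (s + N)))"
  let ?Q = "\<lambda>m'. env0 m' \<and> zer m' \<and> (\<forall>j\<le>s. m' (rLO j) = of_nat (off j)) \<and>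
    (\<forall>l\<le>Suc i. m' (rCB l) = of_nat (2 * s + 2 + l * (s + N)))"
  let ?m = "m1(rT := of_nat s, rU := of_nat (s + N))"
  have v: "(m1(rT := of_nat s)) (rLO s) + (m1(rT := of_nat s)) rT = of_nat (s + N)"
    using I off by simp
  have v': "?m (rCB i) + ?m rU = of_nat (2 * s + 2 + Suc i * (s + N))" using I by (simp add: algebra_simps)
  have "Suc i * (s + N) \<le> k * (s + N)" using i by (intro mult_le_mono1) simp
  hence b: "2 * s + 2 + Suc i * (s + N) \<le> X" using addrX by linarith
  have e: "env0 ?m" "zer ?m" using I by (simp_all add: env0_upd zer_upd regF)
  have "?Q (?m(rCB (Suc i) := of_nat (2 * s + 2 + Suc i * (s + N))))"
    using I e i regs'(2)[of 4 "Suc i"] by (auto simp: env0_upd zer_upd le_Suc_eq simp del: of_nat_add of_nat_mult of_nat_Suc mult_Suc)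
  thus "WP (B (Const rT (of_nat s)) ;; B (Add rU (rLO s) rT) ;; B (Add (rCB (Suc i)) (rCB i) rU)) ?Q m1"
    by (intro wp_Seq wp_Const wp_Add, unfold v v')
       (use b Z NX addrX in \<open>auto intro!: bnd_adr simp del: of_nat_add of_nat_mult of_nat_Suc mult_Suc\<close>)
qed (use assms in \<open>auto simp: env0_upd zer_upd regF\<close>)

lemma wp_setY0:
  assumes "env0 m" "zer m" "\<forall>j\<le>s. m (rLO j) = of_nat (off j)"
    "\<forall>l\<le>k. m (rCB l) = of_nat (2 * s + 2 + l * (s + N))"
  shows "WP setY0 (\<lambda>m'. env m' \<and> zer m') m"
  unfolding setY0_def
proof (rule wp_seqs[where I = "\<lambda>i m'. env0 m' \<and> zer m' \<and> (\<forall>j\<le>s. m' (rLO j) = of_nat (off j)) \<and>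
    (\<forall>l\<le>k. m' (rCB l) = of_nat (2 * s + 2 + l * (s + N))) \<and> (\<forall>e<i. m' (rY0 e) = y0 e)"])
  fix i m1 assume i: "i < D" and I: "env0 m1 \<and> zer m1 \<and> (\<forall>j\<le>s. m1 (rLO j) = of_nat (off j)) \<and>
    (\<forall>l\<le>k. m1 (rCB l) = of_nat (2 * s + 2 + l * (s + N))) \<and> (\<forall>e<i. m1 (rY0 e) = y0 e)"
  let ?Q = "\<lambda>m'. env0 m' \<and> zer m' \<and> (\<forall>j\<le>s. m' (rLO j) = of_nat (off j)) \<and>
    (\<forall>l\<le>k. m' (rCB l) = of_nat (2 * s + 2 + l * (s + N))) \<and> (\<forall>e<Suc i. m' (rY0 e) = y0 e)"
  note lt = D_lt[OF i]
  define a where "a = s + 2 + (i div s) * (s + N) + i mod s"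
  let ?m1 = "m1(rT := of_nat (s - i mod s))"
  have v: "?m1 (rCB (i div s)) - ?m1 rT = of_nat a" using I lt by (simp add: a_def of_nat_diff)
  have a: "1 \<le> a" "a < X" using adr_lt[OF lt(2), of 0] N lt(1) by (simp_all add: a_def)
  have e: "env0 (?m1(0 := of_nat a))" using I F0 by (simp add: env0_upd regF)
  show "WP (B (Const rT (of_nat (s - i mod s))) ;; B (Sub 0 (rCB (i div s)) rT) ;; loadin rU ;;
     B (Sub (rY0 i) rO rU)) ?Q m1"
  proof (rule wp_Seq, rule wp_Const, rule bnd_adr, use addrX Z in linarith, rule wp_Seq, rule wp_Sub, unfold v,
      rule bnd_adr, use a Z in linarith, rule wp_Seq, rule wp_loadin0[OF e a])
    fix q
    let ?m = "?m1(0 := of_nat a, 0 := q, rU := inp a)"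
    have e': "env0 ?m" "zer ?m" using e I F0 by (simp_all add: env0_upd zer_upd regF)
    have v': "?m rO - ?m rU = y0 i" using e' by (simp add: env0_def y0_def a_def)
    have "bnd H (y0 i)" using bnd_lin_H[of "{}" i] by (simp add: lin_def)
    moreover have "?Q (?m(rY0 i := y0 i))"
      using I e' i by (auto simp: env0_upd zer_upd regD less_Suc_eq)
    ultimately show "WP (B (Sub (rY0 i) rO rU)) ?Q ?m" by (intro wp_Sub, unfold v')
  qed simp
qed (use assms in \<open>auto simp: env_def env0_def\<close>)

section \<open>Writing the solution over input and registers\<close>

lemma wp_outhigh:
  assumes "env m"
  shows "WP outhigh (\<lambda>m'. m' rO = 1 \<and> m' rZ = of_nat Z \<and> (\<forall>a\<ge>X. m' a = m a) \<and>
    (\<forall>a. F \<le> a \<and> a < N \<longrightarrow> m' a = m (Z + a))) m"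
proof -
  let ?I = "\<lambda>j m'. m' rO = 1 \<and> m' rF = of_nat F \<and> m' rZ = of_nat Z \<and> m' (rLO s) = of_nat N \<and> (\<forall>a\<ge>X. m' a = m a) \<and>
    (\<forall>a. F \<le> a \<and> a < j \<longrightarrow> m' a = m (Z + a))"
  have upd: "?I j (m'(rg 6 i := q))" if "?I j m'" "i \<le> 10" for j m' i q
    using that regF[of 6 i] FX by auto
  have upd0: "?I j (m'(0 := q))" if "?I j m'" for j m' q
    using that F0 FX by auto
  have LO: "rLO s < F" by (rule regs'(1)) auto
  show ?thesis unfolding outhigh_def
  proof (rule wp_For[of N ?I])
    fix j m1 assume j: "j < N" and I: "?I j m1" and P: "m1 rP = of_nat j" "m1 (rLO s) = of_nat N"
    let ?Q = "\<lambda>m'. m' rP = of_nat j \<and> m' (rLO s) = of_nat N \<and> m' rO = 1 \<and> ?I (Suc j) (m'(rP := of_nat (Suc j)))"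
    have Q: "?Q m'" if "m' rP = of_nat j" "?I (Suc j) m'" for m'
      using upd[OF that(2), where i = 5] that by auto
    show "WP (IfLe rF rP (B (Add 0 rZ rP) ;; B (LoadI rU 0) ;; B (StoreI rP rU)) Skip) ?Q m1"
    proof (rule wp_IfLe)
      assume "m1 rF \<le> m1 rP"
      hence Fj: "F \<le> j" using I P by simp
      have v: "m1 rZ + m1 rP = of_nat (Z + j)" using I P by simp
      let ?m = "m1(0 := of_nat (Z + j))"
      have mz: "?m (Z + j) = m (Z + j)" using I Z F0 by simp
      let ?m' = "?m(rU := m (Z + j))"
      have I': "?I j ?m'" using upd[where j = j and m' = ?m and i = 3] upd0[where j = j and m' = m1] I by simp
      have "?I (Suc j) (?m'(j := m (Z + j)))"
      proof -
        have ne: "rO \<noteq> j" "rF \<noteq> j" "rZ \<noteq> j" "rLO s \<noteq> j"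
          using Fj F2 regF[of 2 3] regF[of 2 5] LO by (auto simp: rO_def)
        have "(?m'(j := m (Z + j))) a = m a" if "X \<le> a" for a using I' that j NX by simp
        moreover have "(?m'(j := m (Z + j))) a = m (Z + a)" if "F \<le> a \<and> a < Suc j" for a
          using I' that by (cases "a = j") auto
        ultimately show ?thesis using I' ne by (simp del: fun_upd_apply) simp
      qed
      moreover have "(?m'(j := m (Z + j))) rP = of_nat j" using P Fj regF[of 6 5] by auto
      ultimately have fin: "?Q (?m'(j := m (Z + j)))" by (rule Q[rotated])
      have st: "?m'(addr (?m' rP) := ?m' rU) = ?m'(j := m (Z + j))" using P by simp
      show "WP (B (Add 0 rZ rP) ;; B (LoadI rU 0) ;; B (StoreI rP rU)) ?Q m1"
      proof (rule wp_Seq, rule wp_Add, unfold v)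
        show "bnd H (of_nat (Z + j))" using j NX Z by (intro bnd_adr) simp
        have ld: "?m (addr (?m 0)) = m (Z + j)" unfolding fun_upd_same addr_of_nat by (rule mz)
        show "WP (B (LoadI rU 0) ;; B (StoreI rP rU)) ?Q ?m"
          by (rule wp_Seq, rule wp_LoadI, unfold ld, rule wp_StoreI, unfold st, rule fin)
      qed
    next
      assume "\<not> m1 rF \<le> m1 rP"
      hence "j < F" using I P by simp
      thus "WP Skip ?Q m1" using I P by (intro wp_Skip Q) (auto simp: less_Suc_eq)
    qed
  next
    show "?I 0 (m(rP := 0))" using upd[where j = 0 and m' = m and i = 5 and q = 0] assms env_LO[OF assms] by (simp add: env_def)
  qed (use assms NH H0 M env_LO in auto)
qed

lemma wp_outlow:
  assumes "m rO = 1" "m rZ = of_nat Z" "\<forall>a\<ge>X. m a = x a" "\<forall>a. F \<le> a \<and> a < N \<longrightarrow> m a = x (Z + a)"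
  shows "WP outlow (\<lambda>m'. \<forall>a<N. m' a = x (Z + a)) m"
proof -
  have ZF: "F \<le> Z" "X \<le> Z" "Z + a \<noteq> 0" for a using Z F0 by auto
  \<comment> \<open>Registers are replaced from \<open>F - 1\<close> downwards, with cell 0 as
    source address and \<open>rO\<close> as decrement, so these two are the last to go. After
    \<open>F - 2\<close> rounds cell 0 points to the source of cell 1.\<close>
  let ?I = "\<lambda>i m'. m' 0 = of_nat (Z + (F - 1 - i)) \<and> m' rO = 1 \<and> m' (2 * Z + 2) = x Z \<and> (\<forall>p<F. m' (Z + p) = x (Z + p)) \<and>
     (\<forall>a. F \<le> a \<and> a < N \<longrightarrow> m' a = x (Z + a)) \<and> (\<forall>a. F - 1 - i < a \<and> a < F \<longrightarrow> m' a = x (Z + a))"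
  let ?m1 = "m(rU := x Z, 0 := of_nat (Z + 1), 0 := of_nat (2 * Z + 2), 2 * Z + 2 := x Z, rT := of_nat (F - 1), 0 := of_nat (Z + (F - 1)))"
  have hi: "?m1 a = (if a = 2 * Z + 2 then x Z else m a)" if "F \<le> a" for a
    using that regF[of 6 2] regF[of 6 3] F0 by auto
  have rO: "rO \<noteq> 2 * Z + 2" "rZ \<noteq> 2 * Z + 2" using Z F2 regF[of 2 5] by (auto simp: rO_def)
  have I0: "?I 0 ?m1"
  proof (intro conjI allI impI)
    show "?m1 (2 * Z + 2) = x Z" using hi[of "2 * Z + 2"] Z by simp
    fix p assume p: "p < F"
    show "?m1 (Z + p) = x (Z + p)" using hi[of "Z + p"] p Z assms(3) by simp
  next
    fix a assume "F \<le> a \<and> a < N"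
    thus "?m1 a = x (Z + a)" using hi[of a] assms(4) NX Z by simp
  qed (use rO assms in auto)
  have main: "WP (seqs (\<lambda>i. B (LoadI (F - 1 - i) 0) ;; B (Sub 0 0 rO)) (F - 2) ;;
     B (LoadI rO 0) ;; B (Add 0 0 0) ;; B (LoadI 0 0)) (\<lambda>m'. \<forall>a<N. m' a = x (Z + a)) ?m1"
  proof (rule wp_Seq, rule wp_seqs[where I = ?I])
    show "?I 0 ?m1" by (rule I0)
    fix i m' assume i: "i < F - 2" and I: "?I i m'"
    define b where "b = F - 1 - i"
    have b: "2 \<le> b" "b < F" "F - 1 - Suc i = b - 1" using i by (auto simp: b_def)
    have I': "?I i m'" by (rule I)
    note I = I[folded b_def]
    have "m' 0 = of_nat (Z + b)" using I by blast
    hence l: "m' (addr (m' 0)) = x (Z + b)" using I b by (simp only: addr_of_nat; blast)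
    let ?m = "m'(b := x (Z + b))"
    have v: "?m 0 - ?m rO = of_nat (Z + (b - 1))" using I b by (simp add: rO_def of_nat_diff)
    have fin: "?I (Suc i) (?m(0 := of_nat (Z + (b - 1))))"
      unfolding b(3)
    proof (intro conjI allI impI)
      fix a assume a: "b - 1 < a \<and> a < F"
      show "(?m(0 := of_nat (Z + (b - 1)))) a = x (Z + a)"
      proof (cases "a = b")
        case False
        hence "b < a" using a by linarith
        thus ?thesis using I a by simp
      qed (use b in simp)
    qed (use I b ZF in \<open>auto simp: rO_def\<close>)
    show "WP (B (LoadI (F - 1 - i) 0) ;; B (Sub 0 0 rO)) (?I (Suc i)) m'"
      unfolding b_def[symmetric]
    proof (rule wp_Seq, rule wp_LoadI, unfold l, rule wp_Sub, unfold v)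
      show "bnd H (of_nat (Z + (b - 1)))" using b Z by (intro bnd_adr) simp
    qed (rule fin)
  next
    fix m' assume I: "?I (F - 2) m'"
    have F1: "F - 1 - (F - 2) = 1" using F2 by simp
    note I = I[unfolded F1]
    have "m' 0 = of_nat (Z + 1)" using I by blast
    hence l: "m' (addr (m' 0)) = x (Z + 1)" using I F2 by (simp only: addr_of_nat; auto)
    let ?m = "m'(rO := x (Z + 1))"
    have v: "?m 0 + ?m 0 = of_nat (2 * Z + 2)" using I by simp
    have l': "(?m(0 := of_nat (2 * Z + 2))) (addr ((?m(0 := of_nat (2 * Z + 2))) 0)) = x Z"
      unfolding fun_upd_same addr_of_nat using I rO by simp
    show "WP (B (LoadI rO 0) ;; B (Add 0 0 0) ;; B (LoadI 0 0)) (\<lambda>m'. \<forall>a<N. m' a = x (Z + a)) m'"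
    proof (rule wp_Seq, rule wp_LoadI, unfold l, rule wp_Seq, rule wp_Add, unfold v, rule bnd_adr, simp,
        rule wp_LoadI, unfold l', intro allI impI)
      fix a assume a: "a < N"
      show "(?m(0 := of_nat (2 * Z + 2), 0 := x Z)) a = x (Z + a)"
      proof (cases "a < F")
        case True
        thus ?thesis using I a by (cases "a = 0"; cases "a = 1") (auto simp: rO_def)
      next
        case False
        thus ?thesis using I a F2 by (auto simp: rO_def)
      qed
    qed
  qed
  have e1: "m (addr (m rZ)) = x Z" using assms ZF by simp
  have e2: "(m(rU := x Z)) rZ + (m(rU := x Z)) rO = of_nat (Z + 1)" using assms by simp
  let ?m2 = "m(rU := x Z, 0 := of_nat (Z + 1))"
  have e3: "?m2 0 + ?m2 0 = of_nat (2 * Z + 2)" by simp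
  let ?m3 = "?m2(0 := of_nat (2 * Z + 2))"
  have e4: "?m3(addr (?m3 0) := ?m3 rU) = ?m3(2 * Z + 2 := x Z)" unfolding fun_upd_same addr_of_nat by simp
  let ?m4 = "?m3(2 * Z + 2 := x Z, rT := of_nat (F - 1))"
  have e5: "?m4 rZ + ?m4 rT = of_nat (Z + (F - 1))" using assms rO by simp
  show ?thesis unfolding outlow_def
    by (rule wp_Seq, rule wp_LoadI, unfold e1, rule wp_Seq, rule wp_Add, unfold e2, rule bnd_adr, simp,
        rule wp_Seq, rule wp_Add, unfold e3, rule bnd_adr, simp, rule wp_Seq, rule wp_StoreI, unfold e4,
        rule wp_Seq, rule wp_Const, rule bnd_adr, simp, rule wp_Seq, rule wp_Add, unfold e5, rule bnd_adr, simp,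
        rule main)
qed

text \<open>Blocks are consecutive intervals of variables, so the block of \<open>p\<close> is the
  first one ending beyond \<open>p\<close>. This supplies the block map for
  \<open>exists_optimal_code\<close>.\<close>

lemma w_blk:
  assumes "e < k * s" "w p e \<noteq> 0"
  shows "e mod s = (LEAST j. p < off (Suc j))"
proof -
  have *: "off (e mod s) \<le> p" "p < off (Suc (e mod s))" using assms by (auto simp: w_def split: if_splits)
  show ?thesis
  proof (rule Least_equality[symmetric])
    fix j assume j: "p < off (Suc j)"
    show "e mod s \<le> j"
    proof (rule ccontr)
      assume "\<not> e mod s \<le> j"
      hence "off (Suc j) \<le> off (e mod s)" using s by (intro off_mono) auto
      thus False using j * by simp
    qed
  qed (use * in simp)
qed

theorem wp_mainc:
  "WP (mainc E) (\<lambda>m'. \<exists>A\<subseteq>{..<N}. (\<forall>p<N. m' p = (if p \<in> A then 1 else 0)) \<and>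
     (\<forall>A'\<subseteq>{..<N}. Obj A' \<le> Obj A)) inp"
  unfolding mainc_def
proof (rule wp_Seq, rule wp_conseq[OF wp_prel], rule wp_Seq, elim conjE, rule wp_conseq[OF wp_setup0], assumption+,
    rule wp_Seq, elim conjE, rule wp_conseq[OF wp_setLO], assumption+,
    rule wp_Seq, elim conjE, rule wp_conseq[OF wp_setCB], assumption+,
    rule wp_Seq, elim conjE, rule wp_conseq[OF wp_setY0], assumption+,
    rule wp_Seq, elim conjE, rule wp_conseq[OF wp_inity], assumption)
  let ?R = "\<lambda>m'. \<exists>A\<subseteq>{..<N}. (\<forall>p<N. m' p = (if p \<in> A then 1 else 0)) \<and> (\<forall>A'\<subseteq>{..<N}. Obj A' \<le> Obj A)"
  fix m m1 assume m: "env m" "zer m" and m1: "same WRK m m1 \<and> (\<forall>e<D. m1 (rY e) = lin y0 w {} e)"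
  show "WP (evalobj ;; B (Add rBest rObj rZero) ;; nest D ;; outhigh ;; outlow) ?R m1"
  proof (rule wp_Seq, rule wp_conseq[OF wp_evalobj[where A = "{}"]])
    fix m2 assume m2: "same WRK m1 m2 \<and> m2 rObj = Obj {}"
    hence s2: "same WRK m m2" using m1 same_trans by blast
    hence e2: "env m2" using env_WRK m by blast
    have Z2: "m2 (Z + p) = 0" for p using s2 m by (simp add: same_def zer_def)
    have q: "m2 rObj + m2 rZero = m2 rObj" using e2 unfolding env_def by simp
    let ?m = "m2(rBest := m2 rObj)"
    have e: "env ?m" using e2 by (simp add: env_upd ENV_rg regF)
    have "rBest \<noteq> Z + p" for p using regF[of 12 2] Z by simp
    hence B: "Best ?m" unfolding Best_def using Z2 m2 by (intro exI[of _ "{}"]) (auto dest: not_sym)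
    \<comment> \<open>No pivot is fixed yet, so both conditions are vacuous and the enumeration
      covers every code.\<close>
    have p: "piv (D - D) undefined undefined ?m" "valid N (D - D) undefined undefined"
      by (simp_all add: piv_def valid_def)
    show "WP (B (Add rBest rObj rZero) ;; nest D ;; outhigh ;; outlow) ?R m2"
    proof (rule wp_Seq, rule wp_Add, unfold q)
      show "bnd H (m2 rObj)" if "good H m2" using that by (rule goodD)
      show "WP (nest D ;; outhigh ;; outlow) ?R ?m"
      proof (rule wp_Seq, rule wp_conseq[OF wp_nest[OF order_refl e B p]], elim conjE, rule wp_Seq,
          rule wp_conseq[OF wp_outhigh], assumption, elim conjE, rule wp_conseq[OF wp_outlow], assumption+)
        fix m3 m4 :: mem
        assume m3: "Best m3" "\<forall>bs' es'. agree (D - D) undefined undefined bs' es' \<and> valid N D bs' es' \<longrightarrow>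
            Obj (chosen bs' es') \<le> m3 rBest" and m4: "\<forall>a<N. m4 a = m3 (Z + a)"
        \<comment> \<open>Some code is optimal, the final value is at least that of every code, and
          it is attained by the stored selection.\<close>
        obtain bs es where val: "valid N D bs es" and opt: "\<forall>S\<subseteq>{..<N}. Obj S \<le> Obj (chosen bs es)"
          using exists_optimal_code[of N s k w "\<lambda>p. LEAST j. p < off (Suc j)" y0] N s w_blk
          unfolding D_def by blast
        obtain A where A: "A \<subseteq> {..<N}" "m3 rBest = Obj A" "\<forall>p<N. m3 (Z + p) = (if p \<in> A then 1 else 0)"
          using m3(1) unfolding Best_def by blast
        have "Obj (chosen bs es) \<le> Obj A" using m3(2) val A(2) by (simp add: agree_def)
        hence "\<forall>A'\<subseteq>{..<N}. Obj A' \<le> Obj A" using opt order_trans by blast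
        thus "?R m4" using A m4 by (intro exI[of _ A]) simp
      qed
    qed
  qed (use m1 in auto)
qed

end

section \<open>The encoding\<close>

lemma length_concat_upt: "length (concat (map f [0..<n])) = (\<Sum>i<n. length (f i))"
  by (induction n) auto

lemma nth_concat_upt:
  assumes "i < n" "r < length (f i)"
  shows "concat (map f [0..<n]) ! ((\<Sum>i'<i. length (f i')) + r) = f i ! r"
  using assms
proof (induction n)
  case (Suc n)
  show ?case
  proof (cases "i = n")
    case True
    thus ?thesis by (simp add: nth_append length_concat_upt)
  next
    case False
    hence i: "i < n" using Suc by simp
    have "(\<Sum>i'<i. length (f i')) + r < (\<Sum>i'<Suc i. length (f i'))" using Suc by simp
    also have "\<dots> \<le> (\<Sum>i'<n. length (f i'))" using i by (intro sum_mono2) auto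
    finally show ?thesis using Suc i by (simp add: nth_append length_concat_upt)
  qed
qed simp

text \<open>Zero-based counterpart of the prefix sums in \<open>out_pos\<close>.\<close>

definition offs :: "(nat \<Rightarrow> nat) \<Rightarrow> nat \<Rightarrow> nat" where
  "offs n j = (\<Sum>i<j. n (Suc i))"

lemma offs_mono: "i \<le> j \<Longrightarrow> offs n i \<le> offs n j"
  unfolding offs_def by (intro sum_mono2) auto

lemma offs_Suc [simp]: "offs n (Suc j) = offs n j + n (Suc j)"
  by (simp add: offs_def)

lemma out_pos_offs: "out_pos n (Suc j) (Suc i) = offs n j + i"
  unfolding out_pos_def offs_def One_nat_def sum.shift_bounds_Suc_ivl lessThan_atLeast0 by simp

lemma offs_inj:
  assumes "offs n j + i = offs n j' + i'" "i < n (Suc j)" "i' < n (Suc j')"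
  shows "j = j' \<and> i = i'"
proof (cases j j' rule: linorder_cases)
  case less
  hence "offs n (Suc j) \<le> offs n j'" by (intro offs_mono) simp
  thus ?thesis using assms by simp
next
  case greater
  hence "offs n (Suc j') \<le> offs n j" by (intro offs_mono) simp
  thus ?thesis using assms by simp
qed (use assms in auto)

lemma upt_Suc_shift: "map f [1..<s + 1] = map (\<lambda>j. f (Suc j)) [0..<s]"
  by (rule nth_equalityI) (simp_all del: upt_Suc)

lemma enc_set_nth:
  shows length_enc_set: "length (enc_set s n c I) = s + offs n s"
    and "j < s \<Longrightarrow> enc_set s n c I ! j = (if Suc j \<in> I then 1 else 0)"
    and "j < s \<Longrightarrow> i < n (Suc j) \<Longrightarrow>
      enc_set s n c I ! (s + (offs n j + i)) = (if Suc j \<in> I then c I (Suc j) (Suc i) else 0)"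
proof -
  define f where "f j = (if Suc j \<in> I then map (c I (Suc j)) [1..<n (Suc j) + 1] else replicate (n (Suc j)) 0)" for j
  have len: "length (f j) = n (Suc j)" for j by (simp add: f_def)
  have enc: "enc_set s n c I = map (\<lambda>j. if Suc j \<in> I then 1 else 0) [0..<s] @ concat (map f [0..<s])"
    unfolding enc_set_def upt_Suc_shift f_def by simp
  show "length (enc_set s n c I) = s + offs n s" unfolding enc by (simp add: length_concat_upt len offs_def del: length_concat)
  show "j < s \<Longrightarrow> enc_set s n c I ! j = (if Suc j \<in> I then 1 else 0)" unfolding enc by (simp add: nth_append)
  assume j: "j < s" "i < n (Suc j)"
  have "enc_set s n c I ! (s + (offs n j + i)) = concat (map f [0..<s]) ! (offs n j + i)"
    unfolding enc by (simp add: nth_append)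
  also have "\<dots> = f j ! i" using nth_concat_upt[of j s i f] j by (simp add: len offs_def)
  also have "\<dots> = (if Suc j \<in> I then c I (Suc j) (Suc i) else 0)" using j by (simp add: f_def del: upt_Suc)
  finally show "enc_set s n c I ! (s + (offs n j + i)) = (if Suc j \<in> I then c I (Suc j) (Suc i) else 0)" .
qed

lemma encode_nth:
  fixes s :: nat and n :: "nat \<Rightarrow> nat"
  defines "N \<equiv> offs n s"
  shows length_encode: "length (encode s n Is c) = s + 2 + length Is * (s + N)"
    and "j < s \<Longrightarrow> encode s n Is c ! Suc j = of_nat (n (Suc j))"
    and "l < length Is \<Longrightarrow> r < s + N \<Longrightarrow> encode s n Is c ! (s + 2 + l * (s + N) + r) = enc_set s n c (Is ! l) ! r"
proof -
  define f where "f l = enc_set s n c (Is ! l)" for l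
  have len: "length (f l) = s + N" for l by (simp add: f_def length_enc_set N_def)
  have "map (enc_set s n c) Is = map f [0..<length Is]" by (rule nth_equalityI) (auto simp: f_def)
  hence enc: "encode s n Is c = (of_nat s # map (\<lambda>j. of_nat (n (Suc j))) [0..<s] @ [of_nat (length Is)]) @ concat (map f [0..<length Is])"
    unfolding encode_def upt_Suc_shift by simp
  show "length (encode s n Is c) = s + 2 + length Is * (s + N)"
    unfolding enc by (simp add: length_concat_upt len del: length_concat)
  show "j < s \<Longrightarrow> encode s n Is c ! Suc j = of_nat (n (Suc j))" unfolding enc by (simp add: nth_append)
  assume l: "l < length Is" "r < s + N"
  have "encode s n Is c ! (s + 2 + l * (s + N) + r) = concat (map f [0..<length Is]) ! (l * (s + N) + r)"
    unfolding enc by (subst nth_append) (simp add: add.assoc)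
  also have "\<dots> = f l ! r" using nth_concat_upt[of l "length Is" r f] l by (simp add: len)
  finally show "encode s n Is c ! (s + 2 + l * (s + N) + r) = enc_set s n c (Is ! l) ! r" by (simp add: f_def)
qed

locale encoded =
  fixes s k :: nat and n :: "nat \<Rightarrow> nat" and Is :: "nat set list" and c :: "nat set \<Rightarrow> nat \<Rightarrow> nat \<Rightarrow> rat"
    and N :: nat and inp :: "nat \<Rightarrow> rat" and off :: "nat \<Rightarrow> nat"
  assumes wf: "wf_instance s n Is" and k: "length Is \<le> k"
    and N_def: "N = offs n s" and off_def: "off = offs n"
    and inp_def: "inp = (\<lambda>a. if a < length (encode s n Is c) then encode s n Is c ! a else 0)"
begin

lemma len: "length (encode s n Is c) = s + 2 + length Is * (s + N)"
  unfolding N_def by (rule length_encode)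

text \<open>For \<open>l\<close> beyond the family the address lies behind the encoding, where
  memory is zero; this realises the padding without any instruction.\<close>

lemma inp_set: "l < k \<Longrightarrow> r < s + N \<Longrightarrow>
   inp (s + 2 + l * (s + N) + r) = (if l < length Is then enc_set s n c (Is ! l) ! r else 0)"
proof (cases "l < length Is")
  case True
  assume r: "r < s + N"
  have "l * (s + N) + r < Suc l * (s + N)" using r by simp
  also have "\<dots> \<le> length Is * (s + N)" using True by (intro mult_le_mono1) simp
  finally show ?thesis using encode_nth(3)[OF True, of r s n c] True r unfolding inp_def len by (simp add: N_def)
next
  case False
  hence "length Is * (s + N) \<le> l * (s + N)" by (intro mult_le_mono1) simp
  hence "\<not> s + 2 + l * (s + N) + r < s + 2 + length Is * (s + N)" by linarith
  hence "inp (s + 2 + l * (s + N) + r) = 0" unfolding inp_def len by (rule if_not_P)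
  thus ?thesis using False by simp
qed

text \<open>The indicators extend each product over a set to all blocks by factors 1. A padded set
  has only such factors, whence the additive constant.\<close>

lemma obj_eq:
  fixes w :: "nat \<Rightarrow> nat \<Rightarrow> rat"
  assumes w: "\<And>p e. w p e = (if off (e mod s) \<le> p \<and> p < off (Suc (e mod s))
      then inp (2 * s + 2 + (e div s) * (s + N) + p) else 0)"
    and y0: "\<And>e. y0 e = 1 - inp (s + 2 + (e div s) * (s + N) + e mod s)"
    and A: "A \<subseteq> {..<N}"
    and x: "\<And>j i. j < s \<Longrightarrow> i < n (Suc j) \<Longrightarrow> x (Suc j) (Suc i) = (if off j + i \<in> A then 1 else 0)"
  shows "mlin k s (lin y0 w A) = objF n Is c x + of_nat (k - length Is)"
proof -
  let ?ip = "\<lambda>I j. \<Sum>i\<in>{1..n j}. c I j i * x j i"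
  have offN: "off (Suc j) \<le> N" if "j < s" for j
    unfolding off_def N_def using that by (intro offs_mono) simp
  have entry: "lin y0 w A (l * s + j) = (if l < length Is \<and> Suc j \<in> Is ! l then ?ip (Is ! l) (Suc j) else 1)"
    if l: "l < k" and j: "j < s" for l j
  proof -
    have e: "(l * s + j) div s = l" "(l * s + j) mod s = j" using j by simp_all
    have y: "y0 (l * s + j) = (if l < length Is \<and> Suc j \<in> Is ! l then 0 else 1)"
      unfolding y0 e using inp_set[OF l, of j] enc_set_nth(2)[OF j, of n c "Is ! l"] j by simp
    have wv: "w (off j + i) (l * s + j) = (if l < length Is \<and> Suc j \<in> Is ! l then c (Is ! l) (Suc j) (Suc i) else 0)"
      if i: "i < n (Suc j)" for i
    proof -
      have lt: "s + (off j + i) < s + N" using offN[OF j] i by (simp add: off_def)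
      have "w (off j + i) (l * s + j) = inp (2 * s + 2 + l * (s + N) + (off j + i))"
        unfolding w e using i by (simp add: off_def)
      also have "2 * s + 2 + l * (s + N) + (off j + i) = s + 2 + l * (s + N) + (s + (off j + i))" by simp
      finally have "w (off j + i) (l * s + j) = inp (s + 2 + l * (s + N) + (s + (off j + i)))" .
      thus ?thesis using inp_set[OF l lt] enc_set_nth(3)[where n = n and j = j and i = i and c = c and I = "Is ! l", OF j i] by (simp add: off_def)
    qed
    have shift: "(\<Sum>p\<in>{off j..<off j + n (Suc j)}. f p) = (\<Sum>i\<in>{0..<n (Suc j)}. f (off j + i))" for f :: "nat \<Rightarrow> rat"
      using sum.shift_bounds_nat_ivl[of f 0 "off j" "n (Suc j)"] by (simp add: add.commute)
    have "(\<Sum>p\<in>A. w p (l * s + j)) = (\<Sum>p\<in>{off j..<off j + n (Suc j)}. if p \<in> A then w p (l * s + j) else 0)"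
    proof -
      have fin: "finite A" using A finite_subset by blast
      have "(\<Sum>p\<in>A. w p (l * s + j)) = (\<Sum>p\<in>A \<inter> {off j..<off j + n (Suc j)}. w p (l * s + j))"
        using fin j by (intro sum.mono_neutral_right) (auto simp: w e off_def)
      also have "\<dots> = (\<Sum>p\<in>{off j..<off j + n (Suc j)}. if p \<in> A then w p (l * s + j) else 0)"
        by (subst Int_commute) (simp add: sum.inter_restrict)
      finally show ?thesis .
    qed
    also have "\<dots> = (\<Sum>i\<in>{0..<n (Suc j)}. if off j + i \<in> A then w (off j + i) (l * s + j) else 0)"
      by (rule shift)
    also have "\<dots> = (\<Sum>i\<in>{0..<n (Suc j)}. if l < length Is \<and> Suc j \<in> Is ! l
        then c (Is ! l) (Suc j) (Suc i) * x (Suc j) (Suc i) else 0)"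
      using x[OF j] wv by (intro sum.cong) auto
    also have "\<dots> = (if l < length Is \<and> Suc j \<in> Is ! l then ?ip (Is ! l) (Suc j) else 0)"
      by (cases "l < length Is \<and> Suc j \<in> Is ! l")
         (simp_all only: if_True if_False, simp_all add: sum.atLeast1_atMost_eq lessThan_atLeast0)
    finally show ?thesis unfolding lin_def y by simp
  qed
  have summand: "(\<Prod>j<s. lin y0 w A (l * s + j)) = (if l < length Is then (\<Prod>j\<in>Is ! l. ?ip (Is ! l) j) else 1)"
    if l: "l < k" for l
  proof (cases "l < length Is")
    case True
    hence sub: "Is ! l \<subseteq> {1..s}" using wf unfolding wf_instance_def by simp
    have "(\<Prod>j<s. lin y0 w A (l * s + j)) = (\<Prod>j<s. if Suc j \<in> Is ! l then ?ip (Is ! l) (Suc j) else 1)"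
      using entry[OF l] True by (intro prod.cong) auto
    also have "\<dots> = (\<Prod>j\<in>{1..s}. if j \<in> Is ! l then ?ip (Is ! l) j else 1)"
      by (simp add: prod.atLeast1_atMost_eq lessThan_atLeast0)
    also have "\<dots> = (\<Prod>j\<in>Is ! l. ?ip (Is ! l) j)"
      using sub by (intro prod.mono_neutral_cong_right) auto
    finally show ?thesis using True by simp
  next
    case False
    hence "(\<Prod>j<s. lin y0 w A (l * s + j)) = (\<Prod>j<s. 1)"
      using entry[OF l] by (intro prod.cong) auto
    thus ?thesis using False by simp
  qed
  have "mlin k s (lin y0 w A) = (\<Sum>l<k. if l < length Is then (\<Prod>j\<in>Is ! l. ?ip (Is ! l) j) else 1)"
    unfolding mlin_def using summand by (intro sum.cong) auto
  also have "\<dots> = (\<Sum>l\<in>{..<length Is}. \<Prod>j\<in>Is ! l. ?ip (Is ! l) j) + (\<Sum>l\<in>{length Is..<k}. 1)"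
  proof -
    have "{..<k} = {..<length Is} \<union> {length Is..<k}" using k by auto
    thus ?thesis by (simp add: sum.union_disjoint ivl_disj_int)
  qed
  \<comment> \<open>Distinctness of \<open>Is\<close> turns the sum over list positions into the sum
    over the family.\<close>
  also have "(\<Sum>l\<in>{..<length Is}. \<Prod>j\<in>Is ! l. ?ip (Is ! l) j) = objF n Is c x"
    unfolding objF_def using wf unfolding wf_instance_def
    by (intro sum.reindex_bij_betw bij_betw_nth) auto
  finally show ?thesis by simp
qed

end

section \<open>Resource bounds\<close>

text \<open>Register numbers depend only on \<open>s\<close> and \<open>k\<close>, so
  \<open>F\<close> can be a constant of the program.\<close>

lemma exists_reg_bound: "\<exists>F. (\<forall>c\<le>12. \<forall>i\<le>s + k + k * s + 10. rg c i < F) \<and> (\<forall>d<k * s. \<forall>e<k * s. rB d e < F)"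
proof -
  have "finite ((\<lambda>(c, i). rg c i) ` ({..12} \<times> {..s + k + k * s + 10}) \<union> (\<lambda>(d, e). rB d e) ` ({..<k * s} \<times> {..<k * s}))"
    by simp
  then obtain F where F: "\<forall>r\<in>((\<lambda>(c, i). rg c i) ` ({..12} \<times> {..s + k + k * s + 10}) \<union>
      (\<lambda>(d, e). rB d e) ` ({..<k * s} \<times> {..<k * s})). r < F"
    unfolding finite_nat_set_iff_bounded by blast
  thus ?thesis by (intro exI[of _ F]) force
qed

lemma hh_le: "hh S d + 1 \<le> 4 ^ d * (S + 1)"
  by (induction d) auto

text \<open>The three budgets of \<open>inst\<close> added up, with \<open>N\<close> and
  \<open>X\<close> replaced by their bounds \<open>S\<close> and \<open>2 ^ E * S\<close>.\<close>

definition hbound :: "nat \<Rightarrow> nat \<Rightarrow> nat \<Rightarrow> nat \<Rightarrow> nat \<Rightarrow> nat" where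
  "hbound s k F E S = 3 * hh S (k * s) + 1 + k * (s * (S * (S + 1) + S + 4) + 2) + (S * (S + 1) + S + 4) +
     s * (S * (S + 1) + S + 4) + 2 + 2 * (2 ^ E * S + F) + 2 * F + 2"

lemma hbound_le: "hbound s k F E S \<le> (3 * 4 ^ (k * s) + k * (4 * s + 2) + 4 * s + 2 * 2 ^ E + 4 * F + 9) * (S + 1) ^ 2"
proof -
  define Q where "Q = (S + 1) ^ 2"
  define Y where "Y = S * (S + 1) + S + 4"
  have Q1: "1 \<le> Q" "S + 1 \<le> Q" "S \<le> Q" by (simp_all add: Q_def power2_eq_square)
  have y: "Y \<le> 4 * Q" by (simp add: Y_def Q_def power2_eq_square)
  have h: "3 * hh S (k * s) \<le> 3 * (4 ^ (k * s) * Q)"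
    using hh_le[of S "k * s"] mult_le_mono2[OF Q1(2), of "4 ^ (k * s)"] by linarith
  have sy: "s * Y \<le> s * (4 * Q)" using y by (rule mult_le_mono2)
  have "s * Y + 2 \<le> s * (4 * Q) + 2 * Q" using sy Q1 by linarith
  hence ky: "k * (s * Y + 2) \<le> k * (s * (4 * Q) + 2 * Q)" by (rule mult_le_mono2)
  have e: "2 ^ E * S \<le> 2 ^ E * Q" using Q1 by (intro mult_le_mono2)
  have f: "F \<le> F * Q" using Q1 by simp
  have arith: "3 * h + 1 + a + Y + b + 2 + 2 * (e + f) + 2 * f + 2 \<le> h' + Q + a' + 4 * Q + b' + 2 * Q + 2 * (e' + f') + 2 * f' + 2 * Q"
    if "3 * h \<le> h'" "b \<le> b'" "a \<le> a'" "e \<le> e'" "f \<le> f'" for h h' a a' b b' e e' f f'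
    using y Q1(1) that by presburger
  have "hbound s k F E S \<le> 3 * (4 ^ (k * s) * Q) + Q + k * (s * (4 * Q) + 2 * Q) + 4 * Q +
     s * (4 * Q) + 2 * Q + 2 * (2 ^ E * Q + F * Q) + 2 * (F * Q) + 2 * Q"
    unfolding hbound_def Y_def[symmetric] by (rule arith[OF h sy ky e f])
  also have "\<dots> = (3 * 4 ^ (k * s) + k * (4 * s + 2) + 4 * s + 2 * 2 ^ E + 4 * F + 9) * Q"
    by (simp add: algebra_simps)
  finally show ?thesis by (simp add: Q_def)
qed

theorem theorem1:
  fixes s k :: nat
  assumes "s > 0"
  shows "\<exists>P C D. solves_F_strongly_poly s k P C D"
proof -
  obtain F where F: "\<And>c i. c \<le> 12 \<Longrightarrow> i \<le> s + k + k * s + 10 \<Longrightarrow> rg c i < F"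
    "\<And>d e. d < k * s \<Longrightarrow> e < k * s \<Longrightarrow> rB d e < F"
    using exists_reg_bound[of s k] by blast
  \<comment> \<open>Since \<open>2 ^ E\<close> exceeds \<open>E\<close>, the address
    \<open>2 ^ E * N\<close> is at least \<open>E * N\<close>, which leaves room for the registers
    and for an input with \<open>k\<close> sets. \<open>E\<close> is independent of the
    instance.\<close>
  define E where "E = F + (2 * s + 2 + k * (s + 1))"
  define main where "main = alg.mainc s k F E"
  define P where "P = compile 0 main"
  obtain C1 D1 where cost: "\<And>M. cost M main \<le> C1 * (M + 1) ^ D1" using cost_poly by blast
  define C2 where "C2 = 3 * 4 ^ (k * s) + k * (4 * s + 2) + 4 * s + 2 * 2 ^ E + 4 * F + (9 :: nat)"
  \<comment> \<open>\<open>C1\<close> serves the running time; \<open>2 * C2 + 1\<close> comes from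
    \<open>rat_size\<close> being at most \<open>2 * H + 1\<close>, with \<open>H\<close> quadratic
    in the input size.\<close>
  define C where "C = C1 + 2 * C2 + 1"
  define Deg where "Deg = D1 + 2"
  have "solves_F_strongly_poly s k P C Deg"
    unfolding solves_F_strongly_poly_def Let_def
  proof (intro allI impI, elim conjE)
    fix n Is c assume wf: "wf_instance s n Is" and k: "length Is \<le> k"
    define xs where "xs = encode s n Is c"
    define N where "N = offs n s"
    define off where "off = offs n"
    define inp where inp_eq: "inp = (\<lambda>a. if a < length xs then xs ! a else 0)"
    define S where "S = input_size xs"
    define H where "H = hbound s k F E S"
    define X where "X = 2 ^ E * N"
    interpret encoded s k n Is c N inp off
      by unfold_locales (use wf k in \<open>auto simp: N_def off_def inp_eq xs_def\<close>)
    have len: "length xs = s + 2 + length Is * (s + N)" unfolding xs_def by (rule len)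
    have "length Is \<noteq> 0" using wf by (simp add: wf_instance_def)
    hence "1 \<le> length Is" by linarith
    hence "1 * (s + N) \<le> length Is * (s + N)" by (rule mult_le_mono1)
    hence "N \<le> length Is * (s + N)" by (metis add_leE mult_1)
    hence Nlen: "N \<le> length xs" "0 < length xs" unfolding len by (rule trans_le_add2) simp
    have lenS: "length xs \<le> S" unfolding S_def input_size_def by simp
    have S0: "0 < S" using lenS Nlen(2) by linarith
    have "n (Suc 0) > 0" using wf assms unfolding wf_instance_def by auto
    moreover have "offs n (Suc 0) \<le> N" unfolding N_def using assms by (intro offs_mono) simp
    ultimately have N0: "0 < N" by simp
    have inpS: "bnd S (inp a)" for a
    proof (cases "a < length xs")
      case True
      hence "rat_size (xs ! a) \<le> sum_list (map rat_size xs)" by (intro member_le_sum_list) auto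
      thus ?thesis using True unfolding inp_eq S_def input_size_def by (auto intro: bnd_rat_size)
    next
      case False
      thus ?thesis using S0 by (simp add: inp_eq bnd_0)
    qed
    have EN: "E * N \<le> X" unfolding X_def using less_exp[of E] by (intro mult_le_mono1) simp
    have N1: "a \<le> a * N" for a using N0 by simp
    have addr: "F + (2 * s + 2 + k * (s + N)) \<le> X"
    proof -
      have "k * (s + N) \<le> k * (s + 1) * N"
        unfolding mult.assoc using N1[of s] by (intro mult_le_mono2) simp
      moreover have "E * N = F * N + (2 * s + 2) * N + k * (s + 1) * N" by (simp add: E_def algebra_simps)
      ultimately show ?thesis using N1[of F] N1[of "2 * s + 2"] EN by linarith
    qed
    have "length xs \<le> X" using addr mult_le_mono1[OF k, of "s + N"] unfolding len by linarith
    have NX: "N \<le> X" unfolding X_def by simp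
    have NS: "N \<le> S" using Nlen lenS by simp
    interpret inst2 s k F N X "X + F" H N S inp off E
    proof
      have 1: "N * (S + 1) \<le> S * (S + 1)" using NS by (rule mult_le_mono1)
      hence 2: "N * (S + 1) + S + 4 \<le> S * (S + 1) + S + 4" by simp
      have 3: "s * (N * (S + 1) + S + 4) \<le> s * (S * (S + 1) + S + 4)" using 2 by (rule mult_le_mono2)
      hence 4: "s * (N * (S + 1) + S + 4) + 2 \<le> s * (S * (S + 1) + S + 4) + 2" by simp
      have 5: "k * (s * (N * (S + 1) + S + 4) + 2) \<le> k * (s * (S * (S + 1) + S + 4) + 2)"
        using 4 by (rule mult_le_mono2)
      show "k * (s * (N * (S + 1) + S + 4) + 2) + N * (S + 1) + S + 4 + s * (N * (S + 1) + S + 4) + 2 \<le> H"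
        unfolding H_def hbound_def using 2 3 5 by linarith
      show "hh S (k * s) + hh S (k * s) + hh S (k * s) + 1 \<le> H" unfolding H_def hbound_def by simp
      have "X \<le> 2 ^ E * S" unfolding X_def using NS by (rule mult_le_mono2)
      hence "2 * (X + F) + 2 * F + 2 \<le> 2 * (2 ^ E * S + F) + 2 * F + 2" by simp
      also have "\<dots> \<le> H" unfolding H_def hbound_def by simp
      finally show "2 * (X + F) + 2 * F + 2 \<le> H" .
      show "inp (Suc j) = of_nat (off (Suc j) - off j)" if "j < s" for j
      proof -
        have "Suc j < length xs" using that len by simp
        thus ?thesis using encode_nth(2)[OF that, of n Is c] by (simp add: inp_eq xs_def off_def)
      qed
      show "inp a = 0" if "X \<le> a" for a using that \<open>length xs \<le> X\<close> by (simp add: inp_eq)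
    qed (use assms N0 S0 addr NX inpS F in \<open>auto simp: off_def N_def X_def offs_def\<close>)
    have good0: "good H inp"
    proof -
      have "S \<le> H" unfolding H_def hbound_def by simp
      thus ?thesis unfolding good_def using inpS bnd_mono by blast
    qed
    have "code_at P 0 (compile 0 main)" by (simp add: code_at_def P_def)
    from wpD[OF wp_mainc good0, folded main_def, OF this] obtain t m' where
      t: "t \<le> cost N main" and reach: "reach H P t (0, inp) (0 + clen main, m')" and
      ex: "\<exists>A\<subseteq>{..<N}. (\<forall>p<N. m' p = (if p \<in> A then 1 else 0)) \<and> (\<forall>A'\<subseteq>{..<N}. Obj A' \<le> Obj A)" .
    obtain A where A: "A \<subseteq> {..<N}" "\<And>p. p < N \<Longrightarrow> m' p = (if p \<in> A then 1 else 0)"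
      "\<And>A'. A' \<subseteq> {..<N} \<Longrightarrow> Obj A' \<le> Obj A" using ex by blast
    have run: "run P xs u = (step P ^^ u) (0, inp)" for u
      unfolding run_def init_config_def inp_eq ..
    have fin: "run P xs t = (clen main, m')" using reach unfolding run reach_def by simp
    have pos: "off j + i < N" if "j < s" "i < n (Suc j)" for j i
    proof -
      have "off (Suc j) \<le> N" unfolding off_def N_def using that by (intro offs_mono) simp
      thus ?thesis using that by (simp add: off_def)
    qed
    have x: "output_x n m' (Suc j) (Suc i) = (if off j + i \<in> A then 1 else 0)" if "j < s" "i < n (Suc j)" for j i
      using A(2)[OF pos[OF that]] by (simp add: output_x_def out_pos_offs off_def)
    have Suc: "\<exists>j' i'. j = Suc j' \<and> i = Suc i' \<and> j' < s \<and> i' < n (Suc j')" if "j \<in> {1..s}" "i \<in> {1..n j}" for j i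
      using that by (cases j; cases i) auto
    have opt: "objF n Is c y \<le> objF n Is c (output_x n m')" if y: "is_binary s n y" for y
    proof -
      define A' where "A' = {off j + i | j i. j < s \<and> i < n (Suc j) \<and> y (Suc j) (Suc i) = 1}"
      have A'N: "A' \<subseteq> {..<N}" using pos by (auto simp: A'_def)
      have "y (Suc j) (Suc i) = (if off j + i \<in> A' then 1 else 0)" if "j < s" "i < n (Suc j)" for j i
      proof (cases "y (Suc j) (Suc i) = 1")
        case True
        thus ?thesis using that by (auto simp: A'_def)
      next
        case False
        have "y (Suc j) (Suc i) \<in> {0, 1}" using y that unfolding is_binary_def by auto
        hence "y (Suc j) (Suc i) = 0" using False by simp
        moreover have "off j + i \<notin> A'"
        proof
          assume "off j + i \<in> A'"
          then obtain j' i' where "off j + i = off j' + i'" "j' < s" "i' < n (Suc j')" "y (Suc j') (Suc i') = 1"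
            by (auto simp: A'_def)
          with offs_inj[of n j i j' i'] that False show False by (auto simp: off_def)
        qed
        ultimately show ?thesis by simp
      qed
      \<comment> \<open>The constant contributed by the padding is the same for both solutions and
        cancels.\<close>
      from obj_eq[OF w_def y0_def A'N this] obj_eq[OF w_def y0_def A(1) x] A(3)[OF A'N] show ?thesis by simp
    qed
    have time: "t \<le> C * (length xs + 1) ^ Deg"
    proof -
      have "t \<le> C1 * (N + 1) ^ D1" using t cost le_trans by blast
      also have "\<dots> \<le> C * (length xs + 1) ^ Deg"
      proof (rule mult_le_mono)
        show "C1 \<le> C" by (simp add: C_def)
        have "(N + 1) ^ D1 \<le> (length xs + 1) ^ D1" using Nlen by (intro power_mono) auto
        also have "\<dots> \<le> (length xs + 1) ^ Deg" unfolding Deg_def by (intro power_increasing) auto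
        finally show "(N + 1) ^ D1 \<le> (length xs + 1) ^ Deg" .
      qed
      finally show ?thesis .
    qed
    have size: "rat_size (snd (run P xs u) a) \<le> C * (input_size xs + 1) ^ Deg" if "u \<le> t" for u a
    proof -
      have "bnd H (snd (run P xs u) a)" using reach that unfolding run reach_def good_def by blast
      hence "rat_size (snd (run P xs u) a) \<le> 2 * H + 1" by (rule rat_size_le)
      also have "\<dots> \<le> 2 * (C2 * (S + 1) ^ 2) + (S + 1) ^ 2"
        using hbound_le[of s k F E S] unfolding H_def C2_def by (intro add_mono mult_le_mono2) auto
      also have "\<dots> = (2 * C2 + 1) * (S + 1) ^ 2" by (simp add: algebra_simps)
      also have "\<dots> \<le> C * (S + 1) ^ Deg"
        by (intro mult_le_mono power_increasing) (auto simp: C_def Deg_def)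
      finally show ?thesis by (simp add: S_def)
    qed
    have bin: "is_binary s n (output_x n m')" unfolding is_binary_def
    proof (intro ballI)
      fix j i assume "j \<in> {1..s}" "i \<in> {1..n j}"
      then obtain j' i' where "j = Suc j'" "i = Suc i'" "j' < s" "i' < n (Suc j')" using Suc by blast
      thus "output_x n m' j i \<in> {0, 1}" using x by simp
    qed
    show "\<exists>t\<le>C * (length (encode s n Is c) + 1) ^ Deg. halted P (run P (encode s n Is c) t) \<and>
          (\<forall>t'\<le>t. \<forall>a. rat_size (snd (run P (encode s n Is c) t') a) \<le> C * (input_size (encode s n Is c) + 1) ^ Deg) \<and>
          is_binary s n (output_x n (snd (run P (encode s n Is c) t))) \<and>
          (\<forall>y. is_binary s n y \<longrightarrow>
             objF n Is c y \<le> objF n Is c (output_x n (snd (run P (encode s n Is c) t))))"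
      unfolding xs_def[symmetric]
    proof (intro exI[of _ t] conjI allI impI)
      \<comment> \<open>The program contains no final \<open>Halt\<close>; it stops because the
        counter has reached its length.\<close>
      show "halted P (run P xs t)" unfolding fin halted_def by (simp add: P_def)
    qed (use time size opt bin in \<open>simp_all add: fin\<close>)
  qed
  thus ?thesis by blast
qed

end
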